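(* Let $p\in(2,3)$ and $q\in\big[p,\max\big(p,\tfrac{p-2}{3-p}\big)\big]$. Assume that $\mu$ is strictly contracting, admits a moment of order $p$ and almost admits a moment of order $q$. Let $s^2=\lim_{n\to+\infty}\frac1n\mathbb E[(\sigma(A_n,W_0)-n\lambda_\mu)^2]$, where $W_0$ has law $\nu$ and is independent of $(Y_n)_{n\in\mathbb N}$, and assume that $s^2>0$. Set $v_n=\big(\frac1n\big)^{p/2-1}$ if $p\in(2,1+\sqrt3]$ and $v_n=\big(\frac1n\big)^{q/(2(q+1))}$ if $p\in(1+\sqrt3,3)$. Then $$\sup_{t\in\mathbb R}\Big|\mathbb P\big(\log v(A_n)-n\lambda_\mu\le t\sqrt n\big)-\Phi(t/s)\Big|=O(v_n)$$ and $$\sup_{t\in\mathbb R}\Big|\mathbb P\big(\log\kappa(A_n)-n\lambda_\mu\le t\sqrt n\big)-\Phi(t/s)\Big|=O(v_n).$$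
   Context: Let $d\ge 2$ be an integer and $\mathbb N=\{1,2,\dots\}$. $\|\cdot\|$ denotes the $\ell^1$ norm on $\mathbb R^d$ and also the associated operator norm on $d\times d$ matrices. $G$ is the semigroup of $d\times d$ real matrices with nonnegative entries such that every row and every column contains a strictly positive entry, with the topology induced by the norm; $G^+\subset G$ is the set of matrices all of whose entries are strictly positive. $S^+=\{x\in\mathbb R^d:\|x\|=1,\ x_i\ge 0\ \forall i\}$, equipped with the metric $\mathbf d(x,y)=\varphi(m(x,y)m(y,x))$, where $\varphi(s)=\frac{1-s}{1+s}$ and $m(x,y)=\inf\{x_i/y_i: 1\le i\le d,\ y_i>0\}$; Borel sets of $S^+$ refer to $\mathbf d$. For $g\in G$: $v(g)=\inf_{x\in S^+}\|gx\|$, $N(g)=\max(\|g\|,1/v(g))$, $L(g)=\|g\|/v(g)$, and $\kappa(g)$ is the spectral radius of $g$. (The function $v(\cdot)$ on $G$ and the numerical sequence $v_n$ are unrelated.) For $(g,x)\in G\times S^+$, $g\cdot x=gx/\|gx\|$ and $\sigma(g,x)=\log\|gx\|$. $\mu$ is a Borel probability measure on $G$; $\mu^{*r}$ is its $r$-fold convolution (the law of a product of $r$ independent matrices of law $\mu$). $\mu$ is strictly contracting if $\mu^{*r}(G^+)>0$ for some $r\in\mathbb N$. $\mu$ admits a moment of order $p\ge1$ if $\int_G(\log N(g))^p\,d\mu(g)<\infty$, and almost admits a moment of order $q\ge 1$ if $\int_G(\log L(g))^q\,d\mu(g)<\infty$. When $\mu$ is strictly contracting there is a unique $\mu$-invariant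 Borel probability measure $\nu$ on $S^+$, i.e. $\int f(g\cdot x)\,d\mu(g)d\nu(x)=\int f\,d\nu$ for all nonnegative Borel $f$. $(Y_n)_{n\in\mathbb N}$ are iid with law $\mu$ and $A_n=Y_n\cdots Y_1$. $\lambda_\mu\in\mathbb R$ is the almost sure (and $L^1$) limit of $\frac1n\log\|A_n\|$, which exists and is constant as soon as $\int_G|\log\|g\||\,d\mu(g)<\infty$. If $\mu$ is strictly contracting and admits a moment of order $2$, the limit defining $s^2$ exists in $[0,\infty)$; $s=\sqrt{s^2}$. $\Phi$ is the standard normal distribution function. *)

theory Defs
  imports "HOL-Probability.Probability" "HOL-Library.Landau_Symbols"
begin

definition l1norm :: "real ^ 'n \<Rightarrow> real" where
  "l1norm x = (\<Sum>i\<in>UNIV. \<bar>x $ i\<bar>)"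

text \<open>The operator norm induced by the \<open>\<ell>\<^sup>1\<close> norm; the quotient at \<open>x = 0\<close> is
  \<open>0 / 0 = 0\<close> and does not affect the supremum (same convention as \<^const>\<open>onorm\<close>).\<close>

definition opnorm :: "real ^ 'n ^ 'n \<Rightarrow> real" where
  "opnorm g = (SUP x. l1norm (g *v x) / l1norm x)"

definition Gset :: "(real ^ 'n ^ 'n) set" where
  "Gset = {g. (\<forall>i j. 0 \<le> g $ i $ j) \<and> (\<forall>i. \<exists>j. 0 < g $ i $ j) \<and> (\<forall>j. \<exists>i. 0 < g $ i $ j)}"

definition Gplus :: "(real ^ 'n ^ 'n) set" where
  "Gplus = {g. \<forall>i j. 0 < g $ i $ j}"

text \<open>All norms on matrices induce the standard topology, so the Borel \<open>\<sigma>\<close>-algebra of \<open>G\<close> is the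
  trace of the standard one.\<close>

definition G_borel :: "(real ^ 'n ^ 'n) measure" where
  "G_borel = restrict_space borel Gset"

definition Splus :: "(real ^ 'n) set" where
  "Splus = {x. l1norm x = 1 \<and> (\<forall>i. 0 \<le> x $ i)}"

definition mratio :: "real ^ 'n \<Rightarrow> real ^ 'n \<Rightarrow> real" where
  "mratio x y = Inf {x $ i / y $ i | i. 0 < y $ i}"

text \<open>Extended by \<open>0\<close> outside \<^const>\<open>Splus\<close>, since \<^const>\<open>Metric_space\<close> requires the
  distance function to be nonnegative and symmetric on the whole type.\<close>

definition proj_dist :: "real ^ 'n \<Rightarrow> real ^ 'n \<Rightarrow> real" where
  "proj_dist x y =
     (if x \<in> Splus \<and> y \<in> Splus
      then let s = mratio x y * mratio y x in (1 - s) / (1 + s) else 0)"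

lemma
  fixes x y :: "real ^ 'n"
  assumes x: "x \<in> Splus" and y: "y \<in> Splus"
  shows mratio_nonneg: "0 \<le> mratio x y"
    and mratio_mult_le: "mratio x y * y $ i \<le> x $ i"
    and mratio_le_1: "mratio x y \<le> 1"
    and mratio_greatest: "(\<And>i. 0 < y $ i \<Longrightarrow> c \<le> x $ i / y $ i) \<Longrightarrow> c \<le> mratio x y"
proof -
  have x0: "0 \<le> x $ i" and y0: "0 \<le> y $ i" for i using x y by (auto simp: Splus_def)
  have sx: "(\<Sum>i\<in>UNIV. x $ i) = 1" and sy: "(\<Sum>i\<in>UNIV. y $ i) = 1"
    using x y by (auto simp: Splus_def l1norm_def)
  obtain k where k: "0 < y $ k"
    using sy y0 by (metis less_eq_real_def sum.neutral zero_neq_one)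
  let ?R = "{x $ i / y $ i | i. 0 < y $ i}"
  have ne: "?R \<noteq> {}" using k by blast
  have fin: "finite ?R" by simp
  show ge: "c \<le> mratio x y" if "\<And>i. 0 < y $ i \<Longrightarrow> c \<le> x $ i / y $ i" for c
    unfolding mratio_def using ne that by (intro cInf_greatest) auto
  show "0 \<le> mratio x y" using x0 by (intro ge) simp
  show le: "mratio x y * y $ i \<le> x $ i" for i
  proof (cases "0 < y $ i")
    case True
    then have "mratio x y \<le> x $ i / y $ i"
      unfolding mratio_def using fin by (intro cInf_lower bdd_below_finite) auto
    then show ?thesis using True by (simp add: pos_le_divide_eq)
  next
    case False
    then have "y $ i = 0" using y0[of i] by simp
    then show ?thesis using x0[of i] by simp
  qed
  have "(\<Sum>i\<in>UNIV. mratio x y * y $ i) \<le> (\<Sum>i\<in>UNIV. x $ i)" by (intro sum_mono le)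
  then show "mratio x y \<le> 1" using sx sy by (simp flip: sum_distrib_left)
qed

lemma mratio_self: "x \<in> Splus \<Longrightarrow> mratio x x = 1"
  by (intro antisym mratio_le_1 mratio_greatest) auto

lemma mratio_eq_1:
  assumes x: "x \<in> Splus" and y: "y \<in> Splus" and eq: "mratio x y = 1"
  shows "x = y"
proof -
  have le: "y $ i \<le> x $ i" for i using mratio_mult_le[OF x y, of i] eq by simp
  have "(\<Sum>i\<in>UNIV. x $ i - y $ i) = 0"
    using x y by (auto simp: Splus_def l1norm_def sum_subtractf)
  then have "x $ i - y $ i = 0" for i
    using le by (subst (asm) sum_nonneg_eq_0_iff) auto
  then show ?thesis by (simp add: vec_eq_iff)
qed

lemma mratio_trans:
  assumes x: "x \<in> Splus" and y: "y \<in> Splus" and z: "z \<in> Splus"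
  shows "mratio x y * mratio y z \<le> mratio x z"
proof (rule mratio_greatest[OF x z])
  fix i assume i: "0 < z $ i"
  have "mratio x y * (mratio y z * z $ i) \<le> mratio x y * y $ i"
    by (intro mult_left_mono mratio_mult_le mratio_nonneg x y z)
  also have "\<dots> \<le> x $ i" by (rule mratio_mult_le[OF x y])
  finally show "mratio x y * mratio y z \<le> x $ i / z $ i"
    using i by (simp add: pos_le_divide_eq mult.assoc)
qed

lemma phi_subadditive:
  fixes a b c :: real
  assumes "0 \<le> a" "a \<le> 1" "0 \<le> b" "b \<le> 1" "a * b \<le> c"
  shows "(1 - c) / (1 + c) \<le> (1 - a) / (1 + a) + (1 - b) / (1 + b)"
proof -
  have ab: "0 \<le> a * b" "a * b \<le> 1" using assms by (auto intro: mult_le_one)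
  have "(1 - c) / (1 + c) \<le> (1 - a * b) / (1 + a * b)"
    using ab assms(5) by (intro frac_le; linarith)
  also have "\<dots> \<le> 2 * (1 - a * b) / ((1 + a) * (1 + b))"
  proof -
    have "0 \<le> (1 - a) * (1 - b)" using assms by simp
    then have "(1 + a) * (1 + b) \<le> 2 * (1 + a * b)" by (simp add: algebra_simps)
    moreover have "0 < (1 + a) * (1 + b)" using assms by simp
    ultimately have "2 * (1 - a * b) / (2 * (1 + a * b)) \<le> 2 * (1 - a * b) / ((1 + a) * (1 + b))"
      using ab by (intro frac_le) simp_all
    moreover have "2 * (1 - a * b) / (2 * (1 + a * b)) = (1 - a * b) / (1 + a * b)"
      by (rule mult_divide_mult_cancel_left) simp
    ultimately show ?thesis by (simp only:)
  qed
  also have "\<dots> = (1 - a) / (1 + a) + (1 - b) / (1 + b)"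
    using assms by (simp add: divide_simps) (simp add: algebra_simps)
  finally show ?thesis .
qed

lemma Metric_space_Splus: "Metric_space (Splus :: (real ^ 'n) set) proj_dist"
proof
  have s01: "0 \<le> mratio x y * mratio y x" "mratio x y * mratio y x \<le> 1"
    if "x \<in> Splus" "y \<in> Splus" for x y :: "real ^ 'n"
    using that by (auto intro!: mult_nonneg_nonneg mult_le_one mratio_nonneg mratio_le_1)
  fix x y z :: "real ^ 'n"
  show "0 \<le> proj_dist x y" using s01[of x y] by (auto simp: proj_dist_def Let_def)
  show "proj_dist x y = proj_dist y x" by (auto simp: proj_dist_def Let_def mult.commute)
  show "proj_dist x y = 0 \<longleftrightarrow> x = y" if xy: "x \<in> Splus" "y \<in> Splus"
  proof
    assume "proj_dist x y = 0"
    then have eq: "mratio x y * mratio y x = 1"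
      using s01[OF xy] xy by (auto simp: proj_dist_def Let_def)
    have "mratio x y * mratio y x \<le> mratio x y * 1"
      by (intro mult_left_mono mratio_le_1 mratio_nonneg xy)
    then show "x = y" using eq mratio_le_1[OF xy] by (intro mratio_eq_1 xy) auto
  qed (use xy in \<open>simp add: proj_dist_def mratio_self\<close>)
  show "proj_dist x z \<le> proj_dist x y + proj_dist y z"
    if x: "x \<in> Splus" and y: "y \<in> Splus" and z: "z \<in> Splus"
  proof -
    have "(mratio x y * mratio y z) * (mratio z y * mratio y x) \<le> mratio x z * mratio z x"
      by (intro mult_mono mratio_trans mult_nonneg_nonneg mratio_nonneg x y z)
    then have "(mratio x y * mratio y x) * (mratio y z * mratio z y) \<le> mratio x z * mratio z x"
      by (simp add: ac_simps)
    then show ?thesis unfolding proj_dist_def Let_def using x y z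
      by (simp add: phi_subadditive s01)
  qed
qed

text \<open>The topology of \<^const>\<open>proj_dist\<close> is strictly finer than the Euclidean one on \<^const>\<open>Splus\<close>:
  points with different supports are at distance \<open>1\<close>.\<close>

definition Splus_borel :: "(real ^ 'n) measure" where
  "Splus_borel = sigma Splus {U. openin (Metric_space.mtopology Splus proj_dist) U}"

definition vmin :: "real ^ 'n ^ 'n \<Rightarrow> real" where
  "vmin g = (INF x\<in>Splus. l1norm (g *v x))"

definition Nmat :: "real ^ 'n ^ 'n \<Rightarrow> real" where
  "Nmat g = max (opnorm g) (1 / vmin g)"

definition Lmat :: "real ^ 'n ^ 'n \<Rightarrow> real" where
  "Lmat g = opnorm g / vmin g"

definition complex_eigenvalues :: "real ^ 'n ^ 'n \<Rightarrow> complex set" where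
  "complex_eigenvalues g =
     {z. \<exists>x :: complex ^ 'n. x \<noteq> 0 \<and> (\<chi> i j. complex_of_real (g $ i $ j)) *v x = z *s x}"

definition spec_rad :: "real ^ 'n ^ 'n \<Rightarrow> real" where
  "spec_rad g = Max (cmod ` complex_eigenvalues g)"

definition act :: "real ^ 'n ^ 'n \<Rightarrow> real ^ 'n \<Rightarrow> real ^ 'n" where
  "act g x = (g *v x) /\<^sub>R l1norm (g *v x)"

definition cocycle :: "real ^ 'n ^ 'n \<Rightarrow> real ^ 'n \<Rightarrow> real" where
  "cocycle g x = ln (l1norm (g *v x))"

text \<open>\<open>left_prod y n = y n ** \<dots> ** y 1\<close>; the entry \<open>y 0\<close> is never used.\<close>

primrec left_prod :: "(nat \<Rightarrow> real ^ 'n ^ 'n) \<Rightarrow> nat \<Rightarrow> real ^ 'n ^ 'n" where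
  "left_prod y 0 = mat 1"
| "left_prod y (Suc n) = y (Suc n) ** left_prod y n"

definition conv_power :: "(real ^ 'n ^ 'n) measure \<Rightarrow> nat \<Rightarrow> (real ^ 'n ^ 'n) measure" where
  "conv_power \<mu> r = distr (\<Pi>\<^sub>M k\<in>{1..r}. \<mu>) G_borel (\<lambda>y. left_prod y r)"

definition strictly_contracting :: "(real ^ 'n ^ 'n) measure \<Rightarrow> bool" where
  "strictly_contracting \<mu> \<longleftrightarrow> (\<exists>r\<ge>1. measure (conv_power \<mu> r) Gplus > 0)"

text \<open>On \<^const>\<open>Gset\<close> both \<^const>\<open>Nmat\<close> and \<^const>\<open>Lmat\<close> are at least \<open>1\<close>, so the
  integrands below are powers of nonnegative reals.\<close>

definition has_moment :: "(real ^ 'n ^ 'n) measure \<Rightarrow> real \<Rightarrow> bool" where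
  "has_moment \<mu> p \<longleftrightarrow> (\<integral>\<^sup>+ g. ennreal (ln (Nmat g) powr p) \<partial>\<mu>) < \<infinity>"

definition almost_has_moment :: "(real ^ 'n ^ 'n) measure \<Rightarrow> real \<Rightarrow> bool" where
  "almost_has_moment \<mu> q \<longleftrightarrow> (\<integral>\<^sup>+ g. ennreal (ln (Lmat g) powr q) \<partial>\<mu>) < \<infinity>"

definition invariant_prob :: "(real ^ 'n ^ 'n) measure \<Rightarrow> (real ^ 'n) measure \<Rightarrow> bool" where
  "invariant_prob \<mu> \<nu> \<longleftrightarrow>
     prob_space \<nu> \<and> sets \<nu> = sets Splus_borel \<and>
     (\<forall>f :: real ^ 'n \<Rightarrow> ennreal. f \<in> borel_measurable Splus_borel \<longrightarrow>
        (\<integral>\<^sup>+ x. (\<integral>\<^sup>+ g. f (act g x) \<partial>\<mu>) \<partial>\<nu>) = (\<integral>\<^sup>+ x. f x \<partial>\<nu>))"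

text \<open>Independence of two random variables whose values may have different types; the library's
  \<open>prob_space.indep_var\<close> requires a common value type.\<close>

definition indep_rv ::
  "'a measure \<Rightarrow> 'b measure \<Rightarrow> ('a \<Rightarrow> 'b) \<Rightarrow> 'c measure \<Rightarrow> ('a \<Rightarrow> 'c) \<Rightarrow> bool" where
  "indep_rv M S X T Z \<longleftrightarrow>
     X \<in> measurable M S \<and> Z \<in> measurable M T \<and>
     prob_space.indep_set M {X -` B \<inter> space M | B. B \<in> sets S} {Z -` C \<inter> space M | C. C \<in> sets T}"

definition rate :: "real \<Rightarrow> real \<Rightarrow> nat \<Rightarrow> real" where
  "rate p q n = (if p \<le> 1 + sqrt 3 then (1 / real n) powr (p / 2 - 1)
                 else (1 / real n) powr (q / (2 * (q + 1))))"

end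

theory Submission
  imports Defs "HOL-Real_Asymp.Real_Asymp"
begin

text \<open>Fix a starting point \<open>x\<^sub>0\<close>. Solving the Poisson equation for the mean of the cocycle turns
  \<open>\<sigma> A\<^sub>n x\<^sub>0 - n lam\<close> into a martingale up to a bounded error, and every quantity between
  \<open>ln (vmin A\<^sub>n)\<close> and \<open>ln (opnorm A\<^sub>n)\<close>, in particular \<open>ln (spec_rad A\<^sub>n)\<close>, differs from it by at
  most \<open>ln (Lmat A\<^sub>n) + O(1)\<close>, whose moment of order \<open>q\<close> is bounded uniformly in \<open>n\<close> because a
  product containing a strictly positive block forgets the factors to the left of that block.

  For the martingale the rate is \<open>n powr (1 - p / 2)\<close>. Its characteristic function is \<open>Q\<^sub>t\<^sup>n 1\<close> for
  a transfer operator \<open>Q\<^sub>t\<close> on Lipschitz functions. If \<open>u\<close> solves the Poisson equation of the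
  conditional variance, then \<open>f\<^sub>t = 1 - t\<^sup>2 u / 2\<close> satisfies
  \<open>Q\<^sub>t f\<^sub>t = exp (- s2 t\<^sup>2 / 2) f\<^sub>t + O(\<bar>t\<bar> powr p)\<close> in Lipschitz norm, and \<open>Q\<^sub>t\<close> contracts a norm adapted
  to the splitting along \<open>f\<^sub>t\<close> by \<open>exp (- c t\<^sup>2)\<close>. Telescoping gives
  \<open>Q\<^sub>t\<^sup>n 1 x\<^sub>0 = exp (- n s2 t\<^sup>2 / 2) + O((t\<^sup>2 + n \<bar>t\<bar> powr p) exp (- c n t\<^sup>2))\<close>, and Esseen smoothing
  yields the rate. Truncating \<open>ln (Lmat A\<^sub>n)\<close> at \<open>n powr (1 / (2 (q + 1)))\<close> transfers it to the
  quantities of interest.\<close>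

section \<open>Esseen smoothing\<close>

text \<open>No eigenfunction of \<open>Q t\<close> is ever constructed. An approximate one suffices,
  because an error of size |t|^p per step, added n times and damped by exp (- c n t^2), costs only
  n^(1 - p/2) once t is rescaled by sqrt n. For this the term linear in t must vanish at every
  starting point and not only on average, which is what the first Poisson equation achieves; the
  second one makes the quadratic term constant in x. The errors must be small in Lipschitz norm as
  well, so one function \<open>el\<close> dominates both the size and the Lipschitz constant of the
  cocycle and carries the moment of order p. Truncation at a level tau costs tau^(-q) from the tail
  and tau / sqrt n from the Lipschitz continuity of the normal distribution function. Equating the
  two gives the exponent 1 / (2 (q + 1)) and the rate n^(- q / (2 (q + 1))). For q = p this rate and
  n^(1 - p/2) coincide at the positive root 1 + sqrt 3 of p^2 - 2 p - 2.\<close>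

lemma Fubini_bounded:
  fixes f :: "'a \<Rightarrow> 'b \<Rightarrow> 'c :: {banach, second_countable_topology}"
  assumes "finite_measure M" "finite_measure N"
    and [measurable]: "(\<lambda>(x, y). f x y) \<in> borel_measurable (M \<Otimes>\<^sub>M N)"
    and bd: "\<And>x y. norm (f x y) \<le> B"
  shows "(LINT x|M. LINT y|N. f x y) = (LINT y|N. LINT x|M. f x y)"
proof -
  interpret M: finite_measure M by fact
  interpret N: finite_measure N by fact
  interpret P: pair_sigma_finite M N ..
  interpret MN: finite_measure "M \<Otimes>\<^sub>M N"
    by (rule finite_measure_pair_measure) fact+
  have "integrable (M \<Otimes>\<^sub>M N) (\<lambda>(x, y). f x y)"
    by (rule MN.integrable_const_bound[of _ B]) (auto simp: bd)
  from P.Fubini_integral[OF this] show ?thesis by simp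
qed

section \<open>The Fejer kernel and its Fourier representation\<close>

text \<open>This is \<open>(sin (y / 2) / (y / 2))\<^sup>2\<close>, the Fourier transform of the
  tent on [-1, 1], with the removable singularity filled in. It stays unnormalised: only the
  positivity of its total mass is used, never the value.\<close>

definition fejer :: "real \<Rightarrow> real" where
  "fejer y = (if y = 0 then 1 else 2 * (1 - cos y) / y\<^sup>2)"

lemma fejer_measurable[measurable]: "fejer \<in> borel_measurable borel"
  unfolding fejer_def[abs_def] by measurable

lemma fejer_nonneg: "0 \<le> fejer y"
  by (auto simp: fejer_def)

lemma fejer_pos: "\<bar>y\<bar> < 1 \<Longrightarrow> 0 < fejer y"
proof -
  assume y: "\<bar>y\<bar> < 1"
  have "cos \<bar>y\<bar> < 1" if "y \<noteq> 0"
    using cos_monotone_0_pi[of 0 "\<bar>y\<bar>"] that y pi_gt3 by auto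
  then show ?thesis by (auto simp: fejer_def)
qed

text \<open>For |y| <= 1 the kernel is at most 1 and 1 + y^2 <= 2; beyond that it is at most 4 / y^2
  and 1 + y^2 <= 2 y^2. The constant 8 covers both ranges.\<close>

lemma fejer_le_Cauchy: "fejer y \<le> 8 * inverse (1 + y\<^sup>2)"
proof (cases "y\<^sup>2 \<le> 1")
  case True
  have "1 - cos y = 2 * (sin (y / 2))\<^sup>2"
    using cos_double_sin[of "y/2"] by simp
  also have "\<dots> \<le> 2 * (y / 2)\<^sup>2"
    by (intro mult_left_mono abs_le_square_iff[THEN iffD1, OF abs_sin_x_le_abs_x]) simp
  finally have "2 * (1 - cos y) \<le> y\<^sup>2" by (simp add: power_divide)
  then have "fejer y \<le> 1" by (auto simp: fejer_def divide_le_eq_1_pos)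
  also have "1 \<le> 8 * inverse (1 + y\<^sup>2)"
    using True add_pos_nonneg[OF zero_less_one zero_le_power2[of y]] by (simp add: field_simps)
  finally show ?thesis .
next
  case False
  then have "y \<noteq> 0" by auto
  have "2 * (1 - cos y) \<le> 4" using abs_cos_le_one[of y] unfolding abs_le_iff by argo
  then have "fejer y \<le> 4 / y\<^sup>2" using \<open>y \<noteq> 0\<close> by (auto simp: fejer_def divide_right_mono)
  also have "\<dots> \<le> 8 * inverse (1 + y\<^sup>2)"
  proof -
    have "0 < y\<^sup>2" "0 < 1 + y\<^sup>2" using False by linarith+
    then show ?thesis using False by (simp add: field_simps)
  qed
  finally show ?thesis .
qed

lemma integrable_fejer: "integrable lborel fejer"
proof -
  have "integrable lborel (\<lambda>y::real. inverse (1 + y\<^sup>2))"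
    using integrable_inverse_1_plus_square unfolding set_integrable_def by simp
  then have "integrable lborel (\<lambda>y::real. 8 * inverse (1 + y\<^sup>2))" by simp
  then show ?thesis
    by (rule Bochner_Integration.integrable_bound)
      (use fejer_le_Cauchy fejer_nonneg in \<open>auto intro!: AE_I2\<close>)
qed

lemma fejer_integral_pos: "0 < (LINT y|lborel. fejer y)"
proof -
  have "0 \<le> (LINT y|lborel. fejer y)" by (simp add: fejer_nonneg)
  moreover have "(LINT y|lborel. fejer y) \<noteq> 0"
  proof
    assume "(LINT y|lborel. fejer y) = 0"
    then have "AE y in lborel. fejer y = 0"
      by (subst (asm) integral_nonneg_eq_0_iff_AE) (auto simp: integrable_fejer fejer_nonneg)
    then have "AE y in lborel. y \<notin> {-1<..<1::real}"
    proof eventually_elim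
      case (elim y)
      then show ?case using fejer_pos[of y] by (auto simp: abs_less_iff)
    qed
    then have "{-1<..<1::real} \<in> null_sets lborel"
      by (subst AE_iff_null_sets) auto
    from null_setsD1[OF this] show False by simp
  qed
  ultimately show ?thesis by linarith
qed

text \<open>The fraction 1/10 is dictated by the absorption step in \<open>esseen_smoothing\<close>,
  where the tail is multiplied by 3/2 and has to stay clearly below 9/20.\<close>

lemma fejer_tail:
  "\<exists>A>0. (LINT y|lborel. indicator {y. A < \<bar>y\<bar>} y * fejer y) \<le> (LINT y|lborel. fejer y) / 10"
proof -
  have "(\<lambda>n. LINT y|lborel. indicator {y. real n < \<bar>y\<bar>} y * fejer y) \<longlonglongrightarrow> (LINT y|(lborel::real measure). 0)"
  proof (rule integral_dominated_convergence[where w = fejer])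
    show "AE y in lborel. (\<lambda>n. indicator {y. real n < \<bar>y\<bar>} y * fejer y) \<longlonglongrightarrow> 0"
    proof (rule AE_I2)
      fix y :: real
      have "eventually (\<lambda>n. indicator {y. real n < \<bar>y\<bar>} y * fejer y = 0) sequentially"
        using eventually_ge_at_top[of "nat \<lceil>\<bar>y\<bar>\<rceil>"]
        by eventually_elim (auto simp: indicator_def not_less nat_ceiling_le_eq)
      then show "(\<lambda>n. indicator {y. real n < \<bar>y\<bar>} y * fejer y) \<longlonglongrightarrow> 0"
        by (rule tendsto_eventually)
    qed
  qed (auto simp: integrable_fejer fejer_nonneg indicator_def)
  then have "eventually (\<lambda>n. (LINT y|lborel. indicator {y. real n < \<bar>y\<bar>} y * fejer y)
      < (LINT y|lborel. fejer y) / 10) sequentially"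
    by (rule order_tendstoD(2)) (simp add: fejer_integral_pos)
  then have "eventually (\<lambda>n. n > 0 \<and> (LINT y|lborel. indicator {y. real n < \<bar>y\<bar>} y * fejer y)
      < (LINT y|lborel. fejer y) / 10) sequentially"
    using eventually_gt_at_top[of 0] by eventually_elim auto
  from eventually_happens[OF this] obtain n where "n > 0"
    "(LINT y|lborel. indicator {y. real n < \<bar>y\<bar>} y * fejer y) < (LINT y|lborel. fejer y) / 10" by auto
  then show ?thesis by (intro exI[of _ "real n"]) auto
qed

definition tent :: "real \<Rightarrow> real \<Rightarrow> real" where
  "tent T t = max 0 (1 - \<bar>t\<bar> / T)"

lemma tent_measurable[measurable]: "tent T \<in> borel_measurable borel"
  unfolding tent_def[abs_def] by measurable

text \<open>The reason for the tent as cutoff: its transform is nonnegative, so it smooths with a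
  positive kernel. The integral is split at the corner 0 and evaluated by explicit antiderivatives;
  y = 0 is separate because the general ones divide by y.\<close>

lemma integral_tent_iexp:
  assumes T: "0 < T"
  shows "(CLINT t|lborel. tent T t * iexp (t * y)) = of_real (T * fejer (T * y))"
proof -
  let ?E = "\<lambda>t. iexp (t * y)"
  let ?f1 = "\<lambda>t::real. complex_of_real (1 + t / T) * ?E t"
  let ?f2 = "\<lambda>t::real. complex_of_real (1 - t / T) * ?E t"
  have split: "(CLINT t|lborel. tent T t * iexp (t * y))
      = (CLINT t|lborel. indicator {-T..0} t *\<^sub>R ?f1 t) + (CLINT t|lborel. indicator {0..T} t *\<^sub>R ?f2 t)"
  proof -
    have "(CLINT t|lborel. tent T t * iexp (t * y)) =
       (CLINT t|lborel. indicator {-T..0} t *\<^sub>R ?f1 t + indicator {0..T} t *\<^sub>R ?f2 t)"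
    proof (rule integral_cong_AE)
      \<comment> \<open>Both indicators contain 0, so the two integrands agree only almost
        everywhere.\<close>
      have "AE t in lborel. t \<noteq> (0::real)" by (rule AE_lborel_singleton)
      then show "AE t in lborel. complex_of_real (tent T t) * iexp (t * y)
          = indicator {-T..0} t *\<^sub>R ?f1 t + indicator {0..T} t *\<^sub>R ?f2 t"
      proof eventually_elim
        case (elim t)
        then show ?case using T
          by (auto simp: tent_def indicator_def max_def field_simps abs_if)
      qed
    qed auto
    also have "\<dots> = (CLINT t|lborel. indicator {-T..0} t *\<^sub>R ?f1 t) + (CLINT t|lborel. indicator {0..T} t *\<^sub>R ?f2 t)"
    proof (rule Bochner_Integration.integral_add)
      show "integrable lborel (\<lambda>t. indicator {-T..0} t *\<^sub>R ?f1 t)"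
        using borel_integrable_atLeastAtMost'[of "-T" 0 ?f1] unfolding set_integrable_def
        by (rule meta_mp) (use T in \<open>auto intro!: continuous_intros\<close>)
      show "integrable lborel (\<lambda>t. indicator {0..T} t *\<^sub>R ?f2 t)"
        using borel_integrable_atLeastAtMost'[of 0 T ?f2] unfolding set_integrable_def
        by (rule meta_mp) (use T in \<open>auto intro!: continuous_intros\<close>)
    qed
    finally show ?thesis .
  qed
  show ?thesis
  proof (cases "y = 0")
    case True
    have 1: "(CLINT t|lborel. indicator {-T..0} t *\<^sub>R ?f1 t)
        = complex_of_real (0 + 0\<^sup>2 / (2*T)) - complex_of_real (-T + (-T)\<^sup>2 / (2*T))"
    proof (rule integral_FTC_Icc)
      fix t
      have "((\<lambda>z. z + z\<^sup>2 / (2*T)) has_field_derivative (1 + complex_of_real t / T)) (at (of_real t))"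
        using T by (auto intro!: derivative_eq_intros)
      from has_vector_derivative_real_field[OF this]
      show "((\<lambda>t. complex_of_real (t + t\<^sup>2 / (2*T))) has_vector_derivative ?f1 t) (at t within {-T..0})"
        using True by simp
    qed (use T True in \<open>auto intro!: continuous_intros\<close>)
    have 2: "(CLINT t|lborel. indicator {0..T} t *\<^sub>R ?f2 t)
        = complex_of_real (T - T\<^sup>2 / (2*T)) - complex_of_real (0 - 0\<^sup>2 / (2*T))"
    proof (rule integral_FTC_Icc)
      fix t
      have "((\<lambda>z. z - z\<^sup>2 / (2*T)) has_field_derivative (1 - complex_of_real t / T)) (at (of_real t))"
        using T by (auto intro!: derivative_eq_intros)
      from has_vector_derivative_real_field[OF this]
      show "((\<lambda>t. complex_of_real (t - t\<^sup>2 / (2*T))) has_vector_derivative ?f2 t) (at t within {0..T})"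
        using True by simp
    qed (use T True in \<open>auto intro!: continuous_intros\<close>)
    show ?thesis unfolding split 1 2 using T True by (simp add: fejer_def power2_eq_square)
  next
    case False
    let ?F1 = "\<lambda>t::real. complex_of_real (1 + t / T) * ?E t / (\<i> * y) + ?E t / (T * y\<^sup>2)"
    let ?F2 = "\<lambda>t::real. complex_of_real (1 - t / T) * ?E t / (\<i> * y) - ?E t / (T * y\<^sup>2)"
    have 1: "(CLINT t|lborel. indicator {-T..0} t *\<^sub>R ?f1 t) = ?F1 0 - ?F1 (-T)"
    proof (rule integral_FTC_Icc)
      fix t
      have "((\<lambda>z. (1 + z / T) * exp (\<i> * (z * y)) / (\<i> * y) + exp (\<i> * (z * y)) / (T * y\<^sup>2))
        has_field_derivative (1 + complex_of_real t / T) * exp (\<i> * (t * y))) (at (of_real t))"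
        by (rule derivative_eq_intros refl | (use T False in force))+
          (use T False in \<open>simp add: field_simps power2_eq_square\<close>)
      from has_vector_derivative_real_field[OF this]
      show "(?F1 has_vector_derivative ?f1 t) (at t within {-T..0})" by simp
    qed (use T in \<open>auto intro!: continuous_intros\<close>)
    have 2: "(CLINT t|lborel. indicator {0..T} t *\<^sub>R ?f2 t) = ?F2 T - ?F2 0"
    proof (rule integral_FTC_Icc)
      fix t
      have "((\<lambda>z. (1 - z / T) * exp (\<i> * (z * y)) / (\<i> * y) - exp (\<i> * (z * y)) / (T * y\<^sup>2))
        has_field_derivative (1 - complex_of_real t / T) * exp (\<i> * (t * y))) (at (of_real t))"
        by (rule derivative_eq_intros refl | (use T False in force))+
          (use T False in \<open>simp add: field_simps power2_eq_square\<close>)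
      from has_vector_derivative_real_field[OF this]
      show "(?F2 has_vector_derivative ?f2 t) (at t within {0..T})" by simp
    qed (use T in \<open>auto intro!: continuous_intros\<close>)
    have "?F1 0 - ?F1 (-T) + (?F2 T - ?F2 0) = (2 - (iexp (T * y) + iexp (- (T * y)))) / (T * y\<^sup>2)"
      using T False by (simp add: field_simps)
    also have "iexp (T * y) + iexp (- (T * y)) = complex_of_real (2 * cos (T * y))"
      by (simp add: complex_eq_iff Re_exp Im_exp)
    also have "(2 - complex_of_real (2 * cos (T * y))) / (T * y\<^sup>2) = of_real (T * fejer (T * y))"
      using T False by (simp add: fejer_def field_simps power2_eq_square)
    finally show ?thesis unfolding split 1 2 .
  qed
qed

text \<open>The bound is independent of \<open>b\<close>, which permits the passage from intervals
  to half-lines; it is also the origin of the factor 1 / |t| in the smoothing inequality.\<close>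

lemma norm_integral_iexp_Icc:
  assumes "b \<le> a" "t \<noteq> 0"
  shows "norm (CLINT u|lborel. indicator {b..a} u *\<^sub>R iexp (- (t * u))) \<le> 2 / \<bar>t\<bar>"
proof -
  let ?F = "\<lambda>u. iexp (- (t * u)) / (- (\<i> * t))"
  have "(CLINT u|lborel. indicator {b..a} u *\<^sub>R iexp (- (t * u))) = ?F a - ?F b"
  proof (rule integral_FTC_Icc)
    show "(?F has_vector_derivative iexp (- (t * u))) (at u within {b..a})" for u
    proof -
      have "((\<lambda>z. exp (- (\<i> * t * z)) / (- (\<i> * t))) has_field_derivative exp (- (\<i> * t * of_real u))) (at (of_real u))"
        using assms by (auto intro!: derivative_eq_intros)
      from has_vector_derivative_real_field[OF this] show ?thesis by (simp add: mult_ac)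
    qed
  qed (use assms in \<open>auto intro!: continuous_intros\<close>)
  also have "norm \<dots> \<le> norm (?F a) + norm (?F b)" by (rule norm_triangle_ineq4)
  also have "\<dots> = 2 / \<bar>t\<bar>" by (simp add: norm_divide norm_mult)
  finally show ?thesis .
qed

lemma tent_kernel:
  assumes T: "0 < T"
  defines "K \<equiv> density lborel (\<lambda>t. ennreal (tent T t))"
  shows "finite_measure K"
    and "(CLINT t|K. iexp (t * y)) = of_real (T * fejer (T * y))"
proof -
  have tnn: "0 \<le> tent T t" for t by (simp add: tent_def)
  have ti: "integrable lborel (\<lambda>t. indicator {-T..T} t *\<^sub>R tent T t)"
    using borel_integrable_atLeastAtMost'[of "-T" T "tent T"] unfolding set_integrable_def
    by (rule meta_mp) (use T in \<open>auto simp: tent_def[abs_def] intro!: continuous_intros\<close>)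
  also have "(\<lambda>t. indicator {-T..T} t *\<^sub>R tent T t) = tent T"
    using T by (auto simp: tent_def indicator_def fun_eq_iff max_def abs_if field_simps)
  finally have ti: "integrable lborel (tent T)" .
  have "emeasure K (space K) = (\<integral>\<^sup>+t. ennreal (tent T t) \<partial>lborel)"
    unfolding K_def by (subst emeasure_density) auto
  also have "\<dots> < \<infinity>" using ti tnn by (simp add: nn_integral_eq_integral)
  finally show "finite_measure K" by (intro finite_measureI) auto
  show "(CLINT t|K. iexp (t * y)) = of_real (T * fejer (T * y))"
    unfolding K_def
    using integral_tent_iexp[OF T, of y]
    by (subst integral_density) (auto simp: tnn scaleR_conv_of_real mult_ac)
qed

text \<open>A Parseval identity: up to normalisation, the left side is the mass that
  \<open>M\<close>, smoothed by the Fejer kernel at scale 1 / T, gives to \<open>{b..a}\<close>. A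
  bounded interval keeps \<open>K\<close>, \<open>U\<close> and \<open>M\<close> finite, so that
  boundedness of the integrands justifies the exchanges between them.\<close>

lemma integral_fejer_interval:
  assumes M: "real_distribution M" and T: "0 < T" and ab: "b \<le> a"
  defines "K \<equiv> density lborel (\<lambda>t. ennreal (tent T t))"
    and "U \<equiv> density lborel (\<lambda>u. ennreal (indicator {b..a} u))"
  shows "complex_of_real (LINT z|lborel. fejer z * measure M {b + z / T..a + z / T})
     = (CLINT t|K. char M t * (CLINT u|U. iexp (- (t * u))))"
proof -
  interpret M: real_distribution M by fact
  have fK: "finite_measure K" unfolding K_def using tent_kernel(1)[OF T] .
  have fU: "finite_measure U"
    unfolding U_def by (intro finite_measureI) (subst emeasure_density, use ab in \<open>auto simp: ennreal_indicator\<close>)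
  have [measurable_cong, simp]: "sets K = sets borel" "sets U = sets borel" by (auto simp: K_def U_def)
  have fM: "finite_measure M" by (rule M.finite_measure_axioms)
  have ch: "(CLINT t|K. iexp (t * y)) = of_real (T * fejer (T * y))" for y
    unfolding K_def by (rule tent_kernel(2)[OF T])
  have "(LINT z|lborel. fejer z * measure M {b + z / T..a + z / T})
     = (LINT z|lborel. LINT x|M. fejer z * indicator {b..a} (x - z / T))"
  proof (intro Bochner_Integration.integral_cong refl)
    fix z
    have "(LINT x|M. fejer z * indicator {b..a} (x - z / T)) = fejer z * (LINT x|M. indicator {b + z / T..a + z / T} x)"
      by (subst integral_mult_right_zero[symmetric], intro Bochner_Integration.integral_cong refl)
        (auto simp: indicator_def)
    then show "fejer z * measure M {b + z / T..a + z / T} = (LINT x|M. fejer z * indicator {b..a} (x - z / T))"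
      by auto
  qed
  also have "\<dots> = (LINT x|M. LINT z|lborel. fejer z * indicator {b..a} (x - z / T))"
  proof -
    interpret P: pair_sigma_finite lborel M ..
    have "integrable (lborel \<Otimes>\<^sub>M M) (\<lambda>(z, x). fejer z * indicator {b..a} (x - z / T))"
    proof (rule Bochner_Integration.integrable_bound)
      show "integrable (lborel \<Otimes>\<^sub>M M) (\<lambda>(z, x). fejer z)"
        using P.integrable_fst
        by (subst P.Fubini_integrable)
          (auto simp: M.emeasure_space_1 integrable_fejer fejer_nonneg M.prob_space[simplified])
    qed (auto simp: indicator_def fejer_nonneg)
    from P.Fubini_integral[OF this] show ?thesis by simp
  qed
  also have "\<dots> = (LINT x|M. LINT u|U. T * fejer (T * (x - u)))"
  proof (rule Bochner_Integration.integral_cong[OF refl])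
    fix x
    have "(LINT u|U. T * fejer (T * (x - u))) = (LINT u|lborel. indicator {b..a} u * (T * fejer (T * (x - u))))"
      unfolding U_def by (subst integral_density) auto
    also have "\<dots> = \<bar>- 1 / T\<bar> *\<^sub>R (LINT z|lborel. indicator {b..a} (x + (-1 / T) * z) * (T * fejer (T * (x - (x + (-1 / T) * z)))))"
      by (rule lborel_integral_real_affine) (use T in auto)
    also have "\<dots> = (LINT z|lborel. fejer z * indicator {b..a} (x - z / T))"
      using T by (simp flip: integral_mult_right_zero add: field_simps)
    finally show "(LINT z|lborel. fejer z * indicator {b..a} (x - z / T)) = (LINT u|U. T * fejer (T * (x - u)))" ..
  qed
  finally have "complex_of_real (LINT z|lborel. fejer z * measure M {b + z / T..a + z / T})
     = (CLINT x|M. CLINT u|U. of_real (T * fejer (T * (x - u))))"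
    by (simp only: integral_complex_of_real)
  also have "\<dots> = (CLINT x|M. CLINT u|U. CLINT t|K. iexp (t * (x - u)))"
    by (simp only: ch)
  also have "\<dots> = (CLINT x|M. CLINT t|K. CLINT u|U. iexp (t * (x - u)))"
    by (intro Bochner_Integration.integral_cong refl Fubini_bounded[OF fU fK, where B = 1]) auto
  also have "\<dots> = (CLINT x|M. CLINT t|K. iexp (t * x) * (CLINT u|U. iexp (- (t * u))))"
    by (simp flip: integral_mult_right_zero exp_add add: algebra_simps)
  also have "\<dots> = (CLINT t|K. CLINT x|M. iexp (t * x) * (CLINT u|U. iexp (- (t * u))))"
  proof (rule Fubini_bounded[OF fM fK])
    interpret U: finite_measure U by fact
    interpret K: finite_measure K by fact
    show "(\<lambda>(x, t). iexp (t * x) * (CLINT u|U. iexp (- (t * u)))) \<in> borel_measurable (M \<Otimes>\<^sub>M K)"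
      by measurable
    show "norm (iexp (t * x) * (CLINT u|U. iexp (- (t * u)))) \<le> (LINT u|U. 1)" for x t
      by (subst norm_mult, simp del: lebesgue_integral_const)
        (rule order_trans[OF integral_norm_bound], simp)
  qed
  also have "\<dots> = (CLINT t|K. char M t * (CLINT u|U. iexp (- (t * u))))"
    by (simp add: char_def)
  finally show ?thesis .
qed

text \<open>The interval identities for \<open>M\<close> and \<open>N\<close> are subtracted and
  estimated by 2 / |t| uniformly in \<open>b\<close>; then \<open>b\<close> tends to minus infinity
  by dominated convergence, with \<open>fejer\<close> as majorant.\<close>

lemma fejer_smoothing:
  assumes M: "real_distribution M" and N: "real_distribution N" and T: "0 < T"
    and int: "set_integrable lborel {-T..T} (\<lambda>t. norm (char M t - char N t) / \<bar>t\<bar>)"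
  shows "\<bar>LINT z|lborel. fejer z * (cdf M (a + z / T) - cdf N (a + z / T))\<bar>
     \<le> 2 * (LINT t:{-T..T}|lborel. norm (char M t - char N t) / \<bar>t\<bar>)" (is "_ \<le> 2 * ?I")
proof -
  interpret M: real_distribution M by fact
  interpret N: real_distribution N by fact
  let ?d = "\<lambda>b z. measure M {b + z / T..a + z / T} - measure N {b + z / T..a + z / T}"
  have lim1: "(\<lambda>n. measure M' {- real n + c..a'}) \<longlonglongrightarrow> cdf M' a'" if "real_distribution M'" for M' c a'
  proof -
    interpret M': real_distribution M' by fact
    have "(\<lambda>n. measure M' {- real n + c..a'}) \<longlonglongrightarrow> measure M' (\<Union>n. {- real n + c..a'})"
      by (rule M'.finite_Lim_measure_incseq) (auto simp: incseq_def)
    also have "(\<Union>n. {- real n + c..a'}) = {..a'}"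
    proof -
      have "\<exists>n. - real n + c \<le> x" for x using reals_Archimedean2[of "c - x"] by (auto intro!: exI[of _ "nat \<lceil>c - x\<rceil>"] simp: algebra_simps) linarith
      then show ?thesis by auto
    qed
    finally show ?thesis by (simp add: cdf_def)
  qed
  have [measurable]: "(\<lambda>z. measure M' {b + z / T..a + z / T}) \<in> borel_measurable borel"
    if "real_distribution M'" for M' b
  proof -
    interpret M': real_distribution M' by fact
    have "(LINT x|M'. indicat_real {b..a} (x - z / T)) = (LINT x|M'. indicat_real {b + z / T..a + z / T} x)" for z
      by (intro Bochner_Integration.integral_cong) (auto simp: indicator_def)
    then have "measure M' {b + z / T..a + z / T} = (LINT x|M'. indicat_real {b..a} (x - z / T))" for z
      by simp
    then show ?thesis by simp
  qed
  have [measurable]: "(\<lambda>z. measure M {b + z / T..a + z / T}) \<in> borel_measurable borel"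
    "(\<lambda>z. measure N {b + z / T..a + z / T}) \<in> borel_measurable borel" for b
    using M N by measurable
  have [measurable]: "cdf M \<in> borel_measurable borel" "cdf N \<in> borel_measurable borel"
    by (auto intro!: borel_measurable_mono monoI M.cdf_nondecreasing N.cdf_nondecreasing)
  have d1: "\<bar>?d b z\<bar> \<le> 1" for b z
    using M.prob_le_1[of "{b + z / T..a + z / T}"] N.prob_le_1[of "{b + z / T..a + z / T}"]
      measure_nonneg[of M "{b + z / T..a + z / T}"] measure_nonneg[of N "{b + z / T..a + z / T}"]
    by linarith
  have lim: "(\<lambda>n. LINT z|lborel. fejer z * ?d (- real n) z) \<longlonglongrightarrow>
     (LINT z|lborel. fejer z * (cdf M (a + z / T) - cdf N (a + z / T)))"
  proof (rule integral_dominated_convergence[where w = fejer])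
    show "AE z in lborel. (\<lambda>n. fejer z * ?d (- real n) z) \<longlonglongrightarrow> fejer z * (cdf M (a + z / T) - cdf N (a + z / T))"
      by (intro AE_I2 tendsto_intros lim1 M N)
    show "AE z in lborel. norm (fejer z * ?d (- real n) z) \<le> fejer z" for n
      by (intro AE_I2) (simp only: real_norm_def abs_mult abs_of_nonneg[OF fejer_nonneg] mult_left_le[OF d1 fejer_nonneg])
    show "(\<lambda>z. fejer z * ?d (- real n) z) \<in> borel_measurable lborel" for n by measurable
    show "(\<lambda>z. fejer z * (cdf M (a + z / T) - cdf N (a + z / T))) \<in> borel_measurable lborel" by measurable
  qed (rule integrable_fejer)
  have bd: "\<bar>LINT z|lborel. fejer z * ?d b z\<bar> \<le> 2 * ?I" if ba: "b \<le> a" for b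
  proof -
    let ?K = "density lborel (\<lambda>t. ennreal (tent T t))"
    let ?U = "density lborel (\<lambda>u. ennreal (indicator {b..a} u))"
    let ?J = "\<lambda>t. CLINT u|?U. iexp (- (t * u))"
    interpret K: finite_measure ?K using tent_kernel(1)[OF T] .
    have J: "?J t = (CLINT u|lborel. indicator {b..a} u *\<^sub>R iexp (- (t * u)))" for t
      by (subst integral_density) auto
    have Jb: "norm (?J t) \<le> 2 / \<bar>t\<bar>" if "t \<noteq> 0" for t
      unfolding J by (rule norm_integral_iexp_Icc[OF ba that])
    have Jc: "norm (?J t) \<le> a - b" for t
    proof -
      have "norm (?J t) \<le> (LINT u|lborel. norm (indicator {b..a} u *\<^sub>R iexp (- (t * u))))"
        unfolding J by (rule integral_norm_bound)
      also have "\<dots> = a - b" using ba by simp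
      finally show ?thesis .
    qed
    interpret Ls: sigma_finite_measure "?U"
    proof -
      have "finite_measure ?U" by (intro finite_measureI) (subst emeasure_density, use ba in \<open>auto simp: ennreal_indicator\<close>)
      then interpret finite_measure ?U .
      show "sigma_finite_measure ?U" ..
    qed
    have [measurable]: "?J \<in> borel_measurable borel" by measurable
    have int1: "integrable lborel (\<lambda>z. fejer z * measure M' {b + z / T..a + z / T})" if M': "real_distribution M'" for M'
    proof -
      interpret M': real_distribution M' by fact
      have [measurable]: "(\<lambda>z. measure M' {b + z / T..a + z / T}) \<in> borel_measurable borel" 
        using M' by measurable
      show ?thesis
        by (rule Bochner_Integration.integrable_bound[OF integrable_fejer])
          (use fejer_nonneg M'.prob_le_1 in \<open>auto simp: abs_mult intro!: mult_left_le\<close>)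
    qed
    have intK: "integrable ?K (\<lambda>t. char M' t * ?J t)" if M': "real_distribution M'" for M'
    proof -
      interpret M': real_distribution M' by fact
      show ?thesis
      proof (rule K.integrable_const_bound)
        show "AE t in ?K. norm (char M' t * ?J t) \<le> 1 * (a - b)"
          unfolding norm_mult by (intro AE_I2 mult_mono Jc M'.cmod_char_le_1) auto
        show "(\<lambda>t. char M' t * ?J t) \<in> borel_measurable ?K" by measurable
      qed
    qed
    have "complex_of_real (LINT z|lborel. fejer z * ?d b z)
      = of_real (LINT z|lborel. fejer z * measure M {b + z / T..a + z / T})
      - of_real (LINT z|lborel. fejer z * measure N {b + z / T..a + z / T})"
      unfolding right_diff_distrib
      by (subst Bochner_Integration.integral_diff) (auto intro: int1 M N)
    also have "\<dots> = (CLINT t|?K. char M t * ?J t) - (CLINT t|?K. char N t * ?J t)"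
      by (simp only: integral_fejer_interval[OF M T ba] integral_fejer_interval[OF N T ba])
    also have "\<dots> = (CLINT t|?K. (char M t - char N t) * ?J t)"
      unfolding left_diff_distrib
      by (subst Bochner_Integration.integral_diff) (rule intK[OF M] intK[OF N] refl)+
    also have "\<dots> = (CLINT t|lborel. tent T t *\<^sub>R ((char M t - char N t) * ?J t))"
      by (subst integral_density) (auto simp: tent_def)
    finally have eq: "complex_of_real (LINT z|lborel. fejer z * ?d b z) = (CLINT t|lborel. tent T t *\<^sub>R ((char M t - char N t) * ?J t))" .
    have "\<bar>LINT z|lborel. fejer z * ?d b z\<bar> = norm (CLINT t|lborel. tent T t *\<^sub>R ((char M t - char N t) * ?J t))"
      unfolding eq[symmetric] by simp
    also have "\<dots> \<le> (LINT t|lborel. norm (tent T t *\<^sub>R ((char M t - char N t) * ?J t)))"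
      by (rule integral_norm_bound)
    also have "\<dots> \<le> (LINT t|lborel. 2 * (indicator {-T..T} t *\<^sub>R (norm (char M t - char N t) / \<bar>t\<bar>)))"
    proof (rule integral_mono_AE')
      show "integrable lborel (\<lambda>t. 2 * (indicator {-T..T} t *\<^sub>R (norm (char M t - char N t) / \<bar>t\<bar>)))"
        using int[unfolded set_integrable_def] by (rule integrable_mult_right)
      have "AE t in lborel. t \<noteq> (0::real)" by (rule AE_lborel_singleton)
      then show "AE t in lborel. norm (tent T t *\<^sub>R ((char M t - char N t) * ?J t))
          \<le> 2 * (indicator {-T..T} t *\<^sub>R (norm (char M t - char N t) / \<bar>t\<bar>))"
      proof eventually_elim
        case (elim t)
        have t1: "0 \<le> tent T t" "tent T t \<le> indicator {-T..T} t"
          using T by (auto simp: tent_def indicator_def max_def abs_if field_simps)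
        have "norm (tent T t *\<^sub>R ((char M t - char N t) * ?J t)) = tent T t * (norm (char M t - char N t) * norm (?J t))"
          using t1 by (simp add: norm_mult)
        also have "\<dots> \<le> indicator {-T..T} t * (norm (char M t - char N t) * (2 / \<bar>t\<bar>))"
          by (intro mult_mono t1 Jb elim mult_nonneg_nonneg) auto
        finally show ?case by (simp add: mult_ac)
      qed
    qed auto
    also have "\<dots> = 2 * ?I" unfolding set_lebesgue_integral_def by (rule integral_mult_right_zero)
    finally show ?thesis .
  qed
  have "eventually (\<lambda>n. \<bar>LINT z|lborel. fejer z * ?d (- real n) z\<bar> \<le> 2 * ?I) sequentially"
    using eventually_ge_at_top[of "nat \<lceil>- a\<rceil>"]
    by eventually_elim (rule bd, simp add: nat_ceiling_le_eq)
  then show ?thesis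
    by (intro tendsto_upperbound[OF tendsto_rabs[OF lim]]) auto
qed

text \<open>Near a point where the difference \<open>D\<close> of the distribution functions almost
  attains its supremum, \<open>D\<close> stays large on an interval to one side: there monotonicity
  of \<open>cdf M\<close> only helps, and \<open>cdf N\<close> moves with speed at most
  \<open>B\<close>. A Fejer kernel concentrated on that interval detects a fixed fraction of the
  supremum.\<close>

theorem esseen_smoothing:
  obtains C :: real where "0 < C"
    "\<And>M N T B x. real_distribution M \<Longrightarrow> real_distribution N \<Longrightarrow> 0 < T \<Longrightarrow> 0 < B \<Longrightarrow>
      (\<And>x y. \<bar>cdf N x - cdf N y\<bar> \<le> B * \<bar>x - y\<bar>) \<Longrightarrow>
      set_integrable lborel {-T..T} (\<lambda>t. norm (char M t - char N t) / \<bar>t\<bar>) \<Longrightarrow>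
      \<bar>cdf M x - cdf N x\<bar> \<le> C * (B / T + (LINT t:{-T..T}|lborel. norm (char M t - char N t) / \<bar>t\<bar>))"
proof -
  let ?F = "LINT y|lborel. fejer y"
  have F0: "0 < ?F" by (rule fejer_integral_pos)
  obtain A where A: "0 < A" "(LINT y|lborel. indicator {y. A < \<bar>y\<bar>} y * fejer y) \<le> ?F / 10"
    using fejer_tail by blast
  \<comment> \<open>The summand \<open>8 * A\<close> serves the case where the interval is too short
    for the kernel, \<open>8 / ?F\<close> the case where the kernel fits.\<close>
  define C where "C = 8 * A + 8 / ?F"
  have C0: "0 < C" using A F0 by (auto simp: C_def add_pos_pos)
  show thesis
  proof (rule that[OF C0])
    fix M N :: "real measure" and T B x :: real
    assume M: "real_distribution M" and N: "real_distribution N" and T: "0 < T" and B: "0 < B"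
      and lip: "\<And>x y. \<bar>cdf N x - cdf N y\<bar> \<le> B * \<bar>x - y\<bar>"
      and int: "set_integrable lborel {-T..T} (\<lambda>t. norm (char M t - char N t) / \<bar>t\<bar>)"
    interpret M: real_distribution M by fact
    interpret N: real_distribution N by fact
    define e where "e = (LINT t:{-T..T}|lborel. norm (char M t - char N t) / \<bar>t\<bar>)"
    define D where "D x = cdf M x - cdf N x" for x
    have D1: "\<bar>D x\<bar> \<le> 1" for x
      using M.cdf_bounded_prob[of x] N.cdf_bounded_prob[of x] M.cdf_nonneg[of x] N.cdf_nonneg[of x]
      by (auto simp: D_def abs_le_iff)
    have bdd: "bdd_above (range (\<lambda>x. \<bar>D x\<bar>))" using D1 by (auto simp: bdd_above_def)
    define S where "S = (SUP x. \<bar>D x\<bar>)"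
    have DS: "\<bar>D x\<bar> \<le> S" for x unfolding S_def by (rule cSUP_upper[OF _ bdd]) simp
    have S0: "0 \<le> S" using DS[of 0] by linarith
    have e0: "0 \<le> e" unfolding e_def set_lebesgue_integral_def by simp
    have sm: "\<bar>LINT z|lborel. fejer z * D (a + z / T)\<bar> \<le> 2 * e" for a
      using fejer_smoothing[OF M N T int, of a] by (simp add: D_def e_def)
    have [measurable]: "cdf M \<in> borel_measurable borel" "cdf N \<in> borel_measurable borel"
      by (auto intro!: borel_measurable_mono monoI M.cdf_nondecreasing N.cdf_nondecreasing)
    have [measurable]: "D \<in> borel_measurable borel" unfolding D_def[abs_def] by measurable
    have intD: "integrable lborel (\<lambda>z. fejer z * D (a + z / T))" for a
      by (rule Bochner_Integration.integrable_bound[OF integrable_fejer])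
        (use fejer_nonneg D1 in \<open>auto simp: abs_mult intro!: mult_left_le\<close>)
    have intA: "integrable lborel (\<lambda>z. indicator {y. A < \<bar>y\<bar>} z * fejer z)"
      by (rule Bochner_Integration.integrable_bound[OF integrable_fejer])
        (auto simp: indicator_def fejer_nonneg)
    \<comment> \<open>For |z| <= A the integrand is bounded below through \<open>near\<close>,
      elsewhere only through - S. The sign \<open>s\<close> treats an excess and a deficit of
      \<open>D\<close> together.\<close>
    have core: "S \<le> 8 / ?F * e"
      if d: "0.9 * S \<le> d" "d \<le> S" and s: "s = 1 \<or> s = - 1"
        and near: "\<And>z. \<bar>z\<bar> \<le> A \<Longrightarrow> d / 2 \<le> s * D (a + z / T)" for d s a
    proof -
      have d0: "0 \<le> d" using d S0 by linarith
      have "(LINT z|lborel. d / 2 * fejer z - (d / 2 + S) * (indicator {y. A < \<bar>y\<bar>} z * fejer z))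
          \<le> (LINT z|lborel. s * (fejer z * D (a + z / T)))"
      proof (rule integral_mono)
        fix z
        show "d / 2 * fejer z - (d / 2 + S) * (indicator {y. A < \<bar>y\<bar>} z * fejer z) \<le> s * (fejer z * D (a + z / T))"
        proof (cases "\<bar>z\<bar> \<le> A")
          case True
          from mult_left_mono[OF near[OF this] fejer_nonneg[of z]] True show ?thesis
            by (simp add: algebra_simps)
        next
          case False
          have "- S \<le> s * D (a + z / T)" using DS[of "a + z / T"] s by auto
          from mult_left_mono[OF this fejer_nonneg[of z]] False show ?thesis
            by (simp add: algebra_simps)
        qed
      qed (auto intro!: Bochner_Integration.integrable_diff integrable_mult_right integrable_fejer intA intD)
      also have "\<dots> = s * (LINT z|lborel. fejer z * D (a + z / T))" by simp
      also have "\<dots> \<le> 2 * e" using sm[of a] s by auto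
      also have "(LINT z|lborel. d / 2 * fejer z - (d / 2 + S) * (indicator {y. A < \<bar>y\<bar>} z * fejer z))
        = d / 2 * ?F - (d / 2 + S) * (LINT y|lborel. indicator {y. A < \<bar>y\<bar>} y * fejer y)"
        by (subst Bochner_Integration.integral_diff)
          (auto intro!: integrable_mult_right integrable_fejer intA)
      finally have "d / 2 * ?F - (d / 2 + S) * (LINT y|lborel. indicator {y. A < \<bar>y\<bar>} y * fejer y) \<le> 2 * e" .
      moreover have "(d / 2 + S) * (LINT y|lborel. indicator {y. A < \<bar>y\<bar>} y * fejer y) \<le> (3 / 2 * S) * (?F / 10)"
        using d d0 S0 A by (intro mult_mono) (auto simp: fejer_nonneg)
      moreover have "(9 / 20) * S * ?F \<le> d / 2 * ?F" using d F0 by (intro mult_right_mono) auto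
      ultimately have "(3 / 10) * S * ?F \<le> 2 * e" by simp
      then have "S * ?F \<le> 8 * e" using e0 by linarith
      then show ?thesis using F0 by (simp add: field_simps)
    qed
    have "S \<le> C * (B / T + e)"
    proof (cases "S = 0")
      case True then show ?thesis using C0 B T e0 by simp
    next
      case False
      with S0 have "0.9 * S < S" by simp
      have "\<exists>x. 0.9 * S < \<bar>D x\<bar>"
      proof (rule ccontr)
        assume "\<not> ?thesis"
        then have "\<bar>D x\<bar> \<le> 0.9 * S" for x by (meson not_less)
        from cSUP_least[of UNIV "\<lambda>x. \<bar>D x\<bar>", OF _ this] have "S \<le> 0.9 * S" by (simp add: S_def)
        with \<open>0.9 * S < S\<close> show False by simp
      qed
      then obtain x0 where x0: "0.9 * S < \<bar>D x0\<bar>" ..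
      let ?d = "\<bar>D x0\<bar>"
      \<comment> \<open>With this \<open>h\<close>, \<open>D\<close> keeps half of its value at
        \<open>x0\<close> over a distance 2 h; the kernel is then centred at the midpoint of that
        interval.\<close>
      define h where "h = ?d / (4 * B)"
      have hB: "B * (2 * h) = ?d / 2" using B by (simp add: h_def)
      show ?thesis
      proof (cases "h * T < A")
        case True
        then have "?d < 4 * A * (B / T)" using B T by (simp add: h_def field_simps)
        then have "S \<le> 8 * A * (B / T)" using x0 S0 by linarith
        also have "\<dots> \<le> C * (B / T + e)"
          using A B T F0 e0 by (intro mult_mono) (auto simp: C_def)
        finally show ?thesis .
      next
        case False
        have zh: "\<bar>z / T\<bar> \<le> h" if "\<bar>z\<bar> \<le> A" for z
        proof -
          have "\<bar>z\<bar> \<le> h * T" using that False by linarith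
          then show ?thesis using T by (simp add: field_simps)
        qed
        have up: "D x0 / 2 \<le> D y" if "0 \<le> D x0" "x0 \<le> y" "y \<le> x0 + 2 * h" for y
        proof -
          have "cdf N y - cdf N x0 \<le> \<bar>cdf N y - cdf N x0\<bar>" by simp
          also have "\<dots> \<le> B * \<bar>y - x0\<bar>" by (rule lip)
          also have "\<dots> \<le> B * (2 * h)" using that B by (intro mult_left_mono) auto
          also have "\<dots> = D x0 / 2" using hB that by simp
          finally have "cdf N y - cdf N x0 \<le> D x0 / 2" .
          moreover have "cdf M x0 \<le> cdf M y" by (rule M.cdf_nondecreasing) fact
          ultimately show ?thesis by (simp add: D_def field_simps)
        qed
        have down: "- D x0 / 2 \<le> - D y" if "D x0 \<le> 0" "y \<le> x0" "x0 - 2 * h \<le> y" for y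
        proof -
          have "cdf N x0 - cdf N y \<le> \<bar>cdf N x0 - cdf N y\<bar>" by simp
          also have "\<dots> \<le> B * \<bar>x0 - y\<bar>" by (rule lip)
          also have "\<dots> \<le> B * (2 * h)" using that B by (intro mult_left_mono) auto
          also have "\<dots> = - D x0 / 2" using hB that by simp
          finally have "cdf N x0 - cdf N y \<le> - D x0 / 2" .
          moreover have "cdf M y \<le> cdf M x0" by (rule M.cdf_nondecreasing) fact
          ultimately show ?thesis by (simp add: D_def field_simps)
        qed
        have "S \<le> 8 / ?F * e"
        proof (cases "0 \<le> D x0")
          case True
          show ?thesis
          proof (rule core[of ?d 1 "x0 + h"])
            fix z assume "\<bar>z\<bar> \<le> A"
            from zh[OF this] have z: "x0 \<le> x0 + h + z / T" "x0 + h + z / T \<le> x0 + 2 * h" unfolding abs_le_iff by linarith+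
            from up[OF True z] show "?d / 2 \<le> 1 * D (x0 + h + z / T)" using True by simp
          qed (use x0 DS in auto)
        next
          case F: False
          show ?thesis
          proof (rule core[of ?d "-1" "x0 - h"])
            fix z assume "\<bar>z\<bar> \<le> A"
            from zh[OF this] have z: "x0 - h + z / T \<le> x0" "x0 - 2 * h \<le> x0 - h + z / T" unfolding abs_le_iff by linarith+
            from down[OF _ z] show "?d / 2 \<le> - 1 * D (x0 - h + z / T)" using F by simp
          qed (use x0 DS in auto)
        qed
        also have "\<dots> \<le> C * (B / T + e)"
          using A B T F0 e0 by (intro mult_mono) (auto simp: C_def)
        finally show ?thesis .
      qed
    qed
    then show "\<bar>cdf M x - cdf N x\<bar> \<le> C * (B / T + (LINT t:{-T..T}|lborel. norm (char M t - char N t) / \<bar>t\<bar>))"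
      using DS[of x] by (simp add: D_def e_def)
  qed
qed

section \<open>Contracting chains and Poisson equations\<close>

text \<open>The gauge \<open>D\<close> contracts only on average; pathwise, one step may enlarge it
  by the factor \<open>K\<close>, which also bounds \<open>D\<close> itself. The base point
  \<open>x\<^sub>0\<close> normalises functions that are otherwise determined up to a
  constant.\<close>

locale contracting_chain = prob_space \<mu> for \<mu> :: "'g measure" +
  fixes S :: "'x measure" and act :: "'g \<Rightarrow> 'x \<Rightarrow> 'x" and D :: "'x \<Rightarrow> 'x \<Rightarrow> real"
    and K \<theta> :: real and x\<^sub>0 :: 'x
  assumes x0: "x\<^sub>0 \<in> space S"
    and act_measurable[measurable]: "(\<lambda>(g, x). act g x) \<in> \<mu> \<Otimes>\<^sub>M S \<rightarrow>\<^sub>M S"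
    and D_measurable: "x \<in> space S \<Longrightarrow> y \<in> space S \<Longrightarrow> (\<lambda>g. D (act g x) (act g y)) \<in> borel_measurable \<mu>"
    and D_nonneg: "x \<in> space S \<Longrightarrow> y \<in> space S \<Longrightarrow> 0 \<le> D x y"
    and D_le: "x \<in> space S \<Longrightarrow> y \<in> space S \<Longrightarrow> D x y \<le> K"
    and D_act: "g \<in> space \<mu> \<Longrightarrow> x \<in> space S \<Longrightarrow> y \<in> space S \<Longrightarrow> D (act g x) (act g y) \<le> K * D x y"
    and D_contract: "x \<in> space S \<Longrightarrow> y \<in> space S \<Longrightarrow> (LINT g|\<mu>. D (act g x) (act g y)) \<le> \<theta> * D x y"
    and theta: "0 \<le> \<theta>" "\<theta> < 1" and K: "1 \<le> K"
begin

lemma act_space[simp, intro]: "g \<in> space \<mu> \<Longrightarrow> x \<in> space S \<Longrightarrow> act g x \<in> space S"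
  using measurable_space[OF act_measurable, of "(g, x)"] by (simp add: space_pair_measure)

lemma act_measurable1[measurable]: "x \<in> space S \<Longrightarrow> (\<lambda>g. act g x) \<in> \<mu> \<rightarrow>\<^sub>M S"
  by measurable

lemma D_integrable: "x \<in> space S \<Longrightarrow> y \<in> space S \<Longrightarrow> integrable \<mu> (\<lambda>g. D (act g x) (act g y))"
  by (rule integrable_const_bound[of _ K])
    (auto intro!: AE_I2 D_measurable simp: abs_of_nonneg D_nonneg D_le)

text \<open>A relation to a bound instead of a seminorm, so that no supremum has to be shown finite.
  Measurability is included because these functions are mostly used under integrals.\<close>

definition lip :: "('x \<Rightarrow> 'b :: {banach, second_countable_topology}) \<Rightarrow> real \<Rightarrow> bool" where
  "lip f C \<longleftrightarrow> f \<in> borel_measurable S \<and> 0 \<le> C \<and>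
     (\<forall>x\<in>space S. \<forall>y\<in>space S. norm (f x - f y) \<le> C * D x y)"

lemma lip_measurable[measurable_dest]: "lip f C \<Longrightarrow> f \<in> borel_measurable S"
  by (simp add: lip_def)

lemma lip_nonneg: "lip f C \<Longrightarrow> 0 \<le> C" by (simp add: lip_def)

lemma lipD: "lip f C \<Longrightarrow> x \<in> space S \<Longrightarrow> y \<in> space S \<Longrightarrow> norm (f x - f y) \<le> C * D x y"
  by (simp add: lip_def)

lemma lip_osc: "lip f C \<Longrightarrow> x \<in> space S \<Longrightarrow> y \<in> space S \<Longrightarrow> norm (f x - f y) \<le> C * K"
  by (rule order_trans[OF lipD mult_left_mono[OF D_le]]) (auto simp: lip_nonneg)

lemma lip_bound: "lip f C \<Longrightarrow> x \<in> space S \<Longrightarrow> norm (f x) \<le> norm (f x\<^sub>0) + C * K"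
  using lip_osc[of f C x x\<^sub>0] norm_triangle_sub[of "f x" "f x\<^sub>0"] x0 by fastforce

lemma lip_mono: "lip f C \<Longrightarrow> C \<le> C' \<Longrightarrow> lip f C'"
  unfolding lip_def using D_nonneg by (meson dual_order.trans mult_right_mono)

lemma lip_cong:
  assumes "lip f C" "\<And>x. x \<in> space S \<Longrightarrow> f x = h x" shows "lip h C"
  using assms measurable_cong[of S f h borel] by (simp add: lip_def)

lemma lip_const: "lip (\<lambda>_. c) 0" by (simp add: lip_def)

lemma lip_add:
  assumes "lip f C" "lip g E" shows "lip (\<lambda>x. f x + g x) (C + E)"
  unfolding lip_def
proof (intro conjI ballI)
  note [measurable] = lip_measurable[OF assms(1)] lip_measurable[OF assms(2)]
  show "(\<lambda>x. f x + g x) \<in> borel_measurable S" by measurable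
  show "0 \<le> C + E" using lip_nonneg[OF assms(1)] lip_nonneg[OF assms(2)] by simp
  fix x y assume xy: "x \<in> space S" "y \<in> space S"
  have "norm (f x + g x - (f y + g y)) \<le> norm (f x - f y) + norm (g x - g y)"
    by (metis add_diff_add norm_triangle_ineq)
  also have "\<dots> \<le> (C + E) * D x y"
    using lipD[OF assms(1) xy] lipD[OF assms(2) xy] by (simp add: distrib_right)
  finally show "norm (f x + g x - (f y + g y)) \<le> (C + E) * D x y" .
qed

lemma lip_bounded_linear:
  assumes "bounded_linear h" "\<And>z. norm (h z) \<le> B * norm z" "0 \<le> B" "lip f C"
  shows "lip (\<lambda>x. h (f x)) (B * C)"
  unfolding lip_def
proof (intro conjI ballI)
  interpret h: bounded_linear h by fact
  have [measurable]: "h \<in> borel_measurable borel"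
    by (intro borel_measurable_continuous_onI h.continuous_on continuous_on_id)
  note [measurable] = lip_measurable[OF assms(4)]
  show "(\<lambda>x. h (f x)) \<in> borel_measurable S" by measurable
  show "0 \<le> B * C" using lip_nonneg[OF assms(4)] assms(3) by simp
  fix x y assume xy: "x \<in> space S" "y \<in> space S"
  have "norm (h (f x) - h (f y)) \<le> B * norm (f x - f y)" unfolding h.diff[symmetric] by (rule assms)
  also have "\<dots> \<le> B * (C * D x y)" by (intro mult_left_mono lipD assms xy)
  finally show "norm (h (f x) - h (f y)) \<le> B * C * D x y" by (simp add: mult_ac)
qed

lemma lip_cmult:
  fixes f :: "'x \<Rightarrow> 'b :: {real_normed_div_algebra, banach, second_countable_topology}"
  assumes "lip f C" shows "lip (\<lambda>x. a * f x) (norm a * C)"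
  by (rule lip_bounded_linear[OF bounded_linear_mult_right _ _ assms]) (auto simp: norm_mult)

lemma lip_minus: "lip f C \<Longrightarrow> lip (\<lambda>x. - f x) C"
  using lip_bounded_linear[OF bounded_linear_minus[OF bounded_linear_ident], of 1 f C] by simp

lemma lip_diff: "lip f C \<Longrightarrow> lip g E \<Longrightarrow> lip (\<lambda>x. f x - g x) (C + E)"
  using lip_add[OF _ lip_minus, of f C g E] by simp

lemma lip_of_real: "lip f C \<Longrightarrow> lip (\<lambda>x. complex_of_real (f x)) C"
  using lip_bounded_linear[where h = complex_of_real and B = 1 and f = f and C = C] bounded_linear_of_real by simp

text \<open>The Lipschitz constant of the kernel may depend on \<open>g\<close> as long as it is
  integrable. In this way moments of the cocycle become Lipschitz estimates for its conditional
  moments and for the operators \<open>Q t\<close>.\<close>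

lemma lip_kernel:
  fixes k :: "'g \<Rightarrow> 'x \<Rightarrow> 'b :: {banach, second_countable_topology}"
  assumes [measurable]: "(\<lambda>(g, x). k g x) \<in> borel_measurable (\<mu> \<Otimes>\<^sub>M S)"
    and k: "\<And>x. x \<in> space S \<Longrightarrow> integrable \<mu> (\<lambda>g. k g x)"
    and b: "integrable \<mu> b" "\<And>g. g \<in> space \<mu> \<Longrightarrow> 0 \<le> b g"
    and kb: "\<And>g x y. g \<in> space \<mu> \<Longrightarrow> x \<in> space S \<Longrightarrow> y \<in> space S \<Longrightarrow> norm (k g x - k g y) \<le> b g * D x y"
  shows "lip (\<lambda>x. LINT g|\<mu>. k g x) (LINT g|\<mu>. b g)"
  unfolding lip_def
proof (intro conjI ballI)
  show "(\<lambda>x. LINT g|\<mu>. k g x) \<in> borel_measurable S" by measurable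
  show "0 \<le> (LINT g|\<mu>. b g)" using b by (intro Bochner_Integration.integral_nonneg_AE AE_I2)
  fix x y assume xy: "x \<in> space S" "y \<in> space S"
  have "norm ((LINT g|\<mu>. k g x) - (LINT g|\<mu>. k g y)) = norm (LINT g|\<mu>. k g x - k g y)"
    by (simp add: k xy)
  also have "\<dots> \<le> (LINT g|\<mu>. norm (k g x - k g y))" by (rule integral_norm_bound)
  also have "\<dots> \<le> (LINT g|\<mu>. b g * D x y)"
    by (rule integral_mono') (use b kb xy D_nonneg in auto)
  finally show "norm ((LINT g|\<mu>. k g x) - (LINT g|\<mu>. k g y)) \<le> (LINT g|\<mu>. b g) * D x y" by simp
qed

definition P :: "('x \<Rightarrow> 'b :: {banach, second_countable_topology}) \<Rightarrow> 'x \<Rightarrow> 'b" where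
  "P f x = (LINT g|\<mu>. f (act g x))"

lemma integrable_bounded:
  fixes f :: "'g \<Rightarrow> 'b :: {banach, second_countable_topology}"
  assumes "f \<in> borel_measurable \<mu>" "\<And>g. g \<in> space \<mu> \<Longrightarrow> norm (f g) \<le> B" shows "integrable \<mu> f"
  using assms by (intro integrable_const_bound[of _ B] AE_I2)

lemma lip_integrable: "lip f C \<Longrightarrow> x \<in> space S \<Longrightarrow> integrable \<mu> (\<lambda>g. f (act g x))"
  by (rule integrable_bounded[of _ "norm (f x\<^sub>0) + C * K"])
    (auto dest: lip_bound intro: measurable_compose[OF act_measurable1 lip_measurable])

text \<open>The spectral gap: mean contraction of the gauge passes to Lipschitz constants.\<close>

lemma lip_P:
  assumes "lip f C" shows "lip (P f) (\<theta> * C)"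
  unfolding lip_def
proof (intro conjI ballI)
  note [measurable] = lip_measurable[OF assms]
  show "P f \<in> borel_measurable S" unfolding P_def[abs_def] by measurable
  show "0 \<le> \<theta> * C" using theta lip_nonneg[OF assms] by simp
  fix x y assume xy: "x \<in> space S" "y \<in> space S"
  have "norm (P f x - P f y) = norm (LINT g|\<mu>. f (act g x) - f (act g y))"
    by (simp add: P_def lip_integrable[OF assms] xy)
  also have "\<dots> \<le> (LINT g|\<mu>. norm (f (act g x) - f (act g y)))" by (rule integral_norm_bound)
  also have "\<dots> \<le> (LINT g|\<mu>. C * D (act g x) (act g y))"
    by (rule integral_mono')
      (use xy lipD[OF assms] D_nonneg lip_nonneg[OF assms] D_integrable in auto)
  also have "\<dots> \<le> C * (\<theta> * D x y)"
    using D_contract[OF xy] lip_nonneg[OF assms] by (simp add: mult_left_mono)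
  finally show "norm (P f x - P f y) \<le> \<theta> * C * D x y" by (simp add: mult_ac)
qed

lemma lip_P_iter: "lip f C \<Longrightarrow> lip ((P ^^ n) f) (\<theta> ^ n * C)"
proof (induction n)
  case (Suc n)
  from lip_P[OF Suc.IH[OF Suc.prems]] show ?case by (simp add: mult_ac)
qed simp

lemma P_diff_bound:
  assumes "lip f C" "x \<in> space S" shows "norm (P f x - f x) \<le> C * K"
proof -
  have "norm (P f x - f x) = norm (LINT g|\<mu>. f (act g x) - f x)"
    using assms by (simp add: P_def lip_integrable prob_space)
  also have "\<dots> \<le> (LINT g|\<mu>. norm (f (act g x) - f x))" by (rule integral_norm_bound)
  also have "\<dots> \<le> (LINT g|\<mu>. C * K)"
    by (rule integral_mono') (use assms lip_osc[OF assms(1)] lip_nonneg[OF assms(1)] K in auto)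
  finally show ?thesis by (simp add: prob_space)
qed

text \<open>The solution is \<open>\<psi> = (\<Sum>n. P\<^sup>n f - P\<^sup>n f x\<^sub>0)\<close>; the series telescopes under \<^const>\<open>P\<close>.\<close>

lemma poisson_equation:
  fixes f :: "'x \<Rightarrow> real"
  assumes f: "lip f C"
  obtains c \<psi> E where "lip \<psi> E" "\<psi> x\<^sub>0 = 0" "\<And>x. x \<in> space S \<Longrightarrow> \<psi> x - P \<psi> x = f x - c"
proof -
  let ?f = "\<lambda>n. (P ^^ n) f"
  have lf: "lip (?f n) (\<theta> ^ n * C)" for n by (rule lip_P_iter[OF f])
  note [measurable] = lip_measurable[OF lf]
  have C0: "0 \<le> C" using lip_nonneg[OF f] .
  have geo: "summable (\<lambda>n. \<theta> ^ n * C * K)"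
    using theta by (intro summable_mult2 summable_geometric) auto
  define h where "h n x = ?f n x - ?f n x\<^sub>0" for n x
  have hb: "norm (h n x) \<le> \<theta> ^ n * C * K" if "x \<in> space S" for n x
    unfolding h_def using lip_osc[OF lf that x0] .
  have hs: "summable (\<lambda>n. h n x)" if "x \<in> space S" for x
    by (rule summable_comparison_test'[OF geo]) (use hb that in auto)
  define \<psi> where "\<psi> x = (\<Sum>n. h n x)" for x
  have [measurable]: "h n \<in> borel_measurable S" for n unfolding h_def[abs_def] by measurable
  have gth: "(\<lambda>n. \<theta> ^ n * C * d) sums (C / (1 - \<theta>) * d)" for d
    using sums_mult2[OF geometric_sums, of \<theta> "C * d"] theta by (simp add: mult_ac)
  have lpsi: "lip \<psi> (C / (1 - \<theta>))"
    unfolding lip_def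
  proof (intro conjI ballI)
    show "\<psi> \<in> borel_measurable S" unfolding \<psi>_def[abs_def] by measurable
    show "0 \<le> C / (1 - \<theta>)" using C0 theta by simp
    fix x y assume xy: "x \<in> space S" "y \<in> space S"
    have "\<psi> x - \<psi> y = (\<Sum>n. h n x - h n y)"
      unfolding \<psi>_def by (intro suminf_diff hs xy)
    also have "norm \<dots> \<le> (\<Sum>n. \<theta> ^ n * C * D x y)"
      by (rule norm_suminf_le) (use lipD[OF lf xy] gth sums_summable in \<open>auto simp: h_def\<close>)
    also have "\<dots> = C / (1 - \<theta>) * D x y" using gth sums_unique by metis
    finally show "norm (\<psi> x - \<psi> y) \<le> C / (1 - \<theta>) * D x y" .
  qed
  have Pn: "P (?f n) x = ?f (Suc n) x" for n x by simp
  \<comment> \<open>By \<open>P_diff_bound\<close> the increments decay geometrically, so the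
    iterates converge at \<open>x\<^sub>0\<close>; summability of \<open>h\<close> then gives the
    same limit at every point.\<close>
  have "Cauchy (\<lambda>n. ?f n x\<^sub>0)"
  proof -
    have "summable (\<lambda>n. ?f (Suc n) x\<^sub>0 - ?f n x\<^sub>0)"
      by (rule summable_comparison_test'[OF geo]) (use P_diff_bound[OF lf x0] in auto)
    then have "convergent (\<lambda>n. \<Sum>i<n. ?f (Suc i) x\<^sub>0 - ?f i x\<^sub>0)"
      by (simp only: summable_iff_convergent)
    then have "convergent (\<lambda>n. ?f n x\<^sub>0)"
      using sum_lessThan_telescope[of "\<lambda>i. ?f i x\<^sub>0"] by (simp add: convergent_diff_const_right_iff)
    then show ?thesis by (rule convergent_Cauchy)
  qed
  then obtain c where c0: "(\<lambda>n. ?f n x\<^sub>0) \<longlonglongrightarrow> c" using Cauchy_convergent_iff convergent_def by blast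
  have c: "(\<lambda>n. ?f n x) \<longlonglongrightarrow> c" if "x \<in> space S" for x
  proof -
    have "(\<lambda>n. h n x + ?f n x\<^sub>0) \<longlonglongrightarrow> 0 + c"
      by (intro tendsto_add c0 summable_LIMSEQ_zero hs that)
    then show ?thesis by (simp add: h_def)
  qed
  have "\<psi> x - P \<psi> x = f x - c" if x: "x \<in> space S" for x
  proof -
    have "P \<psi> x = (LINT g|\<mu>. (\<Sum>n. h n (act g x)))" by (simp add: P_def \<psi>_def)
    also have "\<dots> = (\<Sum>n. LINT g|\<mu>. h n (act g x))"
    proof (rule integral_suminf)
      have hi: "norm (h n (act g x)) \<le> \<theta> ^ n * C * K" if "g \<in> space \<mu>" for g n
        using hb that x by auto
      show "integrable \<mu> (\<lambda>g. h n (act g x))" for n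
        by (rule integrable_bounded[OF _ hi]) (use x in measurable)
      show "AE g in \<mu>. summable (\<lambda>n. norm (h n (act g x)))"
        by (intro AE_I2 summable_comparison_test'[OF geo]) (use hi in auto)
      show "summable (\<lambda>n. LINT g|\<mu>. norm (h n (act g x)))"
      proof (rule summable_comparison_test'[OF geo])
        fix n
        have "(LINT g|\<mu>. norm (h n (act g x))) \<le> (LINT g|\<mu>. \<theta> ^ n * C * K)"
          by (rule integral_mono') (use hi C0 theta K in auto)
        then show "norm (LINT g|\<mu>. norm (h n (act g x))) \<le> \<theta> ^ n * C * K" by (simp add: prob_space)
      qed
    qed
    also have "(\<lambda>n. LINT g|\<mu>. h n (act g x)) = (\<lambda>n. ?f (Suc n) x - ?f n x\<^sub>0)"
    proof
      fix n
      have "(LINT g|\<mu>. h n (act g x)) = P (?f n) x - ?f n x\<^sub>0"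
        unfolding h_def by (simp add: lip_integrable[OF lf x] prob_space P_def[of "?f n"])
      then show "(LINT g|\<mu>. h n (act g x)) = ?f (Suc n) x - ?f n x\<^sub>0" by (simp only: Pn)
    qed
    finally have Ppsi: "P \<psi> x = (\<Sum>n. ?f (Suc n) x - ?f n x\<^sub>0)" .
    \<comment> \<open>Termwise, the series for \<open>\<psi> x\<close> exceeds the one for
      \<open>P \<psi> x\<close> by this telescoping series.\<close>
    have tel: "(\<lambda>n. ?f n x - ?f (Suc n) x) sums (?f 0 x - c)"
      by (rule telescope_sums'[OF c[OF x]])
    have "(\<lambda>n. h n x - (?f n x - ?f (Suc n) x)) sums (\<psi> x - (?f 0 x - c))"
      unfolding \<psi>_def by (intro sums_diff summable_sums hs x tel)
    then have "(\<lambda>n. ?f (Suc n) x - ?f n x\<^sub>0) sums (\<psi> x - (f x - c))"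
      by (simp add: h_def algebra_simps)
    from sums_unique[OF this] Ppsi show ?thesis by simp
  qed
  moreover have "\<psi> x\<^sub>0 = 0" by (simp add: \<psi>_def h_def)
  ultimately show thesis using lpsi that by blast
qed

end

section \<open>Perturbed transfer operators\<close>

lemma integrable_dominated:
  fixes f :: "'a \<Rightarrow> 'b :: {banach, second_countable_topology}"
  assumes "integrable M b" "f \<in> borel_measurable M" "\<And>x. x \<in> space M \<Longrightarrow> norm (f x) \<le> b x"
  shows "integrable M f"
  by (rule Bochner_Integration.integrable_bound[OF assms(1,2)])
    (use assms(3) in \<open>auto intro!: AE_I2 order_trans[OF _ abs_ge_self]\<close>)

lemma norm_iexp_diff_le: "norm (iexp a - iexp b) \<le> \<bar>a - b\<bar>"
proof -
  have "iexp a - iexp b = iexp b * (iexp (a - b) - 1)"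
    by (simp add: right_diff_distrib exp_add[symmetric] algebra_simps)
  then have "norm (iexp a - iexp b) = norm (iexp (a - b) - 1)"
    by (simp add: norm_mult)
  also have "\<dots> \<le> \<bar>a - b\<bar>" using iexp_approx1[of "a - b" 0] by simp
  finally show ?thesis .
qed

section \<open>The second-order Taylor remainder at fractional order\<close>

definition iexp_rem :: "real \<Rightarrow> complex" where
  "iexp_rem u = iexp u - 1 - \<i> * u + of_real (u\<^sup>2 / 2)"

lemma iexp_rem_measurable[measurable]: "iexp_rem \<in> borel_measurable borel"
  unfolding iexp_rem_def[abs_def] by measurable

text \<open>The derivative i (exp (i s) - 1 - i s) is bounded both by s^2 / 2 and by 2 |s|, hence by
  2 |s|^(p - 1) for all p between 2 and 3; the mean value inequality on the segment from -R to R
  does the rest. Differences are estimated because the remainder must be small in Lipschitz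
  norm.\<close>

lemma norm_iexp_rem_diff_le:
  assumes p: "2 \<le> p" "p \<le> 3" and uv: "\<bar>u\<bar> \<le> R" "\<bar>v\<bar> \<le> R"
  shows "norm (iexp_rem u - iexp_rem v) \<le> 2 * R powr (p - 1) * \<bar>u - v\<bar>"
proof -
  let ?f = "\<lambda>z. exp (\<i> * z) - 1 - \<i> * z + z\<^sup>2 / 2"
  let ?f' = "\<lambda>z. \<i> * (exp (\<i> * z) - 1 - \<i> * z)"
  let ?S = "closed_segment (complex_of_real (-R)) (of_real R)"
  have R: "0 \<le> R" using uv by linarith
  have S: "?S = of_real ` {-R..R}"
    using R by (simp only: closed_segment_of_real closed_segment_eq_real_ivl) simp
  have "norm (?f (of_real u) - ?f (of_real v)) \<le> 2 * R powr (p - 1) * norm (of_real u - of_real v :: complex)"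
  proof (rule field_differentiable_bound[where S = ?S and f' = ?f'])
    show "convex ?S" by simp
    show "(?f has_field_derivative ?f' z) (at z within ?S)" for z
      by (auto intro!: derivative_eq_intros simp: algebra_simps)
    fix z assume "z \<in> ?S"
    then obtain s where s: "z = of_real s" "\<bar>s\<bar> \<le> R" unfolding S by (auto simp: abs_le_iff)
    have e1: "norm (iexp s - 1 - \<i> * s) \<le> s\<^sup>2 / 2"
      using iexp_approx1[of s 1] by (simp add: algebra_simps power2_eq_square)
    have e2: "norm (iexp s - 1 - \<i> * s) \<le> 2 * \<bar>s\<bar>"
      using iexp_approx2[of s 1] by (simp add: algebra_simps)
    have "norm (iexp s - 1 - \<i> * s) \<le> 2 * \<bar>s\<bar> powr (p - 1)"
    proof (cases "\<bar>s\<bar> \<le> 1")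
      case True
      have "s\<^sup>2 / 2 \<le> 2 * s\<^sup>2" by simp
      also have "s\<^sup>2 \<le> \<bar>s\<bar> powr (p - 1)"
      proof (cases "s = 0")
        case False
        then have "s\<^sup>2 = \<bar>s\<bar> powr 2" by simp
        also have "\<dots> \<le> \<bar>s\<bar> powr (p - 1)" using True p False by (intro powr_mono') auto
        finally show ?thesis .
      qed simp
      finally show ?thesis using e1 by linarith
    next
      case False
      have "\<bar>s\<bar> powr 1 \<le> \<bar>s\<bar> powr (p - 1)" using False p by (intro powr_mono) auto
      then show ?thesis using e2 by simp
    qed
    also have "\<dots> \<le> 2 * R powr (p - 1)" using s p by (intro mult_left_mono powr_mono2) auto
    finally show "norm (?f' z) \<le> 2 * R powr (p - 1)" by (simp add: norm_mult s)
  next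
    show "of_real u \<in> ?S" "of_real v \<in> ?S" unfolding S using uv by (auto simp: abs_le_iff)
  qed
  then show ?thesis by (simp add: iexp_rem_def flip: of_real_diff)
qed

lemma norm_iexp_rem_le: "2 \<le> p \<Longrightarrow> p \<le> 3 \<Longrightarrow> norm (iexp_rem u) \<le> 2 * \<bar>u\<bar> powr p"
proof -
  assume p: "2 \<le> p" "p \<le> 3"
  have "norm (iexp_rem u - iexp_rem 0) \<le> 2 * \<bar>u\<bar> powr (p - 1) * \<bar>u - 0\<bar>"
    by (rule norm_iexp_rem_diff_le[OF p]) auto
  moreover have "\<bar>u\<bar> powr (p - 1) * \<bar>u\<bar> = \<bar>u\<bar> powr p"
    using powr_mult_base[of "\<bar>u\<bar>" "p - 1"] by (simp add: mult.commute)
  ultimately show ?thesis by (simp add: iexp_rem_def)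
qed

lemma exp_minus_bounds:
  fixes u :: real assumes "0 \<le> u"
  shows "1 - u \<le> exp (- u)" "exp (- u) \<le> 1 - u + u\<^sup>2"
proof -
  show "1 - u \<le> exp (- u)" using exp_ge_add_one_self[of "- u"] by simp
  have "0 \<le> (u - 1 / 2)\<^sup>2" by simp
  then have q: "0 \<le> 1 - u + u\<^sup>2" by (simp add: power2_eq_square algebra_simps)
  \<comment> \<open>The product equals 1 + u^3.\<close>
  have "1 \<le> (1 - u + u\<^sup>2) * (1 + u)" using assms by (simp add: algebra_simps power2_eq_square)
  also have "\<dots> \<le> (1 - u + u\<^sup>2) * exp u"
    using exp_ge_add_one_self[of u] q by (intro mult_left_mono) auto
  finally show "exp (- u) \<le> 1 - u + u\<^sup>2" by (simp add: exp_minus field_simps)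
qed

text \<open>One \<open>el\<close> bounds both the size and the Lipschitz constant: the Lipschitz
  estimate of the Taylor remainder multiplies p - 1 powers of the former by one of the latter, so
  exactly a moment of order \<open>p\<close> is consumed. The bound \<open>1 \<le> el g\<close> lets
  it dominate the lower moments.\<close>

locale lip_cocycle = contracting_chain +
  fixes \<sigma> :: "'a \<Rightarrow> 'b \<Rightarrow> real" and el :: "'a \<Rightarrow> real" and p :: real
  assumes p: "2 < p" "p < 3"
    and sigma_measurable[measurable]: "(\<lambda>(g, x). \<sigma> g x) \<in> borel_measurable (\<mu> \<Otimes>\<^sub>M S)"
    and ell_measurable[measurable]: "el \<in> borel_measurable \<mu>"
    and ell_ge_1: "g \<in> space \<mu> \<Longrightarrow> 1 \<le> el g"
    and ell_int: "integrable \<mu> (\<lambda>g. el g powr p)"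
    and sigma_le: "g \<in> space \<mu> \<Longrightarrow> x \<in> space S \<Longrightarrow> \<bar>\<sigma> g x\<bar> \<le> el g"
    and sigma_lip: "g \<in> space \<mu> \<Longrightarrow> x \<in> space S \<Longrightarrow> y \<in> space S \<Longrightarrow> \<bar>\<sigma> g x - \<sigma> g y\<bar> \<le> el g * D x y"
begin

lemma sigma_measurable1[measurable]: "x \<in> space S \<Longrightarrow> (\<lambda>g. \<sigma> g x) \<in> borel_measurable \<mu>"
  by measurable

definition m :: real where "m = (LINT g|\<mu>. el g powr p)"

lemma ell_powr: "a \<le> p \<Longrightarrow> g \<in> space \<mu> \<Longrightarrow> el g powr a \<le> el g powr p"
  by (intro powr_mono ell_ge_1)

lemma ell_le: "g \<in> space \<mu> \<Longrightarrow> el g \<le> el g powr p" "g \<in> space \<mu> \<Longrightarrow> (el g)\<^sup>2 \<le> el g powr p"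
  using ell_powr[of 1 g] ell_powr[of 2 g] ell_ge_1[of g] p by auto

lemma ell_integrable: "integrable \<mu> el" "integrable \<mu> (\<lambda>g. (el g)\<^sup>2)"
proof -
  show "integrable \<mu> el"
  proof (rule integrable_dominated[OF ell_int])
    show "norm (el g) \<le> el g powr p" if "g \<in> space \<mu>" for g
      using ell_le(1)[OF that] ell_ge_1[OF that] by simp
  qed simp
  show "integrable \<mu> (\<lambda>g. (el g)\<^sup>2)"
  proof (rule integrable_dominated[OF ell_int])
    show "norm ((el g)\<^sup>2) \<le> el g powr p" if "g \<in> space \<mu>" for g
      using ell_le(2)[OF that] by simp
  qed simp
qed

lemma ell_integral_le: "(LINT g|\<mu>. el g) \<le> m" "(LINT g|\<mu>. (el g)\<^sup>2) \<le> m"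
  unfolding m_def using ell_le by (intro integral_mono ell_integrable ell_int; blast)+

lemma m_ge_1: "1 \<le> m"
proof -
  have "(LINT g|\<mu>. 1) \<le> (LINT g|\<mu>. el g)" by (intro integral_mono ell_integrable ell_ge_1) auto
  then show ?thesis using ell_integral_le by (simp add: prob_space)
qed

lemma sigma_integrable: "x \<in> space S \<Longrightarrow> integrable \<mu> (\<lambda>g. \<sigma> g x)"
  by (rule integrable_dominated[OF ell_integrable(1)]) (auto intro: sigma_le)

lemma sigma_sq_le: "g \<in> space \<mu> \<Longrightarrow> x \<in> space S \<Longrightarrow> (\<sigma> g x)\<^sup>2 \<le> (el g)\<^sup>2"
  using sigma_le[of g x] ell_ge_1[of g] by (simp add: abs_le_square_iff[symmetric])

lemma sigma_sq_integrable: "x \<in> space S \<Longrightarrow> integrable \<mu> (\<lambda>g. (\<sigma> g x)\<^sup>2)"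
  by (rule integrable_dominated[OF ell_integrable(2)]) (auto intro: sigma_sq_le)

text \<open>Adding the coboundary of a Poisson solution makes the conditional mean zero at every
  starting point, so that \<open>Q t\<close> applied to a constant has no term linear in t.\<close>

lemma centering:
  obtains lam \<psi> E where "lip \<psi> E" "\<psi> x\<^sub>0 = 0"
    "\<And>x. x \<in> space S \<Longrightarrow> (LINT g|\<mu>. \<sigma> g x - lam + \<psi> (act g x) - \<psi> x) = 0"
proof -
  have "lip (\<lambda>x. LINT g|\<mu>. \<sigma> g x) (LINT g|\<mu>. el g)"
  proof (rule lip_kernel)
    show "0 \<le> el g" if "g \<in> space \<mu>" for g using ell_ge_1[OF that] by simp
  qed (simp_all add: sigma_integrable ell_integrable sigma_lip)
  from poisson_equation[OF this] obtain c \<psi> E where psi: "lip \<psi> E" "\<psi> x\<^sub>0 = 0"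
    "\<And>x. x \<in> space S \<Longrightarrow> \<psi> x - P \<psi> x = (LINT g|\<mu>. \<sigma> g x) - c" by metis
  show thesis
  proof (rule that[OF psi(1,2)])
    fix x assume x: "x \<in> space S"
    have "(LINT g|\<mu>. \<sigma> g x - c + \<psi> (act g x) - \<psi> x) = (LINT g|\<mu>. \<sigma> g x) - c + P \<psi> x - \<psi> x"
      using x sigma_integrable[OF x] lip_integrable[OF psi(1) x] by (simp add: P_def prob_space)
    then show "(LINT g|\<mu>. \<sigma> g x - c + \<psi> (act g x) - \<psi> x) = 0" using psi(3)[OF x] by simp
  qed
qed

text \<open>Recentring stays within the class: the coboundary of \<open>\<psi>\<close> is bounded by
  the oscillation of \<open>\<psi>\<close>, and pathwise it is Lipschitz because one step enlarges
  \<open>D\<close> by at most the factor \<open>K\<close>.\<close>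

lemma lip_cocycle_cohomologous:
  assumes psi: "lip \<psi> E"
  obtains c where "1 \<le> c" "lip_cocycle \<mu> S act D K \<theta> x\<^sub>0 (\<lambda>g x. \<sigma> g x - lam + \<psi> (act g x) - \<psi> x) (\<lambda>g. c * el g) p"
proof
  \<comment> \<open>\<open>E * K\<close> bounds the oscillation of \<open>\<psi>\<close>. The factor
    2 is for the Lipschitz constant, to which both \<open>\<psi> (act g x)\<close> and
    \<open>\<psi> x\<close> contribute.\<close>
  define c where "c = 1 + \<bar>lam\<bar> + 2 * E * K"
  have E0: "0 \<le> E" using lip_nonneg[OF psi] .
  have EK: "E \<le> E * K" using mult_left_mono[OF K E0] by simp
  have c1: "1 \<le> c" using E0 EK by (simp add: c_def)
  then show "1 \<le> c" .
  note [measurable] = lip_measurable[OF psi]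
  show "lip_cocycle \<mu> S act D K \<theta> x\<^sub>0 (\<lambda>g x. \<sigma> g x - lam + \<psi> (act g x) - \<psi> x) (\<lambda>g. c * el g) p"
  proof
    show "2 < p" "p < 3" by (fact p)+
    show "(\<lambda>(g, x). \<sigma> g x - lam + \<psi> (act g x) - \<psi> x) \<in> borel_measurable (\<mu> \<Otimes>\<^sub>M S)"
      by measurable
    show "(\<lambda>g. c * el g) \<in> borel_measurable \<mu>" by measurable
    show "1 \<le> c * el g" if "g \<in> space \<mu>" for g
      using mult_mono[OF c1 ell_ge_1[OF that]] c1 by simp
    show "integrable \<mu> (\<lambda>g. (c * el g) powr p)"
    proof -
      have "integrable \<mu> (\<lambda>g. c powr p * el g powr p)" using ell_int by simp
      moreover have "(c * el g) powr p = c powr p * el g powr p" if "g \<in> space \<mu>" for g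
        using c1 ell_ge_1[OF that] by (simp add: powr_mult)
      ultimately show ?thesis by (subst Bochner_Integration.integrable_cong[OF refl]) auto
    qed
    fix g x assume g: "g \<in> space \<mu>" and x: "x \<in> space S"
    have o: "\<bar>\<psi> (act g x) - \<psi> x\<bar> \<le> E * K" using lip_osc[OF psi, of "act g x" x] g x by simp
    have l1: "1 \<le> el g" by (rule ell_ge_1[OF g])
    have "\<bar>\<sigma> g x - lam + \<psi> (act g x) - \<psi> x\<bar> \<le> el g + (\<bar>lam\<bar> + 2 * E * K)"
      using sigma_le[OF g x] o E0 EK by linarith
    also have "\<dots> \<le> el g + (\<bar>lam\<bar> + 2 * E * K) * el g"
      using mult_left_mono[OF l1, of "\<bar>lam\<bar> + 2 * E * K"] E0 EK by simp
    finally show "\<bar>\<sigma> g x - lam + \<psi> (act g x) - \<psi> x\<bar> \<le> c * el g" by (simp add: c_def algebra_simps)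
    fix y assume y: "y \<in> space S"
    have "\<bar>\<psi> (act g x) - \<psi> (act g y)\<bar> \<le> E * (K * D x y)"
      using lipD[OF psi, of "act g x" "act g y"] mult_left_mono[OF D_act[OF g x y] E0] g x y by simp
    moreover have "\<bar>\<psi> x - \<psi> y\<bar> \<le> E * K * D x y"
      using lipD[OF psi x y] mult_right_mono[OF EK D_nonneg[OF x y]] by simp
    moreover have "2 * E * K * D x y \<le> 2 * E * K * el g * D x y"
      using mult_left_mono[OF l1, of "2 * E * K * D x y"] E0 K D_nonneg[OF x y] by (simp add: mult_ac)
    moreover have "0 \<le> \<bar>lam\<bar> * el g * D x y" using l1 D_nonneg[OF x y] by simp
    ultimately have "\<bar>\<sigma> g x - lam + \<psi> (act g x) - \<psi> x - (\<sigma> g y - lam + \<psi> (act g y) - \<psi> y)\<bar>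
        \<le> el g * D x y + \<bar>lam\<bar> * el g * D x y + 2 * E * K * el g * D x y"
      using sigma_lip[OF g x y] by linarith
    also have "\<dots> = c * el g * D x y" by (simp add: c_def algebra_simps)
    finally show "\<bar>\<sigma> g x - lam + \<psi> (act g x) - \<psi> x - (\<sigma> g y - lam + \<psi> (act g y) - \<psi> y)\<bar> \<le> c * el g * D x y" .
  qed
qed

text \<open>Factoring the difference of squares gives the Lipschitz constant
  \<open>2 * (el g)\<^sup>2\<close>, integrable since p > 2. The constant \<open>s2\<close> is the
  asymptotic variance per step, as \<open>mart_second_moment\<close> confirms.\<close>

lemma variance_poisson:
  obtains s2 chi X where "lip chi X" "chi x\<^sub>0 = 0"
    "\<And>x. x \<in> space S \<Longrightarrow> chi x - P chi x = (LINT g|\<mu>. (\<sigma> g x)\<^sup>2) - s2"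
proof -
  have "lip (\<lambda>x. LINT g|\<mu>. (\<sigma> g x)\<^sup>2) (LINT g|\<mu>. 2 * (el g)\<^sup>2)"
  proof (rule lip_kernel)
    fix g x y assume g: "g \<in> space \<mu>" and x: "x \<in> space S" and y: "y \<in> space S"
    have "\<bar>(\<sigma> g x)\<^sup>2 - (\<sigma> g y)\<^sup>2\<bar> = \<bar>\<sigma> g x - \<sigma> g y\<bar> * \<bar>\<sigma> g x + \<sigma> g y\<bar>"
      by (simp add: square_diff_square_factored power2_eq_square abs_mult mult.commute)
    also have "\<dots> \<le> (el g * D x y) * (2 * el g)"
      using sigma_lip[OF g x y] sigma_le[OF g x] sigma_le[OF g y] ell_ge_1[OF g] D_nonneg[OF x y]
      by (intro mult_mono) auto
    finally show "norm ((\<sigma> g x)\<^sup>2 - (\<sigma> g y)\<^sup>2) \<le> 2 * (el g)\<^sup>2 * D x y"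
      by (simp add: power2_eq_square mult_ac)
  qed (use sigma_sq_integrable ell_integrable in auto)
  from poisson_equation[OF this] show thesis using that by metis
qed

end

text \<open>\<open>chi\<close> is the corrector written u in the overview; the normalisation
  \<open>chi x\<^sub>0 = 0\<close> makes \<open>ft t x\<^sub>0\<close> equal to 1.\<close>

locale centered_cocycle = lip_cocycle +
  fixes s2 :: real and chi :: "'b \<Rightarrow> real" and X :: real
  assumes centered: "x \<in> space S \<Longrightarrow> (LINT g|\<mu>. \<sigma> g x) = 0"
    and chi: "lip chi X" and chi_x0: "chi x\<^sub>0 = 0"
    and chi_eq: "x \<in> space S \<Longrightarrow> chi x - P chi x = (LINT g|\<mu>. (\<sigma> g x)\<^sup>2) - s2"
    and s2: "0 < s2"
begin

lemma X0: "0 \<le> X" by (rule lip_nonneg[OF chi])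

lemma chi_le: "x \<in> space S \<Longrightarrow> \<bar>chi x\<bar> \<le> X * K"
  using lip_bound[OF chi] chi_x0 by simp

lemmas [measurable] = lip_measurable[OF chi]

definition Q :: "real \<Rightarrow> ('b \<Rightarrow> complex) \<Rightarrow> 'b \<Rightarrow> complex" where
  "Q t f x = (CLINT g|\<mu>. iexp (t * \<sigma> g x) * f (act g x))"

definition ft :: "real \<Rightarrow> 'b \<Rightarrow> complex" where
  "ft t x = 1 - of_real (t\<^sup>2 / 2 * chi x)"

lemma lip_ft: "lip (ft t) (t\<^sup>2 / 2 * X)"
  unfolding ft_def[abs_def]
  using lip_diff[OF lip_const lip_of_real[OF lip_cmult[OF chi, of "t\<^sup>2 / 2"]], of 1] by simp

lemma ft_x0: "ft t x\<^sub>0 = 1" by (simp add: ft_def chi_x0)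

lemma Q_integrable:
  assumes "lip f C" "x \<in> space S" shows "integrable \<mu> (\<lambda>g. iexp (t * \<sigma> g x) * f (act g x))"
proof (rule integrable_bounded[of _ "norm (f x\<^sub>0) + C * K"])
  note [measurable] = lip_measurable[OF assms(1)] assms(2)
  show "(\<lambda>g. iexp (t * \<sigma> g x) * f (act g x)) \<in> borel_measurable \<mu>" by measurable
qed (use lip_bound[OF assms(1)] assms in \<open>auto simp: norm_mult\<close>)

lemma Q_cong: "(\<And>x. x \<in> space S \<Longrightarrow> f x = h x) \<Longrightarrow> x \<in> space S \<Longrightarrow> Q t f x = Q t h x"
  unfolding Q_def by (intro Bochner_Integration.integral_cong) auto

lemma Q_linear:
  assumes "lip f C" "lip h E" "x \<in> space S"
  shows "Q t (\<lambda>x. a * f x + b * h x) x = a * Q t f x + b * Q t h x"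
proof -
  have "Q t (\<lambda>x. a * f x + b * h x) x
    = (CLINT g|\<mu>. a * (iexp (t * \<sigma> g x) * f (act g x)) + b * (iexp (t * \<sigma> g x) * h (act g x)))"
    unfolding Q_def by (simp add: algebra_simps)
  then show ?thesis
    using Q_integrable[OF assms(1,3)] Q_integrable[OF assms(2,3)] by (simp add: Q_def)
qed

text \<open>Since |exp (i t \<sigma>) - 1| <= |t| el, the twisted operator is within O(|t|) of
  \<open>P\<close> in both norms, at the cost of the mean of \<open>el\<close> only. The increment
  of the product splits into one of the exponential, paired with the bound \<open>B\<close>, and one
  of \<open>f\<close>, paired with the constant \<open>A\<close>.\<close>

lemma Q_P_diff:
  assumes f: "lip f A" and B: "\<And>x. x \<in> space S \<Longrightarrow> norm (f x) \<le> B"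
  shows "lip (\<lambda>x. Q t f x - P f x) (\<bar>t\<bar> * m * (B + K * A))"
    and "x \<in> space S \<Longrightarrow> norm (Q t f x - P f x) \<le> \<bar>t\<bar> * m * B"
proof -
  note [measurable] = lip_measurable[OF f]
  let ?k = "\<lambda>g x. (iexp (t * \<sigma> g x) - 1) * f (act g x)"
  have A0: "0 \<le> A" by (rule lip_nonneg[OF f])
  have B0: "0 \<le> B" using B[OF x0] norm_ge_zero order_trans by blast
  have ki: "integrable \<mu> (\<lambda>g. ?k g x)" if "x \<in> space S" for x
    using Q_integrable[OF f that, of t] lip_integrable[OF f that] by (simp add: left_diff_distrib)
  have eq: "Q t f x - P f x = (CLINT g|\<mu>. ?k g x)" if "x \<in> space S" for x
    using Q_integrable[OF f that, of t] lip_integrable[OF f that] by (simp add: Q_def P_def left_diff_distrib)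
  have i1: "norm (iexp (t * \<sigma> g x) - 1) \<le> \<bar>t\<bar> * el g" if "g \<in> space \<mu>" "x \<in> space S" for g x
  proof -
    have "norm (iexp (t * \<sigma> g x) - iexp 0) \<le> \<bar>t * \<sigma> g x - 0\<bar>" by (rule norm_iexp_diff_le)
    also have "\<dots> \<le> \<bar>t\<bar> * el g" using sigma_le[OF that] by (simp add: abs_mult mult_left_mono)
    finally show ?thesis by simp
  qed
  have mi: "(LINT g|\<mu>. c * el g) \<le> c * m" if "0 \<le> c" for c
    using mult_left_mono[OF ell_integral_le(1) that] by simp
  have "lip (\<lambda>x. CLINT g|\<mu>. ?k g x) (LINT g|\<mu>. \<bar>t\<bar> * (B + K * A) * el g)"
  proof (rule lip_kernel)
    fix g x y assume g: "g \<in> space \<mu>" and x: "x \<in> space S" and y: "y \<in> space S"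
    have "?k g x - ?k g y = (iexp (t * \<sigma> g x) - iexp (t * \<sigma> g y)) * f (act g x)
        + (iexp (t * \<sigma> g y) - 1) * (f (act g x) - f (act g y))"
      by (simp add: algebra_simps)
    also have "norm \<dots> \<le> norm (iexp (t * \<sigma> g x) - iexp (t * \<sigma> g y)) * norm (f (act g x))
        + norm (iexp (t * \<sigma> g y) - 1) * norm (f (act g x) - f (act g y))"
      by (rule order_trans[OF norm_triangle_ineq]) (simp add: norm_mult)
    also have "\<dots> \<le> (\<bar>t\<bar> * (el g * D x y)) * B + (\<bar>t\<bar> * el g) * (A * (K * D x y))"
    proof (intro add_mono mult_mono)
      have "norm (iexp (t * \<sigma> g x) - iexp (t * \<sigma> g y)) \<le> \<bar>t * \<sigma> g x - t * \<sigma> g y\<bar>" by (rule norm_iexp_diff_le)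
      also have "\<dots> = \<bar>t\<bar> * \<bar>\<sigma> g x - \<sigma> g y\<bar>" by (simp add: abs_mult right_diff_distrib[symmetric])
      also have "\<dots> \<le> \<bar>t\<bar> * (el g * D x y)" by (intro mult_left_mono sigma_lip g x y) simp
      finally show "norm (iexp (t * \<sigma> g x) - iexp (t * \<sigma> g y)) \<le> \<bar>t\<bar> * (el g * D x y)" .
      show "norm (f (act g x) - f (act g y)) \<le> A * (K * D x y)"
        using lipD[OF f, of "act g x" "act g y"] mult_left_mono[OF D_act[OF g x y] A0] g x y by simp
    qed (use B i1 g x y ell_ge_1[OF g] D_nonneg[OF x y] B0 in auto)
    finally show "norm (?k g x - ?k g y) \<le> \<bar>t\<bar> * (B + K * A) * el g * D x y"
      by (simp add: algebra_simps)
  next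
    show "0 \<le> \<bar>t\<bar> * (B + K * A) * el g" if "g \<in> space \<mu>" for g
      using ell_ge_1[OF that] A0 B0 K by simp
  qed (use ki ell_integrable in auto)
  then have "lip (\<lambda>x. CLINT g|\<mu>. ?k g x) (\<bar>t\<bar> * m * (B + K * A))"
    by (rule lip_mono) (use mi[of "\<bar>t\<bar> * (B + K * A)"] A0 B0 K in \<open>simp add: mult_ac\<close>)
  then show "lip (\<lambda>x. Q t f x - P f x) (\<bar>t\<bar> * m * (B + K * A))"
    by (rule lip_cong) (simp add: eq)
  assume x: "x \<in> space S"
  have "norm (Q t f x - P f x) \<le> (LINT g|\<mu>. norm (?k g x))" unfolding eq[OF x] by (rule integral_norm_bound)
  also have "\<dots> \<le> (LINT g|\<mu>. \<bar>t\<bar> * B * el g)"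
  proof (rule integral_mono')
    fix g assume g: "g \<in> space \<mu>"
    have "norm (?k g x) \<le> (\<bar>t\<bar> * el g) * B"
      unfolding norm_mult by (intro mult_mono i1 g x B) (use ell_ge_1[OF g] g x in auto)
    then show "norm (?k g x) \<le> \<bar>t\<bar> * B * el g" by (simp add: mult_ac)
    show "0 \<le> \<bar>t\<bar> * B * el g" using B0 ell_ge_1[OF g] by simp
  qed (use ell_integrable in simp)
  also have "\<dots> \<le> \<bar>t\<bar> * m * B" using mi[of "\<bar>t\<bar> * B"] B0 by (simp add: mult_ac)
  finally show "norm (Q t f x - P f x) \<le> \<bar>t\<bar> * m * B" .
qed

end

context centered_cocycle begin

text \<open>After expansion the term in t vanishes by centering and the terms in t^2 combine to - s2
  t^2 / 2 by the equation for \<open>chi\<close>. There remain the Taylor remainder, O(|t|^p), the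
  error O(|t|^3) from replacing \<open>Q t chi\<close> by \<open>P chi\<close>, and terms O(t^4)
  from the Gaussian factor; for |t| <= 1 and p < 3 all are O(|t|^p).\<close>

lemma perturbed_residual:
  obtains C where "0 \<le> C"
    "\<And>t. \<bar>t\<bar> \<le> 1 \<Longrightarrow> lip (\<lambda>x. Q t (ft t) x - exp (- s2 * t\<^sup>2 / 2) * ft t x) (C * \<bar>t\<bar> powr p)"
    "\<And>t x. \<bar>t\<bar> \<le> 1 \<Longrightarrow> x \<in> space S \<Longrightarrow>
      norm (Q t (ft t) x - exp (- s2 * t\<^sup>2 / 2) * ft t x) \<le> C * \<bar>t\<bar> powr p"
proof -
  define C where "C = s2\<^sup>2 + s2 * (X * K) + 2 * m + m * (X * K + K * X)"
  have Cnn: "0 \<le> s2\<^sup>2" "0 \<le> s2 * X" "0 \<le> s2 * (X * K)" "0 \<le> m * (X * K + K * X)" "0 \<le> 2 * m"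
    using s2 X0 m_ge_1 K by auto
  define H where "H t x = (CLINT g|\<mu>. iexp_rem (t * \<sigma> g x))" for t x
  have pw: "\<bar>t\<bar> ^ 4 \<le> \<bar>t\<bar> powr p" "\<bar>t\<bar> ^ 3 \<le> \<bar>t\<bar> powr p" if "\<bar>t\<bar> \<le> 1" for t :: real
  proof -
    have "\<bar>t\<bar> powr 4 \<le> \<bar>t\<bar> powr p" "\<bar>t\<bar> powr 3 \<le> \<bar>t\<bar> powr p"
      using p by (intro powr_mono'; simp add: that)+
    then show "\<bar>t\<bar> ^ 4 \<le> \<bar>t\<bar> powr p" "\<bar>t\<bar> ^ 3 \<le> \<bar>t\<bar> powr p"
      by simp_all
  qed
  have R: "\<bar>t * \<sigma> g x\<bar> \<le> \<bar>t\<bar> * el g" if "g \<in> space \<mu>" "x \<in> space S" for t g x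
    using sigma_le[OF that] by (simp add: abs_mult mult_left_mono)
  have tl: "(\<bar>t\<bar> * el g) powr p = \<bar>t\<bar> powr p * el g powr p" if "g \<in> space \<mu>" for t g
    using ell_ge_1[OF that] by (simp add: powr_mult)
  have rem: "norm (iexp_rem (t * \<sigma> g x)) \<le> 2 * \<bar>t\<bar> powr p * el g powr p"
    if "g \<in> space \<mu>" "x \<in> space S" for t g x
  proof -
    have "norm (iexp_rem (t * \<sigma> g x)) \<le> 2 * \<bar>t * \<sigma> g x\<bar> powr p"
      using p by (intro norm_iexp_rem_le) auto
    also have "\<dots> \<le> 2 * (\<bar>t\<bar> * el g) powr p"
      using p by (intro mult_left_mono powr_mono2 R that) auto
    finally show ?thesis by (simp add: tl that)
  qed
  have Hi: "integrable \<mu> (\<lambda>g. iexp_rem (t * \<sigma> g x))" if "x \<in> space S" for t x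
    by (rule integrable_dominated[where b = "\<lambda>g. 2 * \<bar>t\<bar> powr p * el g powr p"])
      (use that rem ell_int in auto)
  have Hlip: "lip (H t) (2 * m * \<bar>t\<bar> powr p)" for t
  proof -
    have "lip (\<lambda>x. CLINT g|\<mu>. iexp_rem (t * \<sigma> g x)) (LINT g|\<mu>. 2 * \<bar>t\<bar> powr p * el g powr p)"
    proof (rule lip_kernel)
      fix g x y assume g: "g \<in> space \<mu>" and x: "x \<in> space S" and y: "y \<in> space S"
      have "norm (iexp_rem (t * \<sigma> g x) - iexp_rem (t * \<sigma> g y))
          \<le> 2 * (\<bar>t\<bar> * el g) powr (p - 1) * \<bar>t * \<sigma> g x - t * \<sigma> g y\<bar>"
        using p by (intro norm_iexp_rem_diff_le R g x y) auto
      also have "\<dots> \<le> 2 * (\<bar>t\<bar> * el g) powr (p - 1) * (\<bar>t\<bar> * (el g * D x y))"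
        using sigma_lip[OF g x y]
        by (intro mult_left_mono) (auto simp: right_diff_distrib[symmetric] abs_mult mult_left_mono)
      also have "\<dots> = 2 * ((\<bar>t\<bar> * el g) * (\<bar>t\<bar> * el g) powr (p - 1)) * D x y" by (simp add: mult_ac)
      also have "(\<bar>t\<bar> * el g) * (\<bar>t\<bar> * el g) powr (p - 1) = (\<bar>t\<bar> * el g) powr p"
        using powr_mult_base[of "\<bar>t\<bar> * el g" "p - 1"] ell_ge_1[OF g] by simp
      finally show "norm (iexp_rem (t * \<sigma> g x) - iexp_rem (t * \<sigma> g y)) \<le> 2 * \<bar>t\<bar> powr p * el g powr p * D x y"
        by (simp add: tl g mult_ac)
    qed (use Hi ell_int in auto)
    then show ?thesis by (simp add: H_def[abs_def] m_def mult_ac)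
  qed
  have Hb: "norm (H t x) \<le> 2 * m * \<bar>t\<bar> powr p" if "x \<in> space S" for t x
  proof -
    have "norm (H t x) \<le> (LINT g|\<mu>. norm (iexp_rem (t * \<sigma> g x)))" unfolding H_def by (rule integral_norm_bound)
    also have "\<dots> \<le> (LINT g|\<mu>. 2 * \<bar>t\<bar> powr p * el g powr p)"
      by (rule integral_mono') (use rem that ell_int in auto)
    finally show ?thesis by (simp add: m_def mult_ac)
  qed
  let ?c = "\<lambda>x. complex_of_real (chi x)"
  have clip: "lip ?c X" by (rule lip_of_real[OF chi])
  have cb: "norm (?c x) \<le> X * K" if "x \<in> space S" for x using chi_le[OF that] by simp
  note QP = Q_P_diff[OF clip cb]
  define e where "e t = exp (- s2 * t\<^sup>2 / 2)" for t
  \<comment> \<open>\<open>A\<close> is the Gaussian error that is constant in x, \<open>B\<close>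
    the coefficient of \<open>chi\<close>; both are O(t^4).\<close>
  define A where "A t = 1 - s2 * t\<^sup>2 / 2 - e t" for t
  define B where "B t = t\<^sup>2 / 2 * (1 - e t)" for t
  have u0: "0 \<le> s2 * t\<^sup>2 / 2" for t using s2 by simp
  have ee: "e t = exp (- (s2 * t\<^sup>2 / 2))" for t by (simp add: e_def)
  have Ab: "\<bar>A t\<bar> \<le> s2\<^sup>2 * \<bar>t\<bar> powr p" if "\<bar>t\<bar> \<le> 1" for t
  proof -
    have "\<bar>A t\<bar> \<le> (s2 * t\<^sup>2 / 2)\<^sup>2" using exp_minus_bounds[OF u0[of t]] by (simp add: A_def ee)
    also have "\<dots> = s2\<^sup>2 * \<bar>t\<bar> ^ 4 / 4" by (simp add: power_mult_distrib power_divide flip: power_mult)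
    also have "\<dots> \<le> s2\<^sup>2 * \<bar>t\<bar> ^ 4" by simp
    also have "\<dots> \<le> s2\<^sup>2 * \<bar>t\<bar> powr p" using pw[OF that] by (intro mult_left_mono) auto
    finally show ?thesis .
  qed
  have Bb: "0 \<le> B t" "B t \<le> s2 / 4 * \<bar>t\<bar> powr p" if "\<bar>t\<bar> \<le> 1" for t
  proof -
    have "0 \<le> 1 - e t" using u0[of t] by (simp add: ee)
    then show "0 \<le> B t" by (simp add: B_def)
    have "B t \<le> t\<^sup>2 / 2 * (s2 * t\<^sup>2 / 2)"
      unfolding B_def ee using exp_minus_bounds(1)[OF u0[of t]] by (intro mult_left_mono) auto
    also have "\<dots> = s2 / 4 * \<bar>t\<bar> ^ 4" by (simp add: power4_eq_xxxx power2_eq_square)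
    also have "\<dots> \<le> s2 / 4 * \<bar>t\<bar> powr p" using pw[OF that] s2 by (intro mult_left_mono) auto
    finally show "B t \<le> s2 / 4 * \<bar>t\<bar> powr p" .
  qed
  have T3: "t\<^sup>2 / 2 * (\<bar>t\<bar> * Z) \<le> Z * \<bar>t\<bar> powr p / 2" if "\<bar>t\<bar> \<le> 1" "0 \<le> Z" for t Z
  proof -
    have "\<bar>t\<bar> ^ 3 = \<bar>t\<bar>\<^sup>2 * \<bar>t\<bar>" by (simp add: power3_eq_cube power2_eq_square)
    then have eq: "t\<^sup>2 / 2 * (\<bar>t\<bar> * Z) = Z * \<bar>t\<bar> ^ 3 / 2" by (simp add: mult_ac)
    show ?thesis unfolding eq using mult_left_mono[OF pw(2)[OF that(1)] that(2)] by simp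
  qed
  have decomp: "Q t (ft t) x - e t * ft t x
      = (of_real (A t) - of_real (B t) * ?c x) + (H t x - of_real (t\<^sup>2 / 2) * (Q t ?c x - P ?c x))"
    if x: "x \<in> space S" for t x
  proof -
    have q1: "Q t (ft t) x = Q t (\<lambda>_. 1) x - of_real (t\<^sup>2 / 2) * Q t ?c x"
      using Q_linear[OF lip_const[of 1] clip x, of t 1 "- of_real (t\<^sup>2 / 2)"]
      by (simp add: ft_def[abs_def])
    have q2: "Q t (\<lambda>_. 1) x = 1 - of_real (t\<^sup>2 / 2 * (LINT g|\<mu>. (\<sigma> g x)\<^sup>2)) + H t x"
    proof -
      have "Q t (\<lambda>_. 1) x = (CLINT g|\<mu>. 1 + \<i> * of_real (t * \<sigma> g x) - of_real (t\<^sup>2 / 2 * (\<sigma> g x)\<^sup>2) + iexp_rem (t * \<sigma> g x))"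
        unfolding Q_def by (intro Bochner_Integration.integral_cong refl)
          (simp add: iexp_rem_def power_mult_distrib algebra_simps)
      also have "\<dots> = 1 + \<i> * of_real (t * (LINT g|\<mu>. \<sigma> g x)) - of_real (t\<^sup>2 / 2 * (LINT g|\<mu>. (\<sigma> g x)\<^sup>2)) + H t x"
        using sigma_integrable[OF x] sigma_sq_integrable[OF x] Hi[OF x, of t]
        by (simp add: H_def prob_space integral_complex_of_real flip: of_real_mult)
      finally show ?thesis by (simp add: centered[OF x])
    qed
    have q3: "P ?c x = of_real (s2 + chi x - (LINT g|\<mu>. (\<sigma> g x)\<^sup>2) )" (is "_ = of_real ?pc")
    proof -
      have "P ?c x = of_real (P chi x)" by (simp add: P_def integral_complex_of_real)
      also have "P chi x = chi x - ((LINT g|\<mu>. (\<sigma> g x)\<^sup>2) - s2)" using chi_eq[OF x] by simp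
      finally show ?thesis by simp
    qed
    show ?thesis unfolding q1 q2 q3 A_def B_def
      by (simp add: ft_def algebra_simps add_divide_distrib diff_divide_distrib)
  qed
  show thesis
  proof (rule that[of C])
    show "0 \<le> C" using Cnn by (simp add: C_def)
    fix t :: real assume t: "\<bar>t\<bar> \<le> 1"
    define tp where "tp = \<bar>t\<bar> powr p"
    have tp: "0 \<le> tp" by (simp add: tp_def)
    have l: "lip (\<lambda>x. (of_real (A t) - of_real (B t) * ?c x) + (H t x - of_real (t\<^sup>2 / 2) * (Q t ?c x - P ?c x)))
        ((0 + norm (complex_of_real (B t)) * X) + (2 * m * \<bar>t\<bar> powr p
          + norm (complex_of_real (t\<^sup>2 / 2)) * (\<bar>t\<bar> * m * (X * K + K * X))))"
      by (intro lip_add lip_diff lip_const lip_cmult clip Hlip QP)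
    have t3: "t\<^sup>2 / 2 * (\<bar>t\<bar> * (m * (X * K + K * X))) \<le> m * (X * K + K * X) * tp / 2"
      unfolding tp_def using Cnn by (intro T3 t) auto
    have b3: "B t * X \<le> s2 / 4 * tp * (X * K)"
      using Bb[OF t] X0 s2 mult_left_mono[OF K X0] unfolding tp_def by (intro mult_mono) auto
    have pos: "0 \<le> s2\<^sup>2 * tp" "0 \<le> s2 * (X * K) * tp" "0 \<le> m * (X * K + K * X) * tp" using Cnn tp by simp_all
    have "lip (\<lambda>x. (of_real (A t) - of_real (B t) * ?c x) + (H t x - of_real (t\<^sup>2 / 2) * (Q t ?c x - P ?c x))) (C * tp)"
    proof (rule lip_mono[OF l])
      have "0 + norm (complex_of_real (B t)) * X + (2 * m * \<bar>t\<bar> powr p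
          + norm (complex_of_real (t\<^sup>2 / 2)) * (\<bar>t\<bar> * m * (X * K + K * X)))
        = B t * X + 2 * m * tp + t\<^sup>2 / 2 * (\<bar>t\<bar> * (m * (X * K + K * X)))"
        using Bb[OF t] by (simp add: tp_def mult_ac norm_power)
      also have "\<dots> \<le> s2\<^sup>2 * tp + s2 * (X * K) * tp + 2 * m * tp + m * (X * K + K * X) * tp"
        using t3 b3 pos by (simp add: mult_ac)
      also have "\<dots> = C * tp" by (simp add: C_def algebra_simps)
      finally show "0 + norm (complex_of_real (B t)) * X + (2 * m * \<bar>t\<bar> powr p
          + norm (complex_of_real (t\<^sup>2 / 2)) * (\<bar>t\<bar> * m * (X * K + K * X))) \<le> C * tp" .
    qed
    then show "lip (\<lambda>x. Q t (ft t) x - exp (- s2 * t\<^sup>2 / 2) * ft t x) (C * \<bar>t\<bar> powr p)"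
      unfolding tp_def by (rule lip_cong) (rule decomp[unfolded e_def, symmetric])
  next
    fix t :: real and x assume t: "\<bar>t\<bar> \<le> 1" and x: "x \<in> space S"
    define tp where "tp = \<bar>t\<bar> powr p"
    have tp: "0 \<le> tp" by (simp add: tp_def)
    have n: "norm ((of_real (A t) - of_real (B t) * ?c x) + (H t x - of_real (t\<^sup>2 / 2) * (Q t ?c x - P ?c x)))
      \<le> (norm (complex_of_real (A t)) + norm (of_real (B t) * ?c x)) + (norm (H t x) + norm (of_real (t\<^sup>2 / 2) * (Q t ?c x - P ?c x)))"
      by (intro order_trans[OF norm_triangle_ineq] add_mono norm_triangle_ineq4)
    have 1: "norm (complex_of_real (A t)) \<le> s2\<^sup>2 * tp" using Ab[OF t] by (simp add: tp_def)
    have 2: "norm (of_real (B t) * ?c x) \<le> (s2 / 4 * tp) * (X * K)"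
      unfolding norm_mult tp_def using Bb[OF t] cb[OF x] s2 by (intro mult_mono) auto
    have "norm (of_real (t\<^sup>2 / 2) * (Q t ?c x - P ?c x)) = t\<^sup>2 / 2 * norm (Q t ?c x - P ?c x)"
      by (simp add: norm_mult norm_power)
    also have "\<dots> \<le> t\<^sup>2 / 2 * (\<bar>t\<bar> * m * (X * K))"
      by (intro mult_left_mono QP(2) x) auto
    also have "\<dots> = t\<^sup>2 / 2 * (\<bar>t\<bar> * (m * (X * K)))" by (simp only: mult.assoc)
    also have "\<dots> \<le> m * (X * K) * tp / 2"
      unfolding tp_def using X0 K m_ge_1 by (intro T3 t) auto
    finally have 3: "norm (of_real (t\<^sup>2 / 2) * (Q t ?c x - P ?c x)) \<le> m * (X * K) * tp / 2" .
    have pos: "0 \<le> m * (X * K) * tp" "0 \<le> s2 * (X * K) * tp"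
      using X0 K m_ge_1 s2 tp by auto
    have "norm (Q t (ft t) x - e t * ft t x) \<le> s2\<^sup>2 * tp + s2 * (X * K) * tp + 2 * m * tp + 2 * (m * (X * K) * tp)"
      unfolding decomp[OF x] using n 1 2 3 Hb[OF x, of t, folded tp_def] pos by (simp add: mult_ac)
    also have "\<dots> \<le> C * tp" by (simp add: C_def algebra_simps)
    finally show "norm (Q t (ft t) x - exp (- s2 * t\<^sup>2 / 2) * ft t x) \<le> C * \<bar>t\<bar> powr p"
      by (simp add: e_def tp_def)
  qed
qed

text \<open>The inequalities say that \<open>Q t\<close> contracts both coordinates of the adapted
  norm. At t = 0 the second is strict, because \<open>\<Lambda> * (1 - \<theta>) = 2 * K\<close>, so
  it persists for small t. The first is an equality there; it survives because s2 / 2 exceeds c by 3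
  s2 / 8, while the errors are o(t^2).\<close>

lemma small_parameters:
  assumes C: "0 \<le> C"
  obtains c r \<Lambda> where "0 < c" "c \<le> s2 / 2" "0 < r" "r \<le> 1" "0 < \<Lambda>"
    "\<And>t. \<bar>t\<bar> \<le> r \<Longrightarrow> exp (- s2 * t\<^sup>2 / 2) + C * \<bar>t\<bar> powr p * (1 + \<Lambda> * (1 + X)) \<le> exp (- c * t\<^sup>2)"
    "\<And>t. \<bar>t\<bar> \<le> r \<Longrightarrow> K + \<Lambda> * (\<theta> + 2 * m * K * \<bar>t\<bar> + K * X * t\<^sup>2) \<le> \<Lambda> * exp (- c * t\<^sup>2)"
proof -
  define c where "c = s2 / 8"
  define \<Lambda> where "\<Lambda> = 2 * K / (1 - \<theta>)"
  have L0: "0 < \<Lambda>" using K theta by (simp add: \<Lambda>_def)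
  have LK: "K = \<Lambda> * (1 - \<theta>) / 2" using theta by (simp add: \<Lambda>_def)
  have gap: "K + \<Lambda> * \<theta> - \<Lambda> < 0" using L0 theta by (subst LK) (simp add: field_simps)
  define C' where "C' = C * (1 + \<Lambda> * (1 + X))"
  have "((\<lambda>t. K + \<Lambda> * (\<theta> + 2 * m * K * \<bar>t\<bar> + K * X * t\<^sup>2) - \<Lambda> * exp (- c * t\<^sup>2)) \<longlongrightarrow> K + \<Lambda> * \<theta> - \<Lambda>) (at 0)"
    by (auto intro!: tendsto_eq_intros)
  from order_tendstoD(2)[OF this gap]
  have e1: "eventually (\<lambda>t. K + \<Lambda> * (\<theta> + 2 * m * K * \<bar>t\<bar> + K * X * t\<^sup>2) - \<Lambda> * exp (- c * t\<^sup>2) < 0) (at 0)" .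
  have "((\<lambda>t::real. \<bar>t\<bar> powr (p - 2)) \<longlongrightarrow> 0 powr (p - 2)) (at 0)"
    by (rule tendsto_powr') (use p in \<open>auto intro!: tendsto_eq_intros\<close>)
  then have "((\<lambda>t. s2\<^sup>2 / 4 * t\<^sup>2 + C' * \<bar>t\<bar> powr (p - 2)) \<longlongrightarrow> s2\<^sup>2 / 4 * 0\<^sup>2 + C' * 0 powr (p - 2)) (at 0)"
    by (intro tendsto_add tendsto_mult tendsto_const tendsto_power tendsto_ident_at)
  from order_tendstoD(2)[OF this, of "3 * s2 / 8"]
  have e2: "eventually (\<lambda>t. s2\<^sup>2 / 4 * t\<^sup>2 + C' * \<bar>t\<bar> powr (p - 2) < 3 * s2 / 8) (at 0)" using s2 by simp
  from eventually_conj[OF e1 e2] obtain d where d: "d > 0"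
    "\<And>t. t \<noteq> 0 \<Longrightarrow> \<bar>t\<bar> < d \<Longrightarrow> K + \<Lambda> * (\<theta> + 2 * m * K * \<bar>t\<bar> + K * X * t\<^sup>2) - \<Lambda> * exp (- c * t\<^sup>2) < 0
      \<and> s2\<^sup>2 / 4 * t\<^sup>2 + C' * \<bar>t\<bar> powr (p - 2) < 3 * s2 / 8"
    unfolding eventually_at by (auto simp: dist_real_def)
  define r where "r = min 1 (d / 2)"
  show thesis
  proof (rule that[of c r \<Lambda>])
    show "0 < c" "c \<le> s2 / 2" using s2 by (auto simp: c_def)
    show "0 < r" "r \<le> 1" using d by (auto simp: r_def)
    show "0 < \<Lambda>" by (rule L0)
    fix t assume t: "\<bar>t\<bar> \<le> r"
    then have td: "\<bar>t\<bar> < d" using d by (auto simp: r_def)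
    show "K + \<Lambda> * (\<theta> + 2 * m * K * \<bar>t\<bar> + K * X * t\<^sup>2) \<le> \<Lambda> * exp (- c * t\<^sup>2)"
      using d(2)[OF _ td] gap by (cases "t = 0") auto
    show "exp (- s2 * t\<^sup>2 / 2) + C * \<bar>t\<bar> powr p * (1 + \<Lambda> * (1 + X)) \<le> exp (- c * t\<^sup>2)"
    proof (cases "t = 0")
      case False
      have "\<bar>t\<bar> powr p = t\<^sup>2 * \<bar>t\<bar> powr (p - 2)"
        using powr_add[of "\<bar>t\<bar>" 2 "p - 2"] False by simp
      moreover have "t\<^sup>2 * (s2\<^sup>2 / 4 * t\<^sup>2 + C' * \<bar>t\<bar> powr (p - 2)) \<le> t\<^sup>2 * (3 * s2 / 8)"
        using d(2)[OF False td] by (intro mult_left_mono) auto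
      ultimately have *: "(s2 * t\<^sup>2 / 2)\<^sup>2 + C' * \<bar>t\<bar> powr p \<le> 3 * s2 / 8 * t\<^sup>2"
        by (simp add: power2_eq_square algebra_simps)
      have "exp (- (s2 * t\<^sup>2 / 2)) \<le> 1 - s2 * t\<^sup>2 / 2 + (s2 * t\<^sup>2 / 2)\<^sup>2"
        using s2 by (intro exp_minus_bounds) simp
      then have "exp (- s2 * t\<^sup>2 / 2) + C' * \<bar>t\<bar> powr p \<le> 1 - c * t\<^sup>2"
        using * by (simp add: c_def)
      also have "\<dots> \<le> exp (- (c * t\<^sup>2))" using s2 by (intro exp_minus_bounds) (simp add: c_def)
      finally show ?thesis by (simp add: C'_def mult_ac)
    qed (use p in simp)
  qed
qed

section \<open>The norm adapted to the approximate eigenfunction\<close>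

text \<open>Again a relation to a bound: \<open>e\<close> dominates |\<alpha>| + \<Lambda> Lip(w) in
  a splitting along \<open>ft t\<close>. Evaluation at \<open>x\<^sub>0\<close> forces
  \<open>\<alpha> = f x\<^sub>0\<close>. The weight \<open>\<Lambda>\<close> compensates for the
  part of w that \<open>Q t\<close> feeds back into the coefficient of \<open>ft t\<close>.\<close>

definition nrm :: "real \<Rightarrow> real \<Rightarrow> ('b \<Rightarrow> complex) \<Rightarrow> real \<Rightarrow> bool" where
  "nrm \<Lambda> t f e \<longleftrightarrow> (\<exists>\<alpha> w b. lip w b \<and> w x\<^sub>0 = 0 \<and> (\<forall>x\<in>space S. f x = \<alpha> * ft t x + w x) \<and> norm \<alpha> + \<Lambda> * b \<le> e)"

lemma nrmI:
  "lip w b \<Longrightarrow> w x\<^sub>0 = 0 \<Longrightarrow> (\<And>x. x \<in> space S \<Longrightarrow> f x = \<alpha> * ft t x + w x) \<Longrightarrow> norm \<alpha> + \<Lambda> * b \<le> e \<Longrightarrow> nrm \<Lambda> t f e"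
  unfolding nrm_def by blast

lemma nrm_x0: "nrm \<Lambda> t f e \<Longrightarrow> 0 \<le> \<Lambda> \<Longrightarrow> norm (f x\<^sub>0) \<le> e"
proof -
  assume "nrm \<Lambda> t f e" and L: "0 \<le> \<Lambda>"
  then obtain \<alpha> w b where w: "lip w b" "w x\<^sub>0 = 0" "\<forall>x\<in>space S. f x = \<alpha> * ft t x + w x" "norm \<alpha> + \<Lambda> * b \<le> e"
    unfolding nrm_def by blast
  have "0 \<le> \<Lambda> * b" using L lip_nonneg[OF w(1)] by simp
  then show "norm (f x\<^sub>0) \<le> e" using w x0 by (simp add: ft_x0)
qed

lemma nrm_cong: "(\<And>x. x \<in> space S \<Longrightarrow> f x = h x) \<Longrightarrow> nrm \<Lambda> t f e \<Longrightarrow> nrm \<Lambda> t h e"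
  unfolding nrm_def by auto

lemma nrm_add:
  assumes "nrm \<Lambda> t f e" "nrm \<Lambda> t h e'" shows "nrm \<Lambda> t (\<lambda>x. f x + h x) (e + e')"
proof -
  obtain \<alpha> w b where 1: "lip w b" "w x\<^sub>0 = 0" "\<forall>x\<in>space S. f x = \<alpha> * ft t x + w x" "norm \<alpha> + \<Lambda> * b \<le> e"
    using assms(1) unfolding nrm_def by blast
  obtain \<alpha>' w' b' where 2: "lip w' b'" "w' x\<^sub>0 = 0" "\<forall>x\<in>space S. h x = \<alpha>' * ft t x + w' x" "norm \<alpha>' + \<Lambda> * b' \<le> e'"
    using assms(2) unfolding nrm_def by blast
  show ?thesis
    by (rule nrmI[of "\<lambda>x. w x + w' x" "b + b'" _ "\<alpha> + \<alpha>'"])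
      (use 1 2 norm_triangle_ineq[of \<alpha> \<alpha>'] in \<open>auto intro: lip_add simp: algebra_simps\<close>)
qed

lemma nrm_cmult:
  assumes "nrm \<Lambda> t f e" shows "nrm \<Lambda> t (\<lambda>x. a * f x) (norm a * e)"
proof -
  obtain \<alpha> w b where 1: "lip w b" "w x\<^sub>0 = 0" "\<forall>x\<in>space S. f x = \<alpha> * ft t x + w x" "norm \<alpha> + \<Lambda> * b \<le> e"
    using assms(1) unfolding nrm_def by blast
  show ?thesis
  proof (rule nrmI[of "\<lambda>x. a * w x" "norm a * b" _ "a * \<alpha>"])
    have "norm a * (norm \<alpha> + \<Lambda> * b) \<le> norm a * e" by (intro mult_left_mono 1) auto
    then show "norm (a * \<alpha>) + \<Lambda> * (norm a * b) \<le> norm a * e" by (simp add: norm_mult algebra_simps)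
    show "lip (\<lambda>x. a * w x) (norm a * b)" by (rule lip_cmult[OF 1(1)])
  qed (use 1 in \<open>auto simp: algebra_simps\<close>)
qed

text \<open>The coefficient must be \<open>F x\<^sub>0\<close>; subtracting that multiple of
  \<open>ft t\<close> adds at most \<open>a * (t\<^sup>2 / 2 * X)\<close> to the Lipschitz
  constant.\<close>

lemma nrm_lip:
  assumes F: "lip F b" and b0: "norm (F x\<^sub>0) \<le> a" and L: "0 \<le> \<Lambda>"
  shows "nrm \<Lambda> t F (a + \<Lambda> * (b + a * (t\<^sup>2 / 2 * X)))"
proof (rule nrmI[of "\<lambda>x. F x - F x\<^sub>0 * ft t x" "b + norm (F x\<^sub>0) * (t\<^sup>2 / 2 * X)" _ "F x\<^sub>0"])
  show "lip (\<lambda>x. F x - F x\<^sub>0 * ft t x) (b + norm (F x\<^sub>0) * (t\<^sup>2 / 2 * X))"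
    by (intro lip_diff F lip_cmult lip_ft)
  show "norm (F x\<^sub>0) + \<Lambda> * (b + norm (F x\<^sub>0) * (t\<^sup>2 / 2 * X)) \<le> a + \<Lambda> * (b + a * (t\<^sup>2 / 2 * X))"
    using L X0 b0 by (intro add_mono mult_left_mono mult_right_mono) auto
qed (simp_all add: ft_x0)

text \<open>The difference \<open>u\<close> between the iterate and
  \<open>exp (- s2 * t\<^sup>2 / 2) ^ n * ft t\<close> obeys an affine recursion, contracted by
  \<open>Q t\<close> and driven by the residual \<open>R\<close>. It starts as
  \<open>t\<^sup>2 / 2 * chi\<close> and receives a residual of size |t|^p at every step: these are
  the two terms of the bound.\<close>

theorem perturbed_iterates:
  obtains C c r where "0 < c" "0 < r" "0 \<le> C"
    "\<And>t n. \<bar>t\<bar> \<le> r \<Longrightarrow> norm ((Q t ^^ n) (\<lambda>_. 1) x\<^sub>0 - exp (- real n * s2 * t\<^sup>2 / 2))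
       \<le> C * (t\<^sup>2 + real n * \<bar>t\<bar> powr p) * exp (- c * real n * t\<^sup>2)"
proof -
  obtain C1 where C1: "0 \<le> C1"
    "\<And>t. \<bar>t\<bar> \<le> 1 \<Longrightarrow> lip (\<lambda>x. Q t (ft t) x - exp (- s2 * t\<^sup>2 / 2) * ft t x) (C1 * \<bar>t\<bar> powr p)"
    "\<And>t x. \<bar>t\<bar> \<le> 1 \<Longrightarrow> x \<in> space S \<Longrightarrow>
      norm (Q t (ft t) x - exp (- s2 * t\<^sup>2 / 2) * ft t x) \<le> C1 * \<bar>t\<bar> powr p"
    using perturbed_residual by blast
  obtain c r \<Lambda> where c: "0 < c" "c \<le> s2 / 2" "0 < r" "r \<le> 1" "0 < \<Lambda>"
    and p1: "\<And>t. \<bar>t\<bar> \<le> r \<Longrightarrow> exp (- s2 * t\<^sup>2 / 2) + C1 * \<bar>t\<bar> powr p * (1 + \<Lambda> * (1 + X)) \<le> exp (- c * t\<^sup>2)"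
    and p2: "\<And>t. \<bar>t\<bar> \<le> r \<Longrightarrow> K + \<Lambda> * (\<theta> + 2 * m * K * \<bar>t\<bar> + K * X * t\<^sup>2) \<le> \<Lambda> * exp (- c * t\<^sup>2)"
    using small_parameters[OF C1(1)] by blast
  define R where "R t x = Q t (ft t) x - exp (- s2 * t\<^sup>2 / 2) * ft t x" for t x
  define C2 where "C2 = C1 * (1 + \<Lambda> * (1 + X))"
  have C20: "0 \<le> C2" using C1 c X0 by (simp add: C2_def)
  have t2: "t\<^sup>2 / 2 \<le> 1" "t\<^sup>2 \<le> 1" if "\<bar>t\<bar> \<le> r" for t
  proof -
    have "\<bar>t\<bar> \<le> 1" using that c by linarith
    then show "t\<^sup>2 \<le> 1" by (simp add: abs_square_le_1)
    then show "t\<^sup>2 / 2 \<le> 1" by simp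
  qed
  have nrmR: "nrm \<Lambda> t (R t) (C2 * \<bar>t\<bar> powr p)" if t: "\<bar>t\<bar> \<le> r" for t
  proof -
    have t1: "\<bar>t\<bar> \<le> 1" using t c by linarith
    let ?q = "C1 * \<bar>t\<bar> powr p"
    have "nrm \<Lambda> t (R t) (?q + \<Lambda> * (?q + ?q * (t\<^sup>2 / 2 * X)))"
      unfolding R_def[abs_def] by (rule nrm_lip) (use C1(2,3)[OF t1] x0 c in auto)
    moreover have "?q * (t\<^sup>2 / 2 * X) \<le> ?q * (1 * X)"
      using t2[OF t] C1 X0 by (intro mult_left_mono mult_right_mono) auto
    then have "\<Lambda> * (?q + ?q * (t\<^sup>2 / 2 * X)) \<le> \<Lambda> * (?q + ?q * (1 * X))"
      using c(5) by simp
    then have "?q + \<Lambda> * (?q + ?q * (t\<^sup>2 / 2 * X)) \<le> C2 * \<bar>t\<bar> powr p"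
      by (simp add: C2_def algebra_simps)
    ultimately show ?thesis unfolding nrm_def by (meson order_trans)
  qed
  \<comment> \<open>\<open>Q t\<close> sends \<open>ft t\<close> to a multiple of itself plus
    \<open>R t\<close>, and w to \<open>P w\<close> plus an error O(|t|). The value of
    \<open>Q t w\<close> at \<open>x\<^sub>0\<close> is not small, only at most
    \<open>K * b\<close>; this is the term that \<open>\<Lambda>\<close> absorbs.\<close>
  have nrmQ: "nrm \<Lambda> t (Q t f) (exp (- c * t\<^sup>2) * e)" if t: "\<bar>t\<bar> \<le> r" and f: "nrm \<Lambda> t f e" for t f e
  proof -
    obtain \<alpha> w b where w: "lip w b" "w x\<^sub>0 = 0" and fw: "\<And>x. x \<in> space S \<Longrightarrow> f x = \<alpha> * ft t x + w x"
      and e: "norm \<alpha> + \<Lambda> * b \<le> e"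
      using f unfolding nrm_def by blast
    have t1: "\<bar>t\<bar> \<le> 1" using t c by linarith
    have b0: "0 \<le> b" by (rule lip_nonneg[OF w(1)])
    have wb: "norm (w x) \<le> b * K" if "x \<in> space S" for x using lip_bound[OF w(1) that] w(2) by simp
    let ?q = "C1 * \<bar>t\<bar> powr p"
    let ?F = "\<lambda>x. \<alpha> * R t x + (Q t w x - P w x + P w x)"
    have Qw: "Q t f x = \<alpha> * exp (- s2 * t\<^sup>2 / 2) * ft t x + ?F x" if x: "x \<in> space S" for x
    proof -
      have "Q t f x = Q t (\<lambda>x. \<alpha> * ft t x + 1 * w x) x" using x by (intro Q_cong) (auto simp: fw)
      also have "\<dots> = \<alpha> * Q t (ft t) x + 1 * Q t w x" by (rule Q_linear[OF lip_ft w(1) x])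
      finally show ?thesis by (simp add: R_def algebra_simps)
    qed
    have lF: "lip ?F (norm \<alpha> * ?q + (\<bar>t\<bar> * m * (b * K + K * b) + \<theta> * b))"
      by (intro lip_add lip_cmult lip_P w Q_P_diff wb) (use C1(2)[OF t1] in \<open>simp add: R_def[abs_def]\<close>)
    have F0: "norm (?F x\<^sub>0) \<le> norm \<alpha> * ?q + K * b"
    proof -
      have "norm (Q t w x\<^sub>0) \<le> (LINT g|\<mu>. norm (iexp (t * \<sigma> g x\<^sub>0) * w (act g x\<^sub>0)))"
        unfolding Q_def by (rule integral_norm_bound)
      also have "\<dots> \<le> (LINT g|\<mu>. b * K)"
        by (rule integral_mono') (use wb x0 b0 K in \<open>auto simp: norm_mult\<close>)
      finally have "norm (Q t w x\<^sub>0) \<le> K * b" by (simp add: prob_space mult.commute)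
      moreover have "norm (\<alpha> * R t x\<^sub>0) \<le> norm \<alpha> * ?q"
        unfolding norm_mult R_def by (intro mult_left_mono C1 t1 x0) auto
      ultimately show ?thesis using norm_triangle_ineq[of "\<alpha> * R t x\<^sub>0" "Q t w x\<^sub>0"] by simp
    qed
    let ?a = "norm \<alpha> * ?q + K * b" and ?b = "norm \<alpha> * ?q + (\<bar>t\<bar> * m * (b * K + K * b) + \<theta> * b)"
    have "nrm \<Lambda> t ?F (?a + \<Lambda> * (?b + ?a * (t\<^sup>2 / 2 * X)))"
      using c by (intro nrm_lip lF F0) auto
    moreover have "nrm \<Lambda> t (\<lambda>x. \<alpha> * exp (- s2 * t\<^sup>2 / 2) * ft t x) (norm \<alpha> * exp (- s2 * t\<^sup>2 / 2))"
      by (rule nrmI[OF lip_const[of 0]]) (auto simp: norm_mult)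
    ultimately have "nrm \<Lambda> t (\<lambda>x. \<alpha> * exp (- s2 * t\<^sup>2 / 2) * ft t x + ?F x)
        (norm \<alpha> * exp (- s2 * t\<^sup>2 / 2) + (?a + \<Lambda> * (?b + ?a * (t\<^sup>2 / 2 * X))))"
      by (rule nrm_add[rotated])
    then have n: "nrm \<Lambda> t (Q t f) (norm \<alpha> * exp (- s2 * t\<^sup>2 / 2) + (?a + \<Lambda> * (?b + ?a * (t\<^sup>2 / 2 * X))))"
      by (rule nrm_cong[rotated]) (simp add: Qw)
    have q0: "0 \<le> norm \<alpha> * ?q" using C1 by simp
    have "norm \<alpha> * ?q * (t\<^sup>2 / 2 * X) \<le> norm \<alpha> * ?q * (1 * X)"
      using t2[OF t] X0 q0 by (intro mult_left_mono mult_right_mono) auto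
    moreover have "K * b * (t\<^sup>2 / 2 * X) \<le> K * b * (t\<^sup>2 * X)"
      using X0 K b0 by (intro mult_left_mono mult_right_mono) auto
    ultimately have "?a * (t\<^sup>2 / 2 * X) \<le> norm \<alpha> * ?q * X + K * b * (t\<^sup>2 * X)"
      unfolding distrib_right by (simp only: mult_1 add_mono)
    then have "\<Lambda> * (?b + ?a * (t\<^sup>2 / 2 * X)) \<le> \<Lambda> * (?b + (norm \<alpha> * ?q * X + K * b * (t\<^sup>2 * X)))"
      using c(5) by (simp only: mult_le_cancel_left_pos add_le_cancel_left)
    then have "norm \<alpha> * exp (- s2 * t\<^sup>2 / 2) + (?a + \<Lambda> * (?b + ?a * (t\<^sup>2 / 2 * X)))
       \<le> norm \<alpha> * (exp (- s2 * t\<^sup>2 / 2) + ?q * (1 + \<Lambda> * (1 + X)))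
        + b * (K + \<Lambda> * (\<theta> + 2 * m * K * \<bar>t\<bar> + K * X * t\<^sup>2))"
      by (simp add: algebra_simps)
    also have "\<dots> \<le> norm \<alpha> * exp (- c * t\<^sup>2) + b * (\<Lambda> * exp (- c * t\<^sup>2))"
      by (intro add_mono mult_left_mono p1 p2 t b0) auto
    also have "\<dots> = exp (- c * t\<^sup>2) * (norm \<alpha> + \<Lambda> * b)" by (simp add: algebra_simps)
    also have "\<dots> \<le> exp (- c * t\<^sup>2) * e" by (intro mult_left_mono e) auto
    finally show ?thesis using n unfolding nrm_def by (meson order_trans)
  qed
  define u where "u t n x = (Q t ^^ n) (\<lambda>_. 1) x - exp (- s2 * t\<^sup>2 / 2) ^ n * ft t x" for t n x
  have main: "nrm \<Lambda> t (u t n) ((\<Lambda> * X * t\<^sup>2 + real n * (C2 * exp c * \<bar>t\<bar> powr p)) * exp (- c * t\<^sup>2) ^ n)"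
    if t: "\<bar>t\<bar> \<le> r" for t n
  proof (induction n)
    case 0
    have "nrm \<Lambda> t (u t 0) (\<Lambda> * X * t\<^sup>2)"
    proof (rule nrmI[of "\<lambda>x. of_real (t\<^sup>2 / 2 * chi x)" "t\<^sup>2 / 2 * X" _ 0])
      show "lip (\<lambda>x. complex_of_real (t\<^sup>2 / 2 * chi x)) (t\<^sup>2 / 2 * X)"
        using lip_of_real[OF lip_cmult[OF chi, of "t\<^sup>2 / 2"]] by simp
      have "\<Lambda> * (t\<^sup>2 / 2 * X) = (\<Lambda> * X * t\<^sup>2) / 2" by simp
      also have "\<dots> \<le> \<Lambda> * X * t\<^sup>2" using c X0 by simp
      finally show "norm (0::complex) + \<Lambda> * (t\<^sup>2 / 2 * X) \<le> \<Lambda> * X * t\<^sup>2" by simp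
    qed (auto simp: u_def ft_def chi_x0)
    then show ?case by simp
  next
    case (Suc n)
    let ?E = "exp (- s2 * t\<^sup>2 / 2)"
    have lipw: "\<exists>w b. lip w b \<and> (\<forall>x\<in>space S. u t n x = w x)"
    proof -
      obtain \<alpha> w b where w: "lip w b" "\<forall>x\<in>space S. u t n x = \<alpha> * ft t x + w x"
        using Suc.IH[unfolded nrm_def] by (elim exE conjE) (rule that)
      show ?thesis
        by (intro exI conjI) (rule lip_add[OF lip_cmult[OF lip_ft, of \<alpha>] w(1)], rule w(2))
    qed
    then obtain w b where w: "lip w b" "\<And>x. x \<in> space S \<Longrightarrow> u t n x = w x" by blast
    have eq: "u t (Suc n) x = Q t (u t n) x + of_real (?E ^ n) * R t x" if x: "x \<in> space S" for x
    proof -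
      have "Q t ((Q t ^^ n) (\<lambda>_. 1)) x = Q t (\<lambda>x. 1 * w x + of_real (?E ^ n) * ft t x) x"
        using x by (intro Q_cong) (simp_all add: w(2)[symmetric] u_def)
      also have "\<dots> = 1 * Q t w x + of_real (?E ^ n) * Q t (ft t) x"
        by (rule Q_linear[OF w(1) lip_ft x])
      also have "Q t w x = Q t (u t n) x" using x w by (intro Q_cong) auto
      finally show ?thesis unfolding u_def R_def by (simp add: algebra_simps)
    qed
    let ?A = "(\<Lambda> * X * t\<^sup>2 + real n * (C2 * exp c * \<bar>t\<bar> powr p)) * exp (- c * t\<^sup>2) ^ n"
    have "nrm \<Lambda> t (\<lambda>x. Q t (u t n) x + of_real (?E ^ n) * R t x)
        (exp (- c * t\<^sup>2) * ?A + norm (complex_of_real (?E ^ n)) * (C2 * \<bar>t\<bar> powr p))"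
      by (intro nrm_add nrmQ nrm_cmult nrmR t Suc.IH)
    then have n: "nrm \<Lambda> t (u t (Suc n)) (exp (- c * t\<^sup>2) * ?A + norm (complex_of_real (?E ^ n)) * (C2 * \<bar>t\<bar> powr p))"
      by (rule nrm_cong[rotated]) (simp add: eq)
    have "norm (complex_of_real (?E ^ n)) = ?E ^ n" by (simp add: norm_power)
    also have "\<dots> \<le> exp (- c * t\<^sup>2) ^ n"
    proof (intro power_mono)
      have "c * t\<^sup>2 \<le> s2 / 2 * t\<^sup>2" using c by (intro mult_right_mono) auto
      then show "?E \<le> exp (- c * t\<^sup>2)" by simp
    qed simp
    \<comment> \<open>The new residual carries n Gaussian factors where the target has n + 1; as t^2
      <= 1, the missing one costs the constant \<open>exp c\<close>.\<close>
    also have "\<dots> \<le> exp c * exp (- c * t\<^sup>2) ^ Suc n"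
    proof -
      have "c * t\<^sup>2 \<le> c * 1" using c t2[OF t] by (intro mult_left_mono) auto
      then have "1 \<le> exp c * exp (- c * t\<^sup>2)" by (simp flip: exp_add)
      from mult_right_mono[OF this, of "exp (- c * t\<^sup>2) ^ n"] show ?thesis by (simp add: mult_ac)
    qed
    finally have "norm (complex_of_real (?E ^ n)) * (C2 * \<bar>t\<bar> powr p) \<le> exp c * exp (- c * t\<^sup>2) ^ Suc n * (C2 * \<bar>t\<bar> powr p)"
      using C20 by (intro mult_right_mono) auto
    then have "exp (- c * t\<^sup>2) * ?A + norm (complex_of_real (?E ^ n)) * (C2 * \<bar>t\<bar> powr p)
      \<le> (\<Lambda> * X * t\<^sup>2 + real (Suc n) * (C2 * exp c * \<bar>t\<bar> powr p)) * exp (- c * t\<^sup>2) ^ Suc n"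
      by (simp add: algebra_simps)
    with n show ?case unfolding nrm_def by (meson order_trans)
  qed
  define C where "C = \<Lambda> * X + C2 * exp c"
  show thesis
  proof (rule that[of c r C])
    show "0 < c" "0 < r" by (fact c)+
    show "0 \<le> C" using c X0 C20 by (simp add: C_def)
    fix t :: real and n :: nat assume t: "\<bar>t\<bar> \<le> r"
    have pw: "exp a ^ n = exp (real n * a)" for a :: real by (simp add: exp_of_nat_mult)
    have "norm (u t n x\<^sub>0) \<le> (\<Lambda> * X * t\<^sup>2 + real n * (C2 * exp c * \<bar>t\<bar> powr p)) * exp (- c * t\<^sup>2) ^ n"
      using nrm_x0[OF main[OF t]] c by simp
    also have "\<dots> \<le> C * (t\<^sup>2 + real n * \<bar>t\<bar> powr p) * exp (- c * t\<^sup>2) ^ n"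
    proof (intro mult_right_mono)
      have "0 \<le> C2 * exp c * t\<^sup>2" "0 \<le> \<Lambda> * X * (real n * \<bar>t\<bar> powr p)" using C20 c X0 by simp_all
      then show "\<Lambda> * X * t\<^sup>2 + real n * (C2 * exp c * \<bar>t\<bar> powr p) \<le> C * (t\<^sup>2 + real n * \<bar>t\<bar> powr p)"
        by (simp add: C_def algebra_simps)
    qed simp
    finally show "norm ((Q t ^^ n) (\<lambda>_. 1) x\<^sub>0 - exp (- real n * s2 * t\<^sup>2 / 2))
       \<le> C * (t\<^sup>2 + real n * \<bar>t\<bar> powr p) * exp (- c * real n * t\<^sup>2)"
      by (simp add: u_def ft_x0 pw mult_ac flip: of_real_power)
  qed
qed

end

section \<open>Nonnegative matrices acting on the simplex\<close>

text \<open>On nonnegative vectors the l1 norm of \<open>g *v x\<close> is the linear form with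
  these coefficients. On \<open>Gset\<close> this turns \<open>opnorm\<close> and
  \<open>vmin\<close> into a finite maximum and minimum, which also makes them measurable.\<close>

definition colsum :: "real ^ 'n ^ 'n \<Rightarrow> 'n \<Rightarrow> real" where
  "colsum g j = (\<Sum>i\<in>UNIV. g $ i $ j)"

lemma l1norm_nonneg_vec: "(\<And>i. 0 \<le> x $ i) \<Longrightarrow> l1norm x = (\<Sum>i\<in>UNIV. x $ i)"
  by (simp add: l1norm_def)

lemma l1norm_scaleR: "l1norm (c *\<^sub>R x) = \<bar>c\<bar> * l1norm x"
  by (simp add: l1norm_def abs_mult sum_distrib_left)

lemma l1norm_nonneg: "0 \<le> l1norm x"
  by (simp add: l1norm_def sum_nonneg)

lemma SplusD:
  assumes "x \<in> Splus" shows "0 \<le> x $ i" "(\<Sum>i\<in>UNIV. x $ i) = 1" "x $ i \<le> 1"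
proof -
  show nn: "0 \<le> x $ i" for i using assms by (simp add: Splus_def)
  show s: "(\<Sum>i\<in>UNIV. x $ i) = 1" using assms by (auto simp: Splus_def l1norm_def)
  have "x $ i \<le> (\<Sum>i\<in>UNIV. x $ i)" by (rule member_le_sum) (auto simp: nn)
  then show "x $ i \<le> 1" using s by simp
qed

lemma axis_Splus: "axis j 1 \<in> (Splus :: (real ^ 'n) set)"
  by (auto simp: Splus_def l1norm_def axis_def if_distrib[of abs] cong: if_cong)

lemma GsetD: "g \<in> Gset \<Longrightarrow> 0 \<le> g $ i $ j"
  by (simp add: Gset_def)

lemma colsum_pos: "g \<in> Gset \<Longrightarrow> 0 < colsum g j"
proof -
  assume g: "g \<in> Gset"
  then obtain i where "0 < g $ i $ j" unfolding Gset_def by blast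
  then show ?thesis unfolding colsum_def using g by (intro sum_pos2[of _ i]) (auto simp: Gset_def)
qed

lemma mult_nonneg_vec: "g \<in> Gset \<Longrightarrow> (\<And>i. 0 \<le> x $ i) \<Longrightarrow> 0 \<le> (g *v x) $ i"
  by (auto simp: matrix_vector_mult_def GsetD intro!: sum_nonneg)

lemma l1norm_mult:
  assumes "g \<in> Gset" "\<And>i. 0 \<le> x $ i"
  shows "l1norm (g *v x) = (\<Sum>j\<in>UNIV. colsum g j * x $ j)"
proof -
  have "l1norm (g *v x) = (\<Sum>i\<in>UNIV. \<Sum>j\<in>UNIV. g $ i $ j * x $ j)"
    using mult_nonneg_vec[OF assms] by (simp add: l1norm_nonneg_vec) (simp add: matrix_vector_mult_def)
  also have "\<dots> = (\<Sum>j\<in>UNIV. \<Sum>i\<in>UNIV. g $ i $ j * x $ j)" by (rule sum.swap)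
  finally show ?thesis by (simp add: colsum_def sum_distrib_right)
qed

lemma l1norm_mult_axis: "g \<in> Gset \<Longrightarrow> l1norm (g *v axis j 1) = colsum g j"
  by (subst l1norm_mult) (auto simp: axis_def if_distrib cong: if_cong)

lemma colsum_convex_bounds:
  assumes "g \<in> Gset" "x \<in> Splus"
  shows "(MIN j. colsum g j) \<le> l1norm (g *v x)" "l1norm (g *v x) \<le> (MAX j. colsum g j)"
proof -
  note x = SplusD[OF assms(2)]
  have e: "l1norm (g *v x) = (\<Sum>j\<in>UNIV. colsum g j * x $ j)" using x by (intro l1norm_mult assms) auto
  have "(\<Sum>j\<in>UNIV. (MIN j. colsum g j) * x $ j) \<le> l1norm (g *v x)"
    unfolding e using x by (intro sum_mono mult_right_mono) auto
  then show "(MIN j. colsum g j) \<le> l1norm (g *v x)" using x by (simp flip: sum_distrib_left)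
  have "l1norm (g *v x) \<le> (\<Sum>j\<in>UNIV. (MAX j. colsum g j) * x $ j)"
    unfolding e using x by (intro sum_mono mult_right_mono) auto
  then show "l1norm (g *v x) \<le> (MAX j. colsum g j)" using x by (simp flip: sum_distrib_left)
qed

lemma vmin_eq: assumes g: "g \<in> Gset" shows "vmin g = (MIN j. colsum g j)"
proof (rule antisym)
  have bdd: "bdd_below ((\<lambda>x. l1norm (g *v x)) ` Splus)"
    using colsum_convex_bounds(1)[OF g] by (intro bdd_belowI2)
  show "vmin g \<le> (MIN j. colsum g j)"
  proof (rule Min.boundedI)
    fix a assume "a \<in> range (colsum g)"
    then obtain j where "a = l1norm (g *v axis j 1)" by (auto simp: l1norm_mult_axis[OF g])
    then show "vmin g \<le> a" unfolding vmin_def by (auto intro!: cINF_lower bdd axis_Splus)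
  qed auto
  show "(MIN j. colsum g j) \<le> vmin g"
    unfolding vmin_def using axis_Splus by (intro cINF_greatest colsum_convex_bounds g) auto
qed

lemma l1norm_mult_le:
  assumes g: "g \<in> Gset" shows "l1norm (g *v x) \<le> (MAX j. colsum g j) * l1norm x"
proof -
  have "l1norm (g *v x) \<le> (\<Sum>i\<in>UNIV. \<Sum>j\<in>UNIV. g $ i $ j * \<bar>x $ j\<bar>)"
    unfolding l1norm_def matrix_vector_mult_def
    by (auto intro!: sum_mono order_trans[OF sum_abs] simp: abs_mult GsetD[OF g])
  also have "\<dots> = (\<Sum>j\<in>UNIV. colsum g j * \<bar>x $ j\<bar>)"
    by (subst sum.swap) (simp add: colsum_def sum_distrib_right)
  also have "\<dots> \<le> (\<Sum>j\<in>UNIV. (MAX j. colsum g j) * \<bar>x $ j\<bar>)" by (intro sum_mono mult_right_mono) auto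
  finally show ?thesis by (simp add: l1norm_def sum_distrib_left)
qed

lemma opnorm_eq: assumes g: "g \<in> Gset" shows "opnorm g = (MAX j. colsum g j)"
proof (rule antisym)
  have M0: "0 \<le> (MAX j. colsum g j)" using colsum_pos[OF g] by (auto simp: Max_ge_iff intro: less_imp_le)
  have le: "l1norm (g *v x) / l1norm x \<le> (MAX j. colsum g j)" for x
  proof (cases "l1norm x = 0")
    case False
    then have "0 < l1norm x" using l1norm_nonneg[of x] by simp
    then show ?thesis using l1norm_mult_le[OF g, of x] by (simp add: pos_divide_le_eq)
  qed (simp add: M0)
  then show "opnorm g \<le> (MAX j. colsum g j)" unfolding opnorm_def by (intro cSUP_least) auto
  show "(MAX j. colsum g j) \<le> opnorm g"
  proof (rule Max.boundedI)
    fix a assume "a \<in> range (colsum g)"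
    then obtain j where a: "a = l1norm (g *v axis j 1)" by (auto simp: l1norm_mult_axis[OF g])
    have "l1norm (axis j (1::real)) = 1" using axis_Splus[of j] by (simp add: Splus_def)
    then have "a = l1norm (g *v axis j 1) / l1norm (axis j (1::real))" using a by simp
    also have "\<dots> \<le> opnorm g" unfolding opnorm_def by (rule cSUP_upper) (auto intro!: bdd_aboveI2 le)
    finally show "a \<le> opnorm g" .
  qed auto
qed

lemma vmin_pos: "g \<in> Gset \<Longrightarrow> 0 < vmin g"
  by (simp add: vmin_eq colsum_pos)

lemma vmin_le: "g \<in> Gset \<Longrightarrow> x \<in> Splus \<Longrightarrow> vmin g \<le> l1norm (g *v x)"
  using colsum_convex_bounds(1) vmin_eq by metis

lemma le_opnorm: "g \<in> Gset \<Longrightarrow> x \<in> Splus \<Longrightarrow> l1norm (g *v x) \<le> opnorm g"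
  using colsum_convex_bounds(2) opnorm_eq by metis

lemma l1norm_mult_pos: "g \<in> Gset \<Longrightarrow> x \<in> Splus \<Longrightarrow> 0 < l1norm (g *v x)"
  using vmin_pos vmin_le by fastforce

lemma vmin_le_opnorm: "g \<in> Gset \<Longrightarrow> vmin g \<le> opnorm g"
  using vmin_le[OF _ axis_Splus] le_opnorm[OF _ axis_Splus] order_trans by blast

lemma opnorm_pos: "g \<in> Gset \<Longrightarrow> 0 < opnorm g"
  using vmin_pos vmin_le_opnorm by fastforce

lemma Lmat_ge_1: "g \<in> Gset \<Longrightarrow> 1 \<le> Lmat g"
  using vmin_pos[of g] vmin_le_opnorm[of g] by (simp add: Lmat_def)

lemma Nmat_ge_1: "g \<in> Gset \<Longrightarrow> 1 \<le> Nmat g"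
proof -
  assume g: "g \<in> Gset"
  show ?thesis
  proof (cases "1 \<le> opnorm g")
    case False
    then have "vmin g \<le> 1" using vmin_le_opnorm[OF g] by simp
    then have "1 \<le> 1 / vmin g" using vmin_pos[OF g] by simp
    then show ?thesis by (simp add: Nmat_def)
  qed (simp add: Nmat_def)
qed

lemma abs_ln_le_ln_Nmat:
  assumes g: "g \<in> Gset" and a: "vmin g \<le> a" "a \<le> opnorm g" shows "\<bar>ln a\<bar> \<le> ln (Nmat g)"
proof -
  have a0: "0 < a" using vmin_pos[OF g] a by linarith
  have "ln a \<le> ln (Nmat g)" using a0 a by (subst ln_le_cancel_iff) (auto simp: Nmat_def)
  moreover have "- ln a = ln (1 / a)" using a0 by (simp add: ln_div)
  moreover have "ln (1 / a) \<le> ln (Nmat g)"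
  proof (subst ln_le_cancel_iff)
    have "1 / a \<le> 1 / vmin g" using vmin_pos[OF g] a by (intro divide_left_mono) auto
    then show "1 / a \<le> Nmat g" by (simp add: Nmat_def)
  qed (use a0 Nmat_ge_1[OF g] in auto)
  ultimately show ?thesis by linarith
qed

lemma abs_ln_diff_le_ln_Lmat:
  assumes g: "g \<in> Gset" and a: "vmin g \<le> a" "a \<le> opnorm g" and b: "vmin g \<le> b" "b \<le> opnorm g"
  shows "\<bar>ln a - ln b\<bar> \<le> ln (Lmat g)"
proof -
  have v: "0 < vmin g" by (rule vmin_pos[OF g])
  have "ln (Lmat g) = ln (opnorm g) - ln (vmin g)"
    using v opnorm_pos[OF g] by (simp add: Lmat_def ln_div)
  moreover have "ln (vmin g) \<le> ln a" "ln a \<le> ln (opnorm g)" "ln (vmin g) \<le> ln b" "ln b \<le> ln (opnorm g)"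
    using v a b by auto
  ultimately show ?thesis by linarith
qed

lemma ln_Lmat_nonneg: "g \<in> Gset \<Longrightarrow> 0 \<le> ln (Lmat g)"
  using Lmat_ge_1 ln_ge_zero by blast

lemma ln_Nmat_nonneg: "g \<in> Gset \<Longrightarrow> 0 \<le> ln (Nmat g)"
  using Nmat_ge_1 ln_ge_zero by blast

lemma ln_Lmat_le: assumes g: "g \<in> Gset" shows "ln (Lmat g) \<le> 2 * ln (Nmat g)"
proof -
  have "ln (Lmat g) = ln (opnorm g) - ln (vmin g)"
    using vmin_pos[OF g] opnorm_pos[OF g] by (simp add: Lmat_def ln_div)
  then show ?thesis
    using abs_ln_le_ln_Nmat[OF g order_refl vmin_le_opnorm[OF g]]
      abs_ln_le_ln_Nmat[OF g vmin_le_opnorm[OF g] order_refl] by linarith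
qed

lemma Gset_mult: assumes g: "g \<in> Gset" and h: "h \<in> Gset" shows "g ** h \<in> Gset"
proof -
  have "\<exists>j. 0 < (g ** h) $ i $ j" for i
  proof -
    obtain k where k: "0 < g $ i $ k" using g unfolding Gset_def by blast
    obtain j where j: "0 < h $ k $ j" using h unfolding Gset_def by blast
    have "0 < (\<Sum>k\<in>UNIV. g $ i $ k * h $ k $ j)"
      by (rule sum_pos2[of _ k]) (use k j g h in \<open>auto simp: GsetD\<close>)
    then show ?thesis by (auto simp: matrix_matrix_mult_def)
  qed
  moreover have "\<exists>i. 0 < (g ** h) $ i $ j" for j
  proof -
    obtain k where k: "0 < h $ k $ j" using h unfolding Gset_def by blast
    obtain i where i: "0 < g $ i $ k" using g unfolding Gset_def by blast
    have "0 < (\<Sum>k\<in>UNIV. g $ i $ k * h $ k $ j)"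
      by (rule sum_pos2[of _ k]) (use k i g h in \<open>auto simp: GsetD\<close>)
    then show ?thesis by (auto simp: matrix_matrix_mult_def)
  qed
  moreover have "0 \<le> (g ** h) $ i $ j" for i j
    using g h by (auto simp: matrix_matrix_mult_def GsetD intro!: sum_nonneg)
  ultimately show ?thesis by (simp add: Gset_def)
qed

lemma mat_1_Gset: "mat 1 \<in> Gset"
  by (auto simp: Gset_def mat_def)

lemma act_Splus: assumes "g \<in> Gset" "x \<in> Splus" shows "act g x \<in> Splus"
proof -
  have "0 < l1norm (g *v x)" by (rule l1norm_mult_pos[OF assms])
  then show ?thesis
    using mult_nonneg_vec[OF assms(1), of x] assms
    by (auto simp: Splus_def act_def l1norm_scaleR)
qed

lemma l1norm_mult_mult:
  assumes g: "g \<in> Gset" and h: "h \<in> Gset" and x: "x \<in> Splus"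
  shows "l1norm ((g ** h) *v x) = l1norm (g *v act h x) * l1norm (h *v x)"
proof -
  have p: "0 < l1norm (h *v x)" by (rule l1norm_mult_pos[OF h x])
  have "(g ** h) *v x = g *v (l1norm (h *v x) *\<^sub>R act h x)"
    using p by (simp add: act_def matrix_vector_mul_assoc)
  also have "\<dots> = l1norm (h *v x) *\<^sub>R (g *v act h x)" by (rule matrix_vector_mult_scaleR)
  finally show ?thesis using p by (simp add: l1norm_scaleR)
qed

lemma act_mult:
  assumes g: "g \<in> Gset" and h: "h \<in> Gset" and x: "x \<in> Splus"
  shows "act (g ** h) x = act g (act h x)"
proof -
  have p: "0 < l1norm (h *v x)" by (rule l1norm_mult_pos[OF h x])
  have "g *v (h *v x) = l1norm (h *v x) *\<^sub>R (g *v act h x)"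
    using p by (simp add: act_def matrix_vector_mult_scaleR)
  then show ?thesis using p unfolding act_def[of "g ** h"] act_def[of g] l1norm_mult_mult[OF g h x]
    by (simp add: matrix_vector_mul_assoc[symmetric])
qed

lemma act_mat_1: "x \<in> Splus \<Longrightarrow> act (mat 1) x = x"
  by (simp add: act_def Splus_def)

lemma cocycle_mat_1: "x \<in> Splus \<Longrightarrow> cocycle (mat 1) x = 0"
  by (simp add: cocycle_def Splus_def)

lemma cocycle_mult:
  assumes g: "g \<in> Gset" and h: "h \<in> Gset" and x: "x \<in> Splus"
  shows "cocycle (g ** h) x = cocycle g (act h x) + cocycle h x"
  using l1norm_mult_pos[OF h x] l1norm_mult_pos[OF g act_Splus[OF h x]]
  by (simp add: cocycle_def l1norm_mult_mult[OF assms] ln_mult)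

lemma abs_cocycle_le: "g \<in> Gset \<Longrightarrow> x \<in> Splus \<Longrightarrow> \<bar>cocycle g x\<bar> \<le> ln (Nmat g)"
  unfolding cocycle_def by (intro abs_ln_le_ln_Nmat vmin_le le_opnorm)

text \<open>\<open>opnorm\<close> is submultiplicative and \<open>vmin\<close> supermultiplicative;
  both are checked on the vertices of the simplex, where the column sums are attained.\<close>

lemma ln_Lmat_mult:
  assumes g: "g \<in> Gset" and h: "h \<in> Gset"
  shows "ln (Lmat (g ** h)) \<le> ln (Lmat g) + ln (Lmat h)"
proof -
  have gh: "g ** h \<in> Gset" by (rule Gset_mult[OF g h])
  have "opnorm (g ** h) \<le> opnorm g * opnorm h"
    unfolding opnorm_eq[OF gh]
  proof (rule Max.boundedI)
    fix a assume "a \<in> range (colsum (g ** h))"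
    then obtain j where a: "a = l1norm ((g ** h) *v axis j 1)" by (auto simp: l1norm_mult_axis[OF gh])
    show "a \<le> opnorm g * opnorm h"
      unfolding a l1norm_mult_mult[OF g h axis_Splus]
      by (intro mult_mono le_opnorm g h axis_Splus act_Splus l1norm_nonneg) (use opnorm_pos[OF g] in simp)
  qed auto
  moreover have "vmin g * vmin h \<le> vmin (g ** h)"
    unfolding vmin_eq[OF gh]
  proof (rule Min.boundedI)
    fix a assume "a \<in> range (colsum (g ** h))"
    then obtain j where a: "a = l1norm ((g ** h) *v axis j 1)" by (auto simp: l1norm_mult_axis[OF gh])
    show "vmin g * vmin h \<le> a"
      unfolding a l1norm_mult_mult[OF g h axis_Splus]
      by (intro mult_mono vmin_le g h axis_Splus act_Splus l1norm_nonneg) (use vmin_pos[OF h] in simp)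
  qed auto
  ultimately have "Lmat (g ** h) \<le> (opnorm g * opnorm h) / (vmin g * vmin h)"
    unfolding Lmat_def using vmin_pos[OF g] vmin_pos[OF h] opnorm_pos[OF g] opnorm_pos[OF h]
    by (intro frac_le) auto
  also have "\<dots> = Lmat g * Lmat h" by (simp add: Lmat_def)
  finally have "ln (Lmat (g ** h)) \<le> ln (Lmat g * Lmat h)"
    using Lmat_ge_1[OF gh] by simp
  then show ?thesis using Lmat_ge_1[OF g] Lmat_ge_1[OF h] by (simp add: ln_mult)
qed

section \<open>Quantitative positivity and projective contraction\<close>

text \<open>Positive matrices with a uniform margin: the contraction and comparison constants depend
  on \<open>\<eta>\<close> alone, and \<open>Gplus\<close> is exhausted by such sets.\<close>

definition Gbox :: "real \<Rightarrow> (real ^ 'n ^ 'n) set" where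
  "Gbox \<eta> = {g. \<forall>i j. \<eta> \<le> g $ i $ j \<and> g $ i $ j \<le> 1 / \<eta>}"

lemma Gbox_Gset: "0 < \<eta> \<Longrightarrow> Gbox \<eta> \<subseteq> Gset"
proof
  fix g assume eta: "0 < \<eta>" and "g \<in> Gbox \<eta>"
  then have "0 < g $ i $ j" for i j by (auto simp: Gbox_def intro: less_le_trans)
  then show "g \<in> Gset" by (auto simp: Gset_def less_imp_le)
qed

lemma colsum_mult: "colsum (g ** h) j = (\<Sum>i\<in>UNIV. colsum g i * h $ i $ j)"
proof -
  have "colsum (g ** h) j = (\<Sum>i\<in>UNIV. \<Sum>k\<in>UNIV. g $ i $ k * h $ k $ j)"
    by (simp add: colsum_def matrix_matrix_mult_def)
  also have "\<dots> = (\<Sum>k\<in>UNIV. \<Sum>i\<in>UNIV. g $ i $ k * h $ k $ j)" by (rule sum.swap)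
  finally show ?thesis by (simp add: colsum_def sum_distrib_right)
qed

text \<open>The box factor mixes before \<open>g\<close> acts: every column sum of the product lies
  between \<eta> s and s / \<eta>, with s the sum of all column sums of \<open>g\<close>. The
  quotient of the largest by the smallest is therefore bounded independently of
  \<open>g\<close>.\<close>

lemma ln_Lmat_mult_Gbox:
  assumes g: "g \<in> Gset" and k: "k \<in> Gbox \<eta>" and eta: "0 < \<eta>"
  shows "ln (Lmat (g ** k)) \<le> - 2 * ln \<eta>"
proof -
  have kG: "k \<in> Gset" using Gbox_Gset[OF eta] k by auto
  have gk: "g ** k \<in> Gset" by (rule Gset_mult[OF g kG])
  define s where "s = (\<Sum>i\<in>UNIV. colsum g i)"
  have s0: "0 < s" unfolding s_def using colsum_pos[OF g] by (intro sum_pos) auto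
  have "\<eta> * s \<le> colsum (g ** k) j" "colsum (g ** k) j \<le> s / \<eta>" for j
  proof -
    have "(\<Sum>i\<in>UNIV. colsum g i * \<eta>) \<le> colsum (g ** k) j"
      unfolding colsum_mult using k colsum_pos[OF g]
      by (intro sum_mono mult_left_mono) (auto simp: Gbox_def intro: less_imp_le)
    then show "\<eta> * s \<le> colsum (g ** k) j" by (simp add: s_def mult.commute[of \<eta>] sum_distrib_right)
    have "colsum (g ** k) j \<le> (\<Sum>i\<in>UNIV. colsum g i * (1 / \<eta>))"
      unfolding colsum_mult using k colsum_pos[OF g]
      by (intro sum_mono mult_left_mono) (auto simp: Gbox_def intro: less_imp_le)
    then show "colsum (g ** k) j \<le> s / \<eta>" by (simp add: s_def sum_divide_distrib)
  qed
  then have "opnorm (g ** k) \<le> s / \<eta>" "\<eta> * s \<le> vmin (g ** k)"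
    by (auto simp: opnorm_eq[OF gk] vmin_eq[OF gk])
  then have "Lmat (g ** k) \<le> (s / \<eta>) / (\<eta> * s)"
    unfolding Lmat_def using s0 eta opnorm_pos[OF gk] by (intro frac_le) auto
  also have "\<dots> = 1 / \<eta>\<^sup>2" using s0 by (simp add: power2_eq_square)
  finally have "ln (Lmat (g ** k)) \<le> ln (1 / \<eta>\<^sup>2)" using Lmat_ge_1[OF gk] eta by (subst ln_le_cancel_iff) auto
  also have "\<dots> = - 2 * ln \<eta>" using eta by (simp add: ln_div ln_realpow)
  finally show ?thesis .
qed

text \<open>A gauge comparable to the projective distance, for which Lipschitz estimates are
  simplest; no triangle inequality is needed.\<close>

definition gauge_dist :: "real ^ 'n \<Rightarrow> real ^ 'n \<Rightarrow> real" where
  "gauge_dist x y = 1 - mratio x y * mratio y x"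

lemma gauge_dist_nonneg: "x \<in> Splus \<Longrightarrow> y \<in> Splus \<Longrightarrow> 0 \<le> gauge_dist x y"
  using mult_le_one[of "mratio x y" "mratio y x"] mratio_le_1 mratio_nonneg by (auto simp: gauge_dist_def)

lemma gauge_dist_le_1: "x \<in> Splus \<Longrightarrow> y \<in> Splus \<Longrightarrow> gauge_dist x y \<le> 1"
  by (simp add: gauge_dist_def mratio_nonneg)

lemma mult_vec_mono:
  assumes "g \<in> Gset" "\<And>i. x $ i \<le> y $ i" shows "(g *v x) $ i \<le> (g *v y) $ i"
  using assms by (auto simp: matrix_vector_mult_def GsetD intro!: sum_mono mult_left_mono)

lemma mratio_act_ge:
  assumes g: "g \<in> Gset" and x: "x \<in> Splus" and y: "y \<in> Splus"
    and a: "\<And>i. a * (g *v y) $ i \<le> (g *v x) $ i"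
  shows "a * (l1norm (g *v y) / l1norm (g *v x)) \<le> mratio (act g x) (act g y)"
proof (rule mratio_greatest[OF act_Splus[OF g x] act_Splus[OF g y]])
  have p: "0 < l1norm (g *v y)" "0 < l1norm (g *v x)" by (rule l1norm_mult_pos[OF g y] l1norm_mult_pos[OF g x])+
  fix i assume "0 < act g y $ i"
  then have i: "0 < (g *v y) $ i" using p by (simp add: act_def zero_less_mult_iff)
  have "a \<le> (g *v x) $ i / (g *v y) $ i" using a[of i] i by (simp add: pos_le_divide_eq)
  then have "a * (l1norm (g *v y) / l1norm (g *v x)) \<le> (g *v x) $ i / (g *v y) $ i * (l1norm (g *v y) / l1norm (g *v x))"
    using p by (intro mult_right_mono) auto
  then show "a * (l1norm (g *v y) / l1norm (g *v x)) \<le> act g x $ i / act g y $ i"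
    using p by (simp add: act_def divide_inverse mult_ac)
qed

text \<open>The normalising factors occur inverse to each other in the two ratios and cancel in
  their product, so comparison of the unnormalised images is enough.\<close>

lemma gauge_dist_act_le:
  assumes g: "g \<in> Gset" and x: "x \<in> Splus" and y: "y \<in> Splus" and ab: "0 \<le> a" "0 \<le> b"
    and a: "\<And>i. a * (g *v y) $ i \<le> (g *v x) $ i" and b: "\<And>i. b * (g *v x) $ i \<le> (g *v y) $ i"
  shows "gauge_dist (act g x) (act g y) \<le> 1 - a * b"
proof -
  have p: "0 < l1norm (g *v y)" "0 < l1norm (g *v x)" by (rule l1norm_mult_pos[OF g y] l1norm_mult_pos[OF g x])+
  have "(a * (l1norm (g *v y) / l1norm (g *v x))) * (b * (l1norm (g *v x) / l1norm (g *v y)))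
      \<le> mratio (act g x) (act g y) * mratio (act g y) (act g x)"
    using p ab by (intro mult_mono mratio_act_ge g x y a b mratio_nonneg act_Splus) auto
  then show ?thesis using p by (simp add: gauge_dist_def)
qed

lemma mratio_mult_vec:
  assumes g: "g \<in> Gset" and x: "x \<in> Splus" and y: "y \<in> Splus"
  shows "mratio x y * (g *v y) $ i \<le> (g *v x) $ i"
proof -
  have "(g *v (mratio x y *\<^sub>R y)) $ i \<le> (g *v x) $ i"
    by (rule mult_vec_mono[OF g]) (simp add: mratio_mult_le[OF x y])
  then show ?thesis by (simp add: matrix_vector_mult_scaleR)
qed

lemma gauge_dist_act:
  assumes "g \<in> Gset" "x \<in> Splus" "y \<in> Splus" shows "gauge_dist (act g x) (act g y) \<le> gauge_dist x y"
  unfolding gauge_dist_def[of x y]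
  by (intro gauge_dist_act_le mratio_mult_vec mratio_nonneg assms)

text \<open>With m = \<open>mratio x y\<close>, the vector x - m y is nonnegative of mass 1 - m, so
  each coordinate of its image is at least \<eta> (1 - m). Coordinates of \<open>k *v y\<close> are
  at most 1 / \<eta>, which turns this into the gain \<eta>^2 (1 - m).\<close>

lemma mratio_mult_vec_Gbox:
  assumes k: "k \<in> Gbox \<eta>" and eta: "0 < \<eta>" and x: "x \<in> Splus" and y: "y \<in> Splus"
  shows "(mratio x y + \<eta>\<^sup>2 * (1 - mratio x y)) * (k *v y) $ i \<le> (k *v x) $ i"
proof -
  let ?m = "mratio x y"
  have kG: "k \<in> Gset" using Gbox_Gset[OF eta] k by auto
  have "\<eta> * (1 - ?m) = (\<Sum>j\<in>UNIV. \<eta> * (x $ j - ?m * y $ j))"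
    using SplusD(2)[OF x] SplusD(2)[OF y] by (simp add: sum_subtractf flip: sum_distrib_left)
  also have "\<dots> \<le> (\<Sum>j\<in>UNIV. k $ i $ j * (x $ j - ?m * y $ j))"
    using k mratio_mult_le[OF x y] by (intro sum_mono mult_right_mono) (auto simp: Gbox_def)
  also have "\<dots> = (k *v x) $ i - ?m * (k *v y) $ i"
    by (simp add: matrix_vector_mult_def right_diff_distrib sum_subtractf sum_distrib_left mult_ac)
  finally have 1: "\<eta> * (1 - ?m) \<le> (k *v x) $ i - ?m * (k *v y) $ i" .
  have "(k *v y) $ i \<le> (\<Sum>j\<in>UNIV. 1 / \<eta> * y $ j)"
    unfolding matrix_vector_mult_def vec_lambda_beta
    by (intro sum_mono mult_right_mono) (use k SplusD(1)[OF y] in \<open>auto simp: Gbox_def\<close>)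
  also have "\<dots> = 1 / \<eta>" using SplusD(2)[OF y] by (simp flip: sum_distrib_left sum_divide_distrib)
  finally have "\<eta>\<^sup>2 * (1 - ?m) * (k *v y) $ i \<le> \<eta>\<^sup>2 * (1 - ?m) * (1 / \<eta>)"
    using mratio_le_1[OF x y] by (intro mult_left_mono) auto
  also have "\<dots> = \<eta> * (1 - ?m)" using eta by (simp add: power2_eq_square)
  finally show ?thesis using 1 by (simp add: algebra_simps)
qed

lemma gauge_dist_act_Gbox:
  assumes k: "k \<in> Gbox \<eta>" and eta: "0 < \<eta>" "\<eta> < 1" and x: "x \<in> Splus" and y: "y \<in> Splus"
  shows "gauge_dist (act k x) (act k y) \<le> (1 - \<eta> ^ 4) * gauge_dist x y"
proof -
  let ?m = "mratio x y" and ?m' = "mratio y x" and ?e = "\<eta>\<^sup>2"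
  have kG: "k \<in> Gset" using Gbox_Gset[OF eta(1)] k by auto
  have e: "0 \<le> ?e" "?e \<le> 1" using eta by (auto simp: power_le_one)
  have m: "0 \<le> ?m" "?m \<le> 1" "0 \<le> ?m'" "?m' \<le> 1" using x y by (auto intro: mratio_nonneg mratio_le_1)
  have "gauge_dist (act k x) (act k y) \<le> 1 - (?m + ?e * (1 - ?m)) * (?m' + ?e * (1 - ?m'))"
    using m e by (intro gauge_dist_act_le mratio_mult_vec_Gbox k x y eta kG) auto
  also have "\<dots> \<le> (1 - ?e * ?e) * (1 - ?m * ?m')"
  proof -
    \<comment> \<open>The difference of the two sides is exactly this product.\<close>
    have "0 \<le> ?e * (1 - ?e) * ((1 - ?m) * ?m' + (1 - ?m') * ?m)"
      using m e by (intro mult_nonneg_nonneg add_nonneg_nonneg) auto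
    then show ?thesis by (simp add: algebra_simps)
  qed
  finally show ?thesis by (simp add: gauge_dist_def power2_eq_square power4_eq_xxxx mult.assoc)
qed

text \<open>At gauge distance d <= 1/2 the comparison
  \<open>mratio x y * (g *v y) $ i \<le> (g *v x) $ i\<close> bounds the difference by - ln (1 - d)
  <= 2 d, independently of \<open>g\<close>. At larger distance the plain bound
  \<open>ln (Lmat g)\<close> is at most twice itself times d.\<close>

lemma cocycle_lipschitz:
  assumes g: "g \<in> Gset" and x: "x \<in> Splus" and y: "y \<in> Splus"
  shows "\<bar>cocycle g x - cocycle g y\<bar> \<le> 2 * (1 + ln (Lmat g)) * gauge_dist x y"
proof -
  let ?d = "gauge_dist x y" and ?L = "ln (Lmat g)"
  have d0: "0 \<le> ?d" and L0: "0 \<le> ?L" using gauge_dist_nonneg[OF x y] ln_Lmat_nonneg[OF g] .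
  show ?thesis
  proof (cases "?d \<le> 1 / 2")
    case True
    have one: "- 2 * gauge_dist u v \<le> cocycle g u - cocycle g v"
      if u: "u \<in> Splus" and v: "v \<in> Splus" and d: "gauge_dist u v \<le> 1 / 2" for u v
    proof -
      have d0: "0 \<le> gauge_dist u v" by (rule gauge_dist_nonneg[OF u v])
      have mm: "1 - gauge_dist u v \<le> mratio u v"
        using mult_left_mono[OF mratio_le_1[OF v u] mratio_nonneg[OF u v]] by (simp add: gauge_dist_def)
      then have m0: "0 < mratio u v" using d by linarith
      have "mratio u v * l1norm (g *v v) \<le> l1norm (g *v u)"
        using sum_mono[OF mratio_mult_vec[OF g u v]]
        using mult_nonneg_vec[OF g SplusD(1)[OF u]] mult_nonneg_vec[OF g SplusD(1)[OF v]]
        by (simp add: l1norm_nonneg_vec sum_distrib_left)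
      then have "ln (mratio u v * l1norm (g *v v)) \<le> cocycle g u"
        unfolding cocycle_def using m0 l1norm_mult_pos[OF g v] l1norm_mult_pos[OF g u]
        by (subst ln_le_cancel_iff) auto
      then have "ln (mratio u v) \<le> cocycle g u - cocycle g v"
        using m0 l1norm_mult_pos[OF g v] by (simp add: cocycle_def ln_mult)
      moreover have "ln (1 - gauge_dist u v) \<le> ln (mratio u v)" using mm d by (subst ln_le_cancel_iff) auto
      moreover have "- gauge_dist u v - 2 * (gauge_dist u v)\<^sup>2 \<le> ln (1 - gauge_dist u v)"
        by (rule ln_one_minus_pos_lower_bound[OF d0 d])
      moreover have "(gauge_dist u v)\<^sup>2 \<le> gauge_dist u v * (1 / 2)"
        unfolding power2_eq_square by (rule mult_left_mono[OF d d0])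
      ultimately show ?thesis by linarith
    qed
    have sym: "gauge_dist y x = ?d" by (simp add: gauge_dist_def mult.commute)
    have "\<bar>cocycle g x - cocycle g y\<bar> \<le> 2 * ?d"
      using one[OF x y] one[OF y x] True sym by (auto simp: abs_le_iff)
    also have "\<dots> \<le> 2 * (1 + ?L) * ?d" using L0 d0 by (simp add: mult_right_mono)
    finally show ?thesis .
  next
    case False
    have "\<bar>cocycle g x - cocycle g y\<bar> \<le> ?L"
      unfolding cocycle_def by (intro abs_ln_diff_le_ln_Lmat vmin_le le_opnorm g x y)
    also have "?L \<le> (1 + ?L) * (2 * ?d)"
      using mult_mono[of ?L "1 + ?L" 1 "2 * ?d"] False L0 by simp
    finally show ?thesis by (simp only: mult_ac)
  qed
qed

section \<open>The spectral radius: growth bounds and measurability\<close>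

abbreviation cmat :: "real ^ 'n ^ 'n \<Rightarrow> complex ^ 'n ^ 'n" where
  "cmat g \<equiv> (\<chi> i j. complex_of_real (g $ i $ j))"

lemma eigen_component:
  "cmat g *v x = z *s x \<longleftrightarrow> (\<forall>i. (\<Sum>j\<in>UNIV. complex_of_real (g $ i $ j) * x $ j) = z * x $ i)"
  by (simp add: vec_eq_iff matrix_vector_mult_def)

text \<open>The vector y of moduli of an eigenvector satisfies |z| y <= g y in each coordinate, as
  the entries of \<open>g\<close> are nonnegative; summation over the coordinates compares the
  norms.\<close>

lemma eigenvalue_le_opnorm:
  assumes g: "g \<in> Gset" and z: "z \<in> complex_eigenvalues g"
  shows "cmod z \<le> opnorm g"
proof -
  obtain x where x: "x \<noteq> 0" "cmat g *v x = z *s x" using z by (auto simp: complex_eigenvalues_def)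
  define y :: "real ^ 'a" where "y = (\<chi> i. cmod (x $ i))"
  have y0: "0 \<le> y $ i" for i by (simp add: y_def)
  obtain k where "x $ k \<noteq> 0" using x(1) by (auto simp: vec_eq_iff)
  then have "0 < l1norm y" unfolding l1norm_def by (intro sum_pos2[of _ k]) (auto simp: y_def)
  moreover have "cmod z * l1norm y \<le> l1norm (g *v y)"
  proof -
    have "cmod z * y $ i \<le> (g *v y) $ i" for i
    proof -
      have "cmod z * y $ i = cmod (\<Sum>j\<in>UNIV. complex_of_real (g $ i $ j) * x $ j)"
        using x(2) unfolding eigen_component by (simp add: y_def norm_mult)
      also have "\<dots> \<le> (\<Sum>j\<in>UNIV. g $ i $ j * y $ j)"
        by (rule sum_norm_le) (simp add: norm_mult y_def GsetD[OF g])
      finally show ?thesis by (simp add: matrix_vector_mult_def)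
    qed
    then have "(\<Sum>i\<in>UNIV. cmod z * y $ i) \<le> (\<Sum>i\<in>UNIV. (g *v y) $ i)" by (intro sum_mono)
    then show ?thesis using mult_nonneg_vec[OF g y0] y0 by (simp add: l1norm_nonneg_vec sum_distrib_left)
  qed
  moreover have "l1norm (g *v y) \<le> opnorm g * l1norm y"
    using l1norm_mult_le[OF g] by (simp add: opnorm_eq[OF g])
  ultimately show ?thesis by (meson mult_le_cancel_right_pos order_trans)
qed

text \<open>\<open>spec_rad\<close> is a \<open>Max\<close>, hence meaningful only over a finite
  set. The eigenvalues are the zeros of \<open>q\<close>, the Leibniz expansion of det (g - z), and
  \<open>q\<close> is not the zero polynomial because \<open>opnorm g + 1\<close> exceeds every
  eigenvalue in modulus.\<close>

lemma finite_eigenvalues: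
  assumes g: "g \<in> Gset" shows "finite (complex_eigenvalues g)"
proof -
  define q where "q = (\<Sum>\<pi> | \<pi> permutes (UNIV :: 'a set). of_int (sign \<pi>) *
      (\<Prod>i\<in>UNIV. [: complex_of_real (g $ i $ \<pi> i), - (if i = \<pi> i then 1 else 0) :]))"
  have q: "poly q z = det (cmat g - mat z)" for z
    unfolding q_def det_def poly_sum poly_mult poly_prod
  proof (intro sum.cong refl arg_cong2[where f = "(*)"])
    fix \<pi> :: "'a \<Rightarrow> 'a"
    show "poly (of_int (sign \<pi>)) z = of_int (sign \<pi>)" by (simp add: poly_of_int)
    show "(\<Prod>i\<in>UNIV. poly [:complex_of_real (g $ i $ \<pi> i), - (if i = \<pi> i then 1 else 0):] z)
      = (\<Prod>i\<in>UNIV. (cmat g - mat z) $ i $ \<pi> i)"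
      by (intro prod.cong refl) (simp add: mat_def)
  qed
  have ker: "(cmat g - mat z) *v x = cmat g *v x - z *s x" for z x
    by (simp add: vec_eq_iff matrix_vector_mult_def mat_def left_diff_distrib sum_subtractf
        if_distrib[of "\<lambda>a. a * _"] cong: if_cong)
  have ev: "z \<in> complex_eigenvalues g \<longleftrightarrow> poly q z = 0" for z
  proof -
    have "z \<in> complex_eigenvalues g \<longleftrightarrow> (\<exists>x. x \<noteq> 0 \<and> (cmat g - mat z) *v x = 0)"
      by (simp add: complex_eigenvalues_def ker)
    also have "\<dots> \<longleftrightarrow> \<not> (\<exists>B. B ** (cmat g - mat z) = mat 1)"
      unfolding matrix_left_invertible_ker by blast
    also have "\<dots> \<longleftrightarrow> poly q z = 0"
      unfolding q using invertible_det_nz[of "cmat g - mat z"] invertible_left_inverse by metis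
    finally show ?thesis .
  qed
  have "complex_of_real (opnorm g + 1) \<notin> complex_eigenvalues g"
    using eigenvalue_le_opnorm[OF g, of "complex_of_real (opnorm g + 1)"] opnorm_pos[OF g]
    by (auto simp del: of_real_add)
  then have "q \<noteq> 0" using ev by force
  then have "finite {z. poly q z = 0}" by (rule poly_roots_finite)
  moreover have "complex_eigenvalues g = {z. poly q z = 0}" using ev by blast
  ultimately show ?thesis by (simp only:)
qed

lemma compact_Splus: "compact (Splus :: (real ^ 'n) set)"
proof (subst compact_eq_bounded_closed, intro conjI)
  have "norm x \<le> 1" if "x \<in> Splus" for x :: "real ^ 'n"
    using norm_le_l1_cart[of x] SplusD[OF that] by simp
  then show "bounded (Splus :: (real ^ 'n) set)" by (auto simp: bounded_iff)
  have "closed {x :: real ^ 'n. l1norm x = 1 \<and> (\<forall>i. 0 \<le> x $ i)}"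
    unfolding l1norm_def
    by (intro closed_Collect_conj closed_Collect_eq closed_Collect_all closed_Collect_le continuous_intros)
  then show "closed (Splus :: (real ^ 'n) set)" by (simp add: Splus_def)
qed

lemma convex_Splus: "convex (Splus :: (real ^ 'n) set)"
proof (rule convexI)
  fix x y :: "real ^ 'n" and u v :: real
  assume x: "x \<in> Splus" and y: "y \<in> Splus" and uv: "0 \<le> u" "0 \<le> v" "u + v = 1"
  have nn: "0 \<le> (u *\<^sub>R x + v *\<^sub>R y) $ i" for i using SplusD(1)[OF x, of i] SplusD(1)[OF y, of i] uv by simp
  have "(\<Sum>i\<in>UNIV. (u *\<^sub>R x + v *\<^sub>R y) $ i) = u * (\<Sum>i\<in>UNIV. x $ i) + v * (\<Sum>i\<in>UNIV. y $ i)"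
    by (simp add: sum.distrib sum_distrib_left)
  then have "l1norm (u *\<^sub>R x + v *\<^sub>R y) = 1"
    using nn uv SplusD(2)[OF x] SplusD(2)[OF y] by (simp add: l1norm_nonneg_vec del: vector_add_component vector_scaleR_component)
  then show "u *\<^sub>R x + v *\<^sub>R y \<in> Splus" using nn by (simp add: Splus_def)
qed

text \<open>Brouwer's theorem for the projective action on the simplex yields a nonnegative
  eigenvector. Its eigenvalue is the norm of the image of a point of the simplex.\<close>

lemma eigenvalue_ge_vmin:
  assumes g: "g \<in> Gset" shows "\<exists>z\<in>complex_eigenvalues g. vmin g \<le> cmod z"
proof -
  have "continuous_on Splus (act g)"
  proof -
    have "(\<Sum>i\<in>UNIV. \<bar>\<Sum>j\<in>UNIV. g $ i $ j * x $ j\<bar>) \<noteq> 0" if "x \<in> Splus" for x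
      using l1norm_mult_pos[OF g that] by (simp add: l1norm_def matrix_vector_mult_def)
    then show ?thesis unfolding act_def l1norm_def matrix_vector_mult_def vec_lambda_beta
      by (intro continuous_intros continuous_on_vec_lambda) auto
  qed
  moreover have "act g \<in> Splus \<rightarrow> Splus" using act_Splus[OF g] by auto
  moreover have "Splus \<noteq> ({} :: (real ^ 'a) set)" using axis_Splus by blast
  ultimately obtain x where x: "x \<in> Splus" "act g x = x"
    using brouwer[OF compact_Splus convex_Splus] by metis
  define c where "c = l1norm (g *v x)"
  have c: "0 < c" unfolding c_def by (rule l1norm_mult_pos[OF g x(1)])
  have "g *v x = c *\<^sub>R act g x" using c by (simp add: act_def c_def)
  then have gx: "g *v x = c *\<^sub>R x" by (simp only: x(2))
  define w :: "complex ^ 'a" where "w = (\<chi> i. complex_of_real (x $ i))"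
  have "cmat g *v w = of_real c *s w"
    unfolding eigen_component
  proof
    fix i
    have "(\<Sum>j\<in>UNIV. g $ i $ j * x $ j) = c * x $ i"
      using arg_cong[OF gx, of "\<lambda>v. v $ i"] by (simp add: matrix_vector_mult_def)
    then have "complex_of_real (\<Sum>j\<in>UNIV. g $ i $ j * x $ j) = of_real (c * x $ i)" by simp
    then show "(\<Sum>j\<in>UNIV. complex_of_real (g $ i $ j) * w $ j) = complex_of_real c * w $ i"
      by (simp add: w_def)
  qed
  moreover have "w \<noteq> 0"
  proof
    assume "w = 0"
    then have "x $ i = 0" for i by (simp add: w_def vec_eq_iff)
    then show False using SplusD(2)[OF x(1)] by simp
  qed
  ultimately have "of_real c \<in> complex_eigenvalues g" unfolding complex_eigenvalues_def by blast
  moreover have "vmin g \<le> cmod (of_real c)" using vmin_le[OF g x(1)] c by (simp add: c_def)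
  ultimately show ?thesis by blast
qed

lemma spec_rad_bounds:
  assumes g: "g \<in> Gset" shows "vmin g \<le> spec_rad g" "spec_rad g \<le> opnorm g"
proof -
  note ev = eigenvalue_ge_vmin[OF g] finite_eigenvalues[OF g]
  show "vmin g \<le> spec_rad g" unfolding spec_rad_def using ev by (subst Max_ge_iff) auto
  show "spec_rad g \<le> opnorm g" unfolding spec_rad_def
    using ev eigenvalue_le_opnorm[OF g] by (subst Max_le_iff) auto
qed

text \<open>With eigenvectors on the unit sphere and eigenvalues cut at |z| <= n, a superlevel set
  of \<open>spec_rad\<close> is a countable union of projections of closed sets along compact
  factors. This gives Borel measurability without appeal to continuity of eigenvalues.\<close>

lemma spec_rad_ge_iff:
  assumes g: "g \<in> Gset"
  shows "a \<le> spec_rad g \<longleftrightarrow> (\<exists>n::nat. \<exists>zx. zx \<in> cball 0 (real n) \<times> sphere 0 1 \<and>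
    (zx, g) \<in> {(zx, g). a \<le> cmod (fst zx) \<and> (\<forall>i. (\<Sum>j\<in>UNIV. complex_of_real (g $ i $ j) * snd zx $ j) = fst zx * snd zx $ i)})"
    (is "_ \<longleftrightarrow> ?R")
proof
  assume "a \<le> spec_rad g"
  then obtain z where z: "z \<in> complex_eigenvalues g" "a \<le> cmod z"
    unfolding spec_rad_def using eigenvalue_ge_vmin[OF g] finite_eigenvalues[OF g] by (subst (asm) Max_ge_iff) auto
  then obtain x where x: "x \<noteq> 0" "\<And>i. (\<Sum>j\<in>UNIV. complex_of_real (g $ i $ j) * x $ j) = z * x $ i"
    by (auto simp: complex_eigenvalues_def eigen_component)
  obtain n :: nat where n: "cmod z \<le> real n" using real_arch_simple by blast
  define y where "y = (1 / norm x) *\<^sub>R x"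
  have y: "norm y = 1" using x(1) by (simp add: y_def)
  have "(\<Sum>j\<in>UNIV. complex_of_real (g $ i $ j) * y $ j) = z * y $ i" for i
  proof -
    have "(\<Sum>j\<in>UNIV. complex_of_real (g $ i $ j) * y $ j) = (1 / norm x) *\<^sub>R (\<Sum>j\<in>UNIV. complex_of_real (g $ i $ j) * x $ j)"
      by (simp add: y_def scaleR_right.sum)
    then show ?thesis by (simp add: x(2) y_def)
  qed
  then show ?R using y n z by (intro exI[of _ n] exI[of _ "(z, y)"]) auto
next
  assume ?R
  then obtain z y where y: "norm y = 1" "a \<le> cmod z"
    "\<forall>i. (\<Sum>j\<in>UNIV. complex_of_real (g $ i $ j) * y $ j) = z * y $ i" by auto
  then have "y \<noteq> 0" by auto
  then have "z \<in> complex_eigenvalues g" using y by (auto simp: complex_eigenvalues_def eigen_component)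
  then show "a \<le> spec_rad g"
    unfolding spec_rad_def using y finite_eigenvalues[OF g] by (subst Max_ge_iff) auto
qed

lemma spec_rad_measurable[measurable]: "spec_rad \<in> borel_measurable G_borel"
proof (rule borel_measurableI_ge)
  fix a :: real
  let ?T = "{(zx, g :: real ^ 'n ^ 'n). a \<le> cmod (fst zx) \<and> (\<forall>i. (\<Sum>j\<in>UNIV. complex_of_real (g $ i $ j) * snd zx $ j) = fst zx * snd zx $ i)}"
  let ?F = "\<lambda>n::nat. {g. \<exists>zx. zx \<in> cball 0 (real n) \<times> sphere (0 :: complex ^ 'n) 1 \<and> (zx, g) \<in> ?T}"
  have T: "closed ?T"
    unfolding case_prod_beta'
    by (intro closed_Collect_conj closed_Collect_eq closed_Collect_all closed_Collect_le continuous_intros)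
  have "closed (?F n)" for n
    by (rule closed_compact_projection[OF _ T]) (intro compact_Times compact_cball compact_sphere)
  then have "(\<Union>n. ?F n) \<in> sets borel" by (intro sets.countable_UN) (blast intro: borel_closed)
  moreover have eq: "{g \<in> space G_borel. a \<le> spec_rad g} = (\<Union>n. ?F n) \<inter> Gset"
  proof (rule set_eqI)
    fix g
    show "g \<in> {g \<in> space G_borel. a \<le> spec_rad g} \<longleftrightarrow> g \<in> (\<Union>n. ?F n) \<inter> Gset"
    proof (cases "g \<in> Gset")
      case True
      then show ?thesis using spec_rad_ge_iff[OF True, of a] by (simp add: G_borel_def space_restrict_space)
    qed (simp add: G_borel_def space_restrict_space)
  qed
  ultimately show "{g \<in> space G_borel. a \<le> spec_rad g} \<in> sets G_borel"
    unfolding eq unfolding G_borel_def sets_restrict_space by (subst Int_commute) (rule imageI)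
qed

section \<open>Convolution powers\<close>

lemma borel_measurable_vecI:
  fixes f :: "'a \<Rightarrow> 'b :: euclidean_space ^ 'n"
  assumes "\<And>i. (\<lambda>x. f x $ i) \<in> borel_measurable M"
  shows "f \<in> borel_measurable M"
proof (subst borel_measurable_euclidean_space, intro ballI)
  fix b :: "'b ^ 'n" assume "b \<in> Basis"
  then obtain i u where b: "b = axis i u" by (auto simp: Basis_vec_def)
  have [measurable]: "(\<lambda>x. f x $ i) \<in> borel_measurable M" by fact
  show "(\<lambda>x. f x \<bullet> b) \<in> borel_measurable M" unfolding b inner_axis by measurable
qed

lemma borel_measurable_vec_nth[measurable (raw)]:
  fixes f :: "'a \<Rightarrow> 'b :: euclidean_space ^ 'n"
  assumes [measurable]: "f \<in> borel_measurable M"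
  shows "(\<lambda>x. f x $ i) \<in> borel_measurable M"
proof -
  have "(\<lambda>v :: 'b ^ 'n. v $ i) \<in> borel_measurable borel"
    by (intro borel_measurable_continuous_onI continuous_intros)
  from measurable_compose[OF assms this] show ?thesis .
qed

lemma space_G_borel[simp]: "space G_borel = Gset"
  by (simp add: G_borel_def space_restrict_space)

lemma measurable_G_borel_id: "(\<lambda>g. g) \<in> borel_measurable G_borel"
  unfolding G_borel_def by (rule measurable_restrict_space1) simp

lemma measurable_G_borelI:
  "f \<in> borel_measurable M \<Longrightarrow> (\<And>x. x \<in> space M \<Longrightarrow> f x \<in> Gset) \<Longrightarrow> f \<in> M \<rightarrow>\<^sub>M G_borel"
  unfolding G_borel_def by (rule measurable_restrict_space2) auto

lemma measurable_G_borelD: "f \<in> M \<rightarrow>\<^sub>M G_borel \<Longrightarrow> f \<in> borel_measurable M"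
  using measurable_compose[OF _ measurable_G_borel_id] by auto

text \<open>The chain is run on the Euclidean Borel sets of the simplex, for which the action, the
  cocycle and the gauge are jointly measurable; \<open>Splus_borel\<close> belongs to the finer
  projective topology.\<close>

definition S_borel :: "(real ^ 'n) measure" where
  "S_borel = restrict_space borel Splus"

lemma space_S_borel[simp]: "space S_borel = Splus"
  by (simp add: S_borel_def space_restrict_space)

lemma measurable_S_borel_id: "(\<lambda>x. x) \<in> borel_measurable S_borel"
  unfolding S_borel_def by (rule measurable_restrict_space1) simp

lemma measurable_S_borelI:
  "f \<in> borel_measurable M \<Longrightarrow> (\<And>x. x \<in> space M \<Longrightarrow> f x \<in> Splus) \<Longrightarrow> f \<in> M \<rightarrow>\<^sub>M S_borel"
  unfolding S_borel_def by (rule measurable_restrict_space2) auto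

lemma measurable_S_borelD: "f \<in> M \<rightarrow>\<^sub>M S_borel \<Longrightarrow> f \<in> borel_measurable M"
  using measurable_compose[OF _ measurable_S_borel_id] by auto

lemma matrix_vector_measurable:
  assumes [measurable]: "f \<in> borel_measurable M" "h \<in> borel_measurable M"
  shows "(\<lambda>x. (f x :: real ^ 'n ^ 'm) *v h x) \<in> borel_measurable M"
  by (rule borel_measurable_vecI) (simp add: matrix_vector_mult_def)

lemma matrix_mult_measurable:
  assumes [measurable]: "f \<in> borel_measurable M" "h \<in> borel_measurable M"
  shows "(\<lambda>x. (f x :: real ^ 'n ^ 'm) ** (h x :: real ^ 'k ^ 'n)) \<in> borel_measurable M"
  by (intro borel_measurable_vecI) (simp add: matrix_matrix_mult_def)

lemma G_mult_measurable[measurable (raw)]: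
  assumes f: "f \<in> M \<rightarrow>\<^sub>M G_borel" and h: "h \<in> M \<rightarrow>\<^sub>M G_borel"
  shows "(\<lambda>x. f x ** h x) \<in> M \<rightarrow>\<^sub>M G_borel"
  using measurable_space[OF f] measurable_space[OF h]
  by (intro measurable_G_borelI
      matrix_mult_measurable[OF measurable_G_borelD[OF f] measurable_G_borelD[OF h]])
    (auto intro: Gset_mult)

lemma mult_left_measurable: "g \<in> Gset \<Longrightarrow> (\<lambda>k. g ** k) \<in> G_borel \<rightarrow>\<^sub>M G_borel"
  by (intro G_mult_measurable measurable_const) auto

lemma l1norm_measurable[measurable (raw)]:
  assumes [measurable]: "f \<in> borel_measurable M"
  shows "(\<lambda>x. l1norm (f x :: real ^ 'n)) \<in> borel_measurable M"
  unfolding l1norm_def by measurable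

lemma cocycle_measurable[measurable (raw)]:
  assumes f: "f \<in> M \<rightarrow>\<^sub>M G_borel" and h: "h \<in> M \<rightarrow>\<^sub>M S_borel"
  shows "(\<lambda>x. cocycle (f x) (h x)) \<in> borel_measurable M"
proof -
  have [measurable]: "(\<lambda>x. f x *v h x) \<in> borel_measurable M"
    by (intro matrix_vector_measurable measurable_G_borelD measurable_S_borelD f h)
  show ?thesis unfolding cocycle_def by measurable
qed

lemma act_measurable[measurable (raw)]:
  assumes f: "f \<in> M \<rightarrow>\<^sub>M G_borel" and h: "h \<in> M \<rightarrow>\<^sub>M S_borel"
  shows "(\<lambda>x. act (f x) (h x)) \<in> M \<rightarrow>\<^sub>M S_borel"
proof (rule measurable_S_borelI)
  have [measurable]: "(\<lambda>x. f x *v h x) \<in> borel_measurable M"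
    by (intro matrix_vector_measurable measurable_G_borelD measurable_S_borelD f h)
  show "(\<lambda>x. act (f x) (h x)) \<in> borel_measurable M" unfolding act_def by measurable
  show "act (f x) (h x) \<in> Splus" if "x \<in> space M" for x
    using measurable_space[OF f that] measurable_space[OF h that] by (auto intro: act_Splus)
qed

text \<open>The filler 1 at coordinates where y vanishes cannot push the minimum below
  \<open>mratio\<close>, which is at most 1. A minimum over a fixed finite index set is visibly
  measurable.\<close>

lemma mratio_eq_Min:
  assumes x: "x \<in> Splus" and y: "y \<in> Splus"
  shows "mratio x y = (MIN i. if 0 < y $ i then x $ i / y $ i else 1)"
proof (rule antisym)
  show "mratio x y \<le> (MIN i. if 0 < y $ i then x $ i / y $ i else 1)"
  proof (rule Min.boundedI)
    fix a assume "a \<in> range (\<lambda>i. if 0 < y $ i then x $ i / y $ i else 1)"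
    then obtain i where i: "a = (if 0 < y $ i then x $ i / y $ i else 1)" by blast
    show "mratio x y \<le> a"
      using mratio_mult_le[OF x y, of i] mratio_le_1[OF x y] by (auto simp: i pos_le_divide_eq)
  qed auto
  show "(MIN i. if 0 < y $ i then x $ i / y $ i else 1) \<le> mratio x y"
  proof (rule mratio_greatest[OF x y])
    fix i assume "0 < y $ i"
    then have "x $ i / y $ i = (if 0 < y $ i then x $ i / y $ i else 1)" by simp
    moreover have "(MIN i. if 0 < y $ i then x $ i / y $ i else 1) \<le> (if 0 < y $ i then x $ i / y $ i else 1)"
      by (intro Min_le finite_imageI finite rangeI)
    ultimately show "(MIN i. if 0 < y $ i then x $ i / y $ i else 1) \<le> x $ i / y $ i" by (simp only:)
  qed
qed

lemma mratio_measurable[measurable (raw)]: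
  assumes f: "f \<in> M \<rightarrow>\<^sub>M S_borel" and h: "h \<in> M \<rightarrow>\<^sub>M S_borel"
  shows "(\<lambda>x. mratio (f x) (h x)) \<in> borel_measurable M"
proof (subst measurable_cong)
  show "mratio (f x) (h x) = (MIN i. if 0 < h x $ i then f x $ i / h x $ i else 1)" if "x \<in> space M" for x
    using measurable_space[OF f that] measurable_space[OF h that] by (intro mratio_eq_Min) simp_all
  note [measurable] = measurable_S_borelD[OF f] measurable_S_borelD[OF h]
  show "(\<lambda>x. MIN i. if 0 < h x $ i then f x $ i / h x $ i else 1) \<in> borel_measurable M"
    by (intro borel_measurable_Min finite) measurable
qed

lemma gauge_dist_measurable[measurable (raw)]:
  "f \<in> M \<rightarrow>\<^sub>M S_borel \<Longrightarrow> h \<in> M \<rightarrow>\<^sub>M S_borel \<Longrightarrow> (\<lambda>x. gauge_dist (f x) (h x)) \<in> borel_measurable M"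
  unfolding gauge_dist_def
  by (intro borel_measurable_diff borel_measurable_times borel_measurable_const mratio_measurable)

lemma colsum_measurable[measurable]: "(\<lambda>g. colsum g j) \<in> borel_measurable G_borel"
proof -
  note [measurable] = measurable_G_borel_id
  show ?thesis unfolding colsum_def by measurable
qed

lemma vmin_measurable[measurable]: "vmin \<in> borel_measurable G_borel"
  by (subst measurable_cong[OF vmin_eq]) (auto intro!: borel_measurable_Min)

lemma opnorm_measurable[measurable]: "opnorm \<in> borel_measurable G_borel"
  by (subst measurable_cong[OF opnorm_eq]) (auto intro!: borel_measurable_Max)

lemma Lmat_measurable[measurable]: "Lmat \<in> borel_measurable G_borel"
  unfolding Lmat_def[abs_def] by measurable

lemma Nmat_measurable[measurable]: "Nmat \<in> borel_measurable G_borel"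
  unfolding Nmat_def[abs_def] by measurable

lemma Gbox_sets[measurable]: assumes "0 < \<eta>" shows "Gbox \<eta> \<in> sets G_borel"
proof -
  note [measurable] = measurable_G_borel_id
  have "Gbox \<eta> = {g \<in> space G_borel. \<forall>i j. \<eta> \<le> g $ i $ j \<and> g $ i $ j \<le> 1 / \<eta>}"
    using Gbox_Gset[OF assms] by (auto simp: Gbox_def)
  also have "\<dots> \<in> sets G_borel" by measurable
  finally show ?thesis .
qed

section \<open>Laws of products\<close>

text \<open>The newest factor stands on the left, as in \<open>left_prod\<close>. Starting from the
  identity matrix lets the inductions begin at n = 0; \<open>conv_power_eq\<close> provides the link
  to \<open>conv_power\<close>.\<close>

primrec mconv :: "(real ^ 'n ^ 'n) measure \<Rightarrow> nat \<Rightarrow> (real ^ 'n ^ 'n) measure" where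
  "mconv \<mu> 0 = return G_borel (mat 1)"
| "mconv \<mu> (Suc n) = distr (\<mu> \<Otimes>\<^sub>M mconv \<mu> n) G_borel (\<lambda>(g, h). g ** h)"

locale matrix_law = prob_space \<mu> for \<mu> :: "(real ^ 'n ^ 'n) measure" +
  assumes sets_mu[measurable_cong]: "sets \<mu> = sets G_borel"
begin

lemma space_mu[simp]: "space \<mu> = Gset"
  using sets_eq_imp_space_eq[OF sets_mu] by simp

lemma mult_measurable_pair:
  assumes "sets N = sets G_borel"
  shows "(\<lambda>(g, h). g ** h) \<in> \<mu> \<Otimes>\<^sub>M N \<rightarrow>\<^sub>M G_borel"
proof -
  have [measurable]: "fst \<in> \<mu> \<Otimes>\<^sub>M N \<rightarrow>\<^sub>M G_borel" "snd \<in> \<mu> \<Otimes>\<^sub>M N \<rightarrow>\<^sub>M G_borel"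
    using measurable_fst[of \<mu> N] measurable_snd[of \<mu> N]
    by (simp_all add: measurable_cong_sets[OF refl sets_mu] measurable_cong_sets[OF refl assms])
  show ?thesis unfolding case_prod_beta' by (rule G_mult_measurable) measurable
qed

lemma mconv_prob_sets: "prob_space (mconv \<mu> n) \<and> sets (mconv \<mu> n) = sets G_borel"
proof (induction n)
  case 0
  have "prob_space (return G_borel (mat 1 :: real ^ 'n ^ 'n))" by (rule prob_space_return) (simp add: mat_1_Gset)
  then show ?case by simp
next
  case (Suc n)
  interpret N: prob_space "mconv \<mu> n" using Suc by simp
  interpret P: pair_prob_space \<mu> "mconv \<mu> n" ..
  show ?case using P.prob_space_distr[OF mult_measurable_pair] Suc by simp
qed

lemma mconv_prob: "prob_space (mconv \<mu> n)" using mconv_prob_sets by blast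
lemma mconv_sets[measurable_cong]: "sets (mconv \<mu> n) = sets G_borel" using mconv_prob_sets by blast
lemma mconv_space[simp]: "space (mconv \<mu> n) = Gset"
  using sets_eq_imp_space_eq[OF mconv_sets] by simp

lemma nn_integral_mconv_Suc:
  assumes [measurable]: "f \<in> borel_measurable G_borel"
  shows "(\<integral>\<^sup>+k. f k \<partial>mconv \<mu> (Suc n)) = (\<integral>\<^sup>+g. \<integral>\<^sup>+h. f (g ** h) \<partial>mconv \<mu> n \<partial>\<mu>)"
proof -
  interpret N: prob_space "mconv \<mu> n" by (rule mconv_prob)
  have "(\<integral>\<^sup>+k. f k \<partial>mconv \<mu> (Suc n)) = (\<integral>\<^sup>+z. f (case z of (g, h) \<Rightarrow> g ** h) \<partial>(\<mu> \<Otimes>\<^sub>M mconv \<mu> n))"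
    unfolding mconv.simps by (intro nn_integral_distr mult_measurable_pair mconv_sets) simp
  also have "\<dots> = (\<integral>\<^sup>+g. \<integral>\<^sup>+h. f (g ** h) \<partial>mconv \<mu> n \<partial>\<mu>)"
    by (subst N.nn_integral_fst[symmetric]) auto
  finally show ?thesis .
qed

lemma nn_integral_mconv_add:
  assumes f[measurable]: "f \<in> borel_measurable G_borel"
  shows "(\<integral>\<^sup>+k. f k \<partial>mconv \<mu> (m + n)) = (\<integral>\<^sup>+g. \<integral>\<^sup>+h. f (g ** h) \<partial>mconv \<mu> n \<partial>mconv \<mu> m)"
  using f
proof (induction m arbitrary: f)
  case 0
  note [measurable] = 0
  interpret N: prob_space "mconv \<mu> n" by (rule mconv_prob)
  show ?case by (subst mconv.simps(1), subst nn_integral_return) (auto simp: mat_1_Gset)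
next
  case (Suc m)
  note [measurable] = Suc.prems
  interpret N: prob_space "mconv \<mu> n" by (rule mconv_prob)
  interpret M: prob_space "mconv \<mu> m" by (rule mconv_prob)
  have "(\<integral>\<^sup>+k. f k \<partial>mconv \<mu> (Suc m + n)) = (\<integral>\<^sup>+g. \<integral>\<^sup>+k. f (g ** k) \<partial>mconv \<mu> (m + n) \<partial>\<mu>)"
    by (simp only: add_Suc nn_integral_mconv_Suc[OF Suc.prems])
  also have "\<dots> = (\<integral>\<^sup>+g. \<integral>\<^sup>+h. \<integral>\<^sup>+l. f (g ** (h ** l)) \<partial>mconv \<mu> n \<partial>mconv \<mu> m \<partial>\<mu>)"
  proof (rule nn_integral_cong)
    fix g assume "g \<in> space \<mu>"
    then have [measurable]: "(\<lambda>k. f (g ** k)) \<in> borel_measurable G_borel"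
      by (intro measurable_compose[OF mult_left_measurable Suc.prems]) simp
    show "(\<integral>\<^sup>+k. f (g ** k) \<partial>mconv \<mu> (m + n)) = (\<integral>\<^sup>+h. \<integral>\<^sup>+l. f (g ** (h ** l)) \<partial>mconv \<mu> n \<partial>mconv \<mu> m)"
      by (rule Suc.IH) measurable
  qed
  also have "\<dots> = (\<integral>\<^sup>+g. \<integral>\<^sup>+h. \<integral>\<^sup>+l. f ((g ** h) ** l) \<partial>mconv \<mu> n \<partial>mconv \<mu> m \<partial>\<mu>)"
    by (simp add: matrix_mul_assoc)
  also have "\<dots> = (\<integral>\<^sup>+g. \<integral>\<^sup>+h. f (g ** h) \<partial>mconv \<mu> n \<partial>mconv \<mu> (Suc m))"
    by (rule nn_integral_mconv_Suc[symmetric]) measurable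
  finally show ?case .
qed

lemma mconv_1: "mconv \<mu> 1 = \<mu>"
proof (rule measure_eqI)
  show "sets (mconv \<mu> 1) = sets \<mu>" by (simp add: mconv_sets sets_mu)
  fix A assume "A \<in> sets (mconv \<mu> 1)"
  then have [measurable]: "A \<in> sets G_borel" by (simp add: mconv_sets)
  have "emeasure (mconv \<mu> 1) A = (\<integral>\<^sup>+k. indicator A k \<partial>mconv \<mu> (Suc 0))"
    by (subst nn_integral_indicator) (auto simp: mconv_sets)
  also have "\<dots> = (\<integral>\<^sup>+g. \<integral>\<^sup>+h. indicator A (g ** h) \<partial>mconv \<mu> 0 \<partial>\<mu>)"
    by (rule nn_integral_mconv_Suc) measurable
  also have "\<dots> = (\<integral>\<^sup>+g. indicator A g \<partial>\<mu>)"
  proof (rule nn_integral_cong)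
    fix g assume "g \<in> space \<mu>"
    then have "(\<lambda>k. indicator A (g ** k) :: ennreal) \<in> borel_measurable G_borel"
      by (intro measurable_compose[OF mult_left_measurable borel_measurable_indicator]) simp_all
    then show "(\<integral>\<^sup>+h. indicator A (g ** h) \<partial>mconv \<mu> 0) = indicator A g"
      unfolding mconv.simps by (subst nn_integral_return) (simp_all add: mat_1_Gset)
  qed
  also have "\<dots> = emeasure \<mu> A" by (subst nn_integral_indicator) (auto simp: sets_mu)
  finally show "emeasure (mconv \<mu> 1) A = emeasure \<mu> A" .
qed

lemma mconv_add:
  "mconv \<mu> (m + n) = distr (mconv \<mu> m \<Otimes>\<^sub>M mconv \<mu> n) G_borel (\<lambda>(g, h). g ** h)"
proof (rule measure_eqI)
  interpret N: prob_space "mconv \<mu> n" by (rule mconv_prob)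
  fix A assume "A \<in> sets (mconv \<mu> (m + n))"
  then have A[measurable]: "A \<in> sets G_borel" by (simp add: mconv_sets)
  have "emeasure (mconv \<mu> (m + n)) A = (\<integral>\<^sup>+k. indicator A k \<partial>mconv \<mu> (m + n))"
    by (subst nn_integral_indicator) (auto simp: mconv_sets)
  also have "\<dots> = (\<integral>\<^sup>+g. \<integral>\<^sup>+h. indicator A (g ** h) \<partial>mconv \<mu> n \<partial>mconv \<mu> m)"
    by (rule nn_integral_mconv_add) measurable
  also have "\<dots> = (\<integral>\<^sup>+z. indicator A (case z of (g, h) \<Rightarrow> g ** h) \<partial>(mconv \<mu> m \<Otimes>\<^sub>M mconv \<mu> n))"
    by (subst N.nn_integral_fst[symmetric]) auto
  also have "\<dots> = (\<integral>\<^sup>+k. indicator A k \<partial>distr (mconv \<mu> m \<Otimes>\<^sub>M mconv \<mu> n) G_borel (\<lambda>(g, h). g ** h))"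
    by (rule nn_integral_distr[symmetric]) measurable
  also have "\<dots> = emeasure (distr (mconv \<mu> m \<Otimes>\<^sub>M mconv \<mu> n) G_borel (\<lambda>(g, h). g ** h)) A"
    by (subst nn_integral_indicator) auto
  finally show "emeasure (mconv \<mu> (m + n)) A = emeasure (distr (mconv \<mu> m \<Otimes>\<^sub>M mconv \<mu> n) G_borel (\<lambda>(g, h). g ** h)) A" .
qed (simp add: mconv_sets)

text \<open>Here g is the product of the later, left factors and h that of the earlier, right ones.
  The second order of integration conditions on the earlier factors and is the Markov property in
  disguise.\<close>

lemma integral_mconv_add:
  fixes f :: "real ^ 'n ^ 'n \<Rightarrow> 'b :: {banach, second_countable_topology}"
  assumes f: "integrable (mconv \<mu> (m + n)) f"
  shows "(LINT k|mconv \<mu> (m + n). f k) = (LINT g|mconv \<mu> m. LINT h|mconv \<mu> n. f (g ** h))"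
    and "(LINT k|mconv \<mu> (m + n). f k) = (LINT h|mconv \<mu> n. LINT g|mconv \<mu> m. f (g ** h))"
proof -
  interpret N: prob_space "mconv \<mu> n" by (rule mconv_prob)
  interpret M: prob_space "mconv \<mu> m" by (rule mconv_prob)
  interpret P: pair_prob_space "mconv \<mu> m" "mconv \<mu> n" ..
  have [measurable]: "f \<in> borel_measurable G_borel"
    using borel_measurable_integrable[OF f] by (simp add: measurable_cong_sets[OF mconv_sets refl])
  have i: "integrable (mconv \<mu> m \<Otimes>\<^sub>M mconv \<mu> n) (\<lambda>(g, h). f (g ** h))"
    using f unfolding mconv_add
    by (subst (asm) integrable_distr_eq) (auto simp: case_prod_beta')
  have e: "(LINT k|mconv \<mu> (m + n). f k) = (LINT z|(mconv \<mu> m \<Otimes>\<^sub>M mconv \<mu> n). (case z of (g, h) \<Rightarrow> f (g ** h)))"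
    unfolding mconv_add by (subst integral_distr) (auto simp: case_prod_beta')
  show "(LINT k|mconv \<mu> (m + n). f k) = (LINT g|mconv \<mu> m. LINT h|mconv \<mu> n. f (g ** h))"
    unfolding e using P.integral_fst'[OF i] by simp
  show "(LINT k|mconv \<mu> (m + n). f k) = (LINT h|mconv \<mu> n. LINT g|mconv \<mu> m. f (g ** h))"
    unfolding e using P.integral_snd[OF i] by simp
qed

end

text \<open>The coefficient of \<open>a powr q\<close> can be taken as close to 1 as desired at the
  expense of the other one, according to whether b is at most d a. This keeps the moment recursion
  of \<open>Lmat\<close> contracting for every exponent.\<close>

lemma add_powr_le:
  fixes a b :: real
  assumes "0 \<le> a" "0 \<le> b" "0 < d" "0 \<le> q"
  shows "(a + b) powr q \<le> (1 + d) powr q * a powr q + (1 + 1 / d) powr q * b powr q"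
proof (cases "b \<le> d * a")
  case True
  then have "(a + b) powr q \<le> ((1 + d) * a) powr q"
    using assms by (intro powr_mono2) (auto simp: algebra_simps)
  also have "\<dots> = (1 + d) powr q * a powr q" using assms by (simp add: powr_mult)
  finally show ?thesis using assms by (simp add: add_increasing2)
next
  case False
  then have "a \<le> b / d" using assms by (simp add: field_simps)
  then have "(a + b) powr q \<le> ((1 + 1 / d) * b) powr q"
    using assms by (intro powr_mono2) (auto simp: algebra_simps)
  also have "\<dots> = (1 + 1 / d) powr q * b powr q" using assms by (simp add: powr_mult)
  finally show ?thesis using assms by (simp add: add_increasing)
qed

context matrix_law
begin

text \<open>Countably many boxes cover \<open>Gplus\<close>, so they cannot all be null. The index k
  + 2 keeps \<open>\<eta>\<close> below 1.\<close>

lemma Gbox_positive: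
  assumes r: "0 < measure (mconv \<mu> r) Gplus"
  obtains \<eta> where "0 < \<eta>" "\<eta> < 1" "0 < measure (mconv \<mu> r) (Gbox \<eta>)"
proof -
  interpret N: prob_space "mconv \<mu> r" by (rule mconv_prob)
  have "\<exists>k. measure (mconv \<mu> r) (Gbox (1 / real (k + 2))) > 0"
  proof (rule ccontr)
    assume "\<not> ?thesis"
    then have z: "measure (mconv \<mu> r) (Gbox (1 / real (k + 2))) = 0" for k
      using measure_nonneg by (metis antisym_conv1 linorder_not_le)
    have "Gbox (1 / real (k + 2)) \<in> null_sets (mconv \<mu> r)" for k
      using z[of k] by (intro null_setsI) (auto simp: N.emeasure_eq_measure mconv_sets)
    then have n: "(\<Union>k. Gbox (1 / real (k + 2))) \<in> null_sets (mconv \<mu> r)" by (rule null_sets_UN)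
    have "Gplus \<subseteq> (\<Union>k. Gbox (1 / real (k + 2)) :: (real ^ 'n ^ 'n) set)"
    proof
      fix g :: "real ^ 'n ^ 'n" assume "g \<in> Gplus"
      then have p: "0 < g $ i $ j" for i j by (simp add: Gplus_def)
      define B where "B = Max (range (\<lambda>(i, j). max (g $ i $ j) (1 / g $ i $ j)))"
      have B: "max (g $ i $ j) (1 / g $ i $ j) \<le> B" for i j
        unfolding B_def by (rule Max_ge) (auto intro!: image_eqI[of _ _ "(i, j)"])
      obtain k :: nat where k: "B \<le> real k" using real_arch_simple by blast
      have "1 / real (k + 2) \<le> g $ i $ j \<and> g $ i $ j \<le> 1 / (1 / real (k + 2))" for i j
      proof -
        have "1 / g $ i $ j \<le> real (k + 2)" "g $ i $ j \<le> real (k + 2)" using B[of i j] k by auto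
        then show ?thesis using p[of i j] by (auto simp: field_simps)
      qed
      then show "g \<in> (\<Union>k. Gbox (1 / real (k + 2)))" unfolding Gbox_def by blast
    qed
    from N.finite_measure_mono[OF this null_setsD2[OF n]] have "measure (mconv \<mu> r) Gplus \<le> 0"
      by (simp only: measure_eq_0_null_sets[OF n])
    then show False using r by simp
  qed
  then obtain k where "measure (mconv \<mu> r) (Gbox (1 / real (k + 2))) > 0" ..
  then show thesis by (intro that[of "1 / real (k + 2)"]) auto
qed

lemma gauge_act_measurable:
  "x \<in> Splus \<Longrightarrow> y \<in> Splus \<Longrightarrow> (\<lambda>h. gauge_dist (act h x) (act h y)) \<in> borel_measurable G_borel"
  by (intro gauge_dist_measurable act_measurable measurable_const) auto

lemma gauge_act_integrable:
  assumes "x \<in> Splus" "y \<in> Splus"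
  shows "integrable (mconv \<mu> n) (\<lambda>h. gauge_dist (act h x) (act h y))"
proof -
  interpret N: prob_space "mconv \<mu> n" by (rule mconv_prob)
  show ?thesis
    by (rule N.integrable_const_bound[of _ 1])
      (use assms gauge_act_measurable[OF assms] in \<open>auto intro!: AE_I2 simp: abs_of_nonneg gauge_dist_nonneg gauge_dist_le_1 act_Splus measurable_cong_sets[OF mconv_sets refl]\<close>)
qed

text \<open>The synchronous coupling: both points are moved by the same random product.\<close>

definition gauge_mean :: "nat \<Rightarrow> real ^ 'n \<Rightarrow> real ^ 'n \<Rightarrow> real" where
  "gauge_mean n x y = (LINT h|mconv \<mu> n. gauge_dist (act h x) (act h y))"

lemma gauge_mean_nonneg: "x \<in> Splus \<Longrightarrow> y \<in> Splus \<Longrightarrow> 0 \<le> gauge_mean n x y"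
  unfolding gauge_mean_def by (intro Bochner_Integration.integral_nonneg_AE AE_I2) (auto intro!: gauge_dist_nonneg act_Splus)

lemma gauge_mean_le: assumes "x \<in> Splus" "y \<in> Splus" shows "gauge_mean n x y \<le> gauge_dist x y"
proof -
  interpret N: prob_space "mconv \<mu> n" by (rule mconv_prob)
  have "gauge_mean n x y \<le> (LINT h|mconv \<mu> n. gauge_dist x y)"
    unfolding gauge_mean_def
    by (intro integral_mono gauge_act_integrable assms) (auto intro: gauge_dist_act assms)
  then show ?thesis using N.prob_space by simp
qed

lemma gauge_mean_0: "x \<in> Splus \<Longrightarrow> y \<in> Splus \<Longrightarrow> gauge_mean 0 x y = gauge_dist x y"
  unfolding gauge_mean_def mconv.simps
  by (subst integral_return) (auto simp: mat_1_Gset act_mat_1 gauge_act_measurable)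

lemma gauge_mean_Suc:
  assumes x: "x \<in> Splus" and y: "y \<in> Splus"
  shows "(LINT g|\<mu>. gauge_mean n (act g x) (act g y)) = gauge_mean (Suc n) x y"
    and "(\<lambda>g. gauge_mean n (act g x) (act g y)) \<in> borel_measurable \<mu>"
proof -
  interpret N: prob_space "mconv \<mu> n" by (rule mconv_prob)
  have "gauge_mean (Suc n) x y = (LINT g|\<mu>. LINT h|mconv \<mu> n. gauge_dist (act (h ** g) x) (act (h ** g) y))"
    using integral_mconv_add(2)[of n 1 "\<lambda>h. gauge_dist (act h x) (act h y)"] gauge_act_integrable[OF x y, of "n + 1"]
    by (simp only: mconv_1) (simp add: gauge_mean_def)
  also have "\<dots> = (LINT g|\<mu>. gauge_mean n (act g x) (act g y))"
    unfolding gauge_mean_def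
    by (intro Bochner_Integration.integral_cong refl) (simp add: act_mult x y)
  finally show "(LINT g|\<mu>. gauge_mean n (act g x) (act g y)) = gauge_mean (Suc n) x y" ..
  note [measurable] = x y
  have [measurable]: "(\<lambda>g. act g x) \<in> \<mu> \<rightarrow>\<^sub>M S_borel" "(\<lambda>g. act g y) \<in> \<mu> \<rightarrow>\<^sub>M S_borel"
    using x y by (auto intro!: act_measurable simp: measurable_cong_sets[OF sets_mu refl])
  show "(\<lambda>g. gauge_mean n (act g x) (act g y)) \<in> borel_measurable \<mu>"
    unfolding gauge_mean_def by measurable
qed

text \<open>On the box the gauge shrinks by the factor 1 - \<eta>^4, elsewhere it does not
  grow.\<close>

lemma gauge_mean_contract:
  assumes x: "x \<in> Splus" and y: "y \<in> Splus" and eta: "0 < \<eta>" "\<eta> < 1"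
  shows "gauge_mean r x y \<le> (1 - \<eta> ^ 4 * measure (mconv \<mu> r) (Gbox \<eta>)) * gauge_dist x y"
proof -
  interpret N: prob_space "mconv \<mu> r" by (rule mconv_prob)
  have [measurable]: "Gbox \<eta> \<in> sets (mconv \<mu> r)" using Gbox_sets[OF eta(1)] by (simp add: mconv_sets)
  have [simp]: "Gbox \<eta> \<inter> Gset = (Gbox \<eta> :: (real ^ 'n ^ 'n) set)" using Gbox_Gset[OF eta(1)] by auto
  have [simp]: "integrable (mconv \<mu> r) (indicat_real (Gbox \<eta>))"
    by (rule N.integrable_const_bound[of _ 1]) (auto simp: indicator_def)
  have "gauge_mean r x y \<le> (LINT h|mconv \<mu> r. gauge_dist x y - \<eta> ^ 4 * gauge_dist x y * indicator (Gbox \<eta>) h)"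
    unfolding gauge_mean_def
  proof (rule integral_mono)
    fix h :: "real ^ 'n ^ 'n" assume h: "h \<in> space (mconv \<mu> r)"
    show "gauge_dist (act h x) (act h y) \<le> gauge_dist x y - \<eta> ^ 4 * gauge_dist x y * indicator (Gbox \<eta>) h"
      using gauge_dist_act[of h x y] gauge_dist_act_Gbox[of h \<eta> x y] h x y eta
      by (auto simp: indicator_def algebra_simps)
  qed (auto intro!: gauge_act_integrable x y Bochner_Integration.integrable_diff integrable_mult_right)
  also have "\<dots> = gauge_dist x y - \<eta> ^ 4 * gauge_dist x y * measure (mconv \<mu> r) (Gbox \<eta>)"
    by (subst Bochner_Integration.integral_diff) (use N.prob_space in \<open>auto intro!: integrable_mult_right\<close>)
  finally show ?thesis by (simp add: algebra_simps)
qed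

text \<open>Only the \<open>r\<close>-step kernel contracts the gauge; the weighted sum of the mean gauges over
  the first \<open>r\<close> steps is contracted by a single step.\<close>

lemma adapted_gauge:
  assumes r: "1 \<le> r" "0 < measure (mconv \<mu> r) Gplus" and x0: "x\<^sub>0 \<in> Splus"
  obtains D K \<theta> where "contracting_chain \<mu> S_borel act D K \<theta> x\<^sub>0"
    "\<And>x y. x \<in> Splus \<Longrightarrow> y \<in> Splus \<Longrightarrow> gauge_dist x y \<le> D x y"
proof -
  obtain \<eta> where eta: "0 < \<eta>" "\<eta> < 1" and P: "0 < measure (mconv \<mu> r) (Gbox \<eta>)"
    using Gbox_positive[OF r(2)] by blast
  interpret N: prob_space "mconv \<mu> r" by (rule mconv_prob)
  define \<rho> where "\<rho> = 1 - \<eta> ^ 4 * measure (mconv \<mu> r) (Gbox \<eta>)"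
  have e4: "0 < \<eta> ^ 4" "\<eta> ^ 4 < 1" using eta by (auto simp: power_less_one_iff)
  have "\<eta> ^ 4 * measure (mconv \<mu> r) (Gbox \<eta>) \<le> \<eta> ^ 4 * 1" by (intro mult_left_mono N.prob_le_1) (use e4 in auto)
  then have rho: "0 < \<rho>" "\<rho> < 1" using mult_pos_pos[OF e4(1) P] e4 unfolding \<rho>_def by linarith+
  \<comment> \<open>Chosen so that \<open>\<tau> ^ r * \<rho> = 1\<close>: one step shifts the
    weighted sum by an index, and the new last term is then paid for by the lost first one. The
    contraction factor per step is 1 / \<tau>.\<close>
  define \<tau> where "\<tau> = root r (1 / \<rho>)"
  have tr: "\<tau> ^ r * \<rho> = 1" using r rho by (simp add: \<tau>_def)
  have tau: "1 < \<tau>" using r rho by (simp add: \<tau>_def real_root_gt_1_iff)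
  define D where "D x y = (\<Sum>j<r. \<tau> ^ j * gauge_mean j x y)" for x y
  define K where "K = (\<Sum>j<r. \<tau> ^ j)"
  have ge: "gauge_dist x y \<le> D x y" if "x \<in> Splus" "y \<in> Splus" for x y
  proof -
    have "\<tau> ^ 0 * gauge_mean 0 x y \<le> D x y"
      unfolding D_def using r tau gauge_mean_nonneg[OF that]
      by (intro member_le_sum) auto
    then show ?thesis by (simp add: gauge_mean_0 that)
  qed
  have le: "D x y \<le> K * gauge_dist x y" if "x \<in> Splus" "y \<in> Splus" for x y
    unfolding D_def K_def sum_distrib_right
    using tau gauge_mean_le[OF that] by (intro sum_mono mult_left_mono) auto
  have K1: "1 \<le> K"
  proof -
    have "\<tau> ^ 0 \<le> K" unfolding K_def using r tau by (intro member_le_sum) auto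
    then show ?thesis by simp
  qed
  have "contracting_chain \<mu> S_borel act D K (1 / \<tau>) x\<^sub>0"
  proof (intro contracting_chain.intro contracting_chain_axioms.intro)
    show "prob_space \<mu>" by (rule prob_space_axioms)
    show "x\<^sub>0 \<in> space S_borel" using x0 by simp
    show "(\<lambda>(g, x). act g x) \<in> \<mu> \<Otimes>\<^sub>M S_borel \<rightarrow>\<^sub>M S_borel"
      by measurable
    show "0 \<le> 1 / \<tau>" "1 / \<tau> < 1" using tau by auto
    show "1 \<le> K" by (rule K1)
    fix x y assume "x \<in> space (S_borel :: (real ^ 'n) measure)" "y \<in> space (S_borel :: (real ^ 'n) measure)"
    then have x: "x \<in> Splus" and y: "y \<in> Splus" by auto
    show "(\<lambda>g. D (act g x) (act g y)) \<in> borel_measurable \<mu>"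
      unfolding D_def by (intro borel_measurable_sum borel_measurable_times borel_measurable_const gauge_mean_Suc x y)
    show "0 \<le> D x y" using ge[OF x y] gauge_dist_nonneg[OF x y] by linarith
    show "D x y \<le> K"
      using le[OF x y] mult_left_mono[OF gauge_dist_le_1[OF x y], of K] K1 by linarith
    show "D (act g x) (act g y) \<le> K * D x y" if "g \<in> space \<mu>" for g
    proof -
      have g: "g \<in> Gset" using that by simp
      have "D (act g x) (act g y) \<le> K * gauge_dist (act g x) (act g y)"
        by (intro le act_Splus g x y)
      also have "\<dots> \<le> K * D x y"
        using K1 gauge_dist_act[OF g x y] ge[OF x y] by (intro mult_left_mono) auto
      finally show ?thesis .
    qed
    have int: "integrable \<mu> (\<lambda>g. gauge_mean j (act g x) (act g y))" for j
    proof (rule integrable_const_bound[of _ 1])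
      have "\<bar>gauge_mean j (act g x) (act g y)\<bar> \<le> 1" if "g \<in> Gset" for g
        using gauge_mean_nonneg[OF act_Splus[OF that x] act_Splus[OF that y], of j]
          gauge_mean_le[OF act_Splus[OF that x] act_Splus[OF that y], of j]
          gauge_dist_le_1[OF act_Splus[OF that x] act_Splus[OF that y]] by simp
      then show "AE g in \<mu>. norm (gauge_mean j (act g x) (act g y)) \<le> 1" by (intro AE_I2) simp
    qed (rule gauge_mean_Suc(2)[OF x y])
    have "(LINT g|\<mu>. D (act g x) (act g y)) = (\<Sum>j<r. \<tau> ^ j * gauge_mean (Suc j) x y)"
      unfolding D_def by (subst Bochner_Integration.integral_sum) (auto simp: gauge_mean_Suc x y int)
    also have "\<tau> * (\<Sum>j<r. \<tau> ^ j * gauge_mean (Suc j) x y) = (\<Sum>j<r. \<tau> ^ Suc j * gauge_mean (Suc j) x y)"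
      by (simp add: sum_distrib_left mult_ac)
    also have "\<dots> = (\<Sum>j<Suc r. \<tau> ^ j * gauge_mean j x y) - gauge_dist x y"
      by (subst sum.lessThan_Suc_shift) (simp add: gauge_mean_0 x y)
    also have "\<dots> = D x y + \<tau> ^ r * gauge_mean r x y - gauge_dist x y" by (simp add: D_def)
    also have "\<tau> ^ r * gauge_mean r x y \<le> \<tau> ^ r * (\<rho> * gauge_dist x y)"
      using gauge_mean_contract[OF x y eta, of r] tau unfolding \<rho>_def by (intro mult_left_mono) auto
    also have "\<dots> = gauge_dist x y" using tr by (simp add: mult.assoc[symmetric])
    finally have "\<tau> * (LINT g|\<mu>. D (act g x) (act g y)) \<le> D x y"
      using \<open>(LINT g|\<mu>. D (act g x) (act g y)) = (\<Sum>j<r. \<tau> ^ j * gauge_mean (Suc j) x y)\<close> by simp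
    then show "(LINT g|\<mu>. D (act g x) (act g y)) \<le> 1 / \<tau> * D x y"
      using tau by (simp add: field_simps)
  qed
  then show thesis using that ge by blast
qed

text \<open>The Lipschitz constant \<open>2 * (1 + ln (Lmat g))\<close> is at most
  \<open>2 + 4 * ln (Nmat g)\<close> because \<open>ln_Lmat_le\<close> loses a factor 2, and the
  same expression bounds the cocycle. The moment of \<open>ln (Nmat g)\<close> thus becomes one of
  \<open>el\<close>.\<close>

lemma chain_of_moment:
  assumes r: "1 \<le> r" "0 < measure (mconv \<mu> r) Gplus" and x0: "x\<^sub>0 \<in> Splus"
    and p: "2 < p" "p < 3" and mom: "has_moment \<mu> p"
  obtains D K \<theta> where "lip_cocycle \<mu> S_borel act D K \<theta> x\<^sub>0 cocycle (\<lambda>g. 2 + 4 * ln (Nmat g)) p"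
proof -
  obtain D K \<theta> where ch: "contracting_chain \<mu> S_borel act D K \<theta> x\<^sub>0"
    and ge: "\<And>x y. x \<in> Splus \<Longrightarrow> y \<in> Splus \<Longrightarrow> gauge_dist x y \<le> D x y"
    using adapted_gauge[OF r x0] by blast
  have [measurable]: "(\<lambda>g. ln (Nmat g)) \<in> borel_measurable \<mu>"
    by (simp add: measurable_cong_sets[OF sets_mu refl])
  have "lip_cocycle \<mu> S_borel act D K \<theta> x\<^sub>0 cocycle (\<lambda>g. 2 + 4 * ln (Nmat g)) p"
  proof (intro lip_cocycle.intro ch lip_cocycle_axioms.intro p)
    show "(\<lambda>(g, x). cocycle g x) \<in> borel_measurable (\<mu> \<Otimes>\<^sub>M S_borel)" by measurable
    show "(\<lambda>g. 2 + 4 * ln (Nmat g)) \<in> borel_measurable \<mu>" by measurable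
    have "integrable \<mu> (\<lambda>g. ln (Nmat g) powr p)"
      by (rule integrableI_nonneg) (use mom in \<open>auto simp: has_moment_def\<close>)
    then have "integrable \<mu> (\<lambda>g. 2 powr p * 2 powr p + 2 powr p * (4 powr p * ln (Nmat g) powr p))"
      by simp
    then show "integrable \<mu> (\<lambda>g. (2 + 4 * ln (Nmat g)) powr p)"
    proof (rule Bochner_Integration.integrable_bound)
      show "AE g in \<mu>. norm ((2 + 4 * ln (Nmat g)) powr p) \<le> norm (2 powr p * 2 powr p + 2 powr p * (4 powr p * ln (Nmat g) powr p))"
      proof (rule AE_I2)
        fix g assume "g \<in> space \<mu>"
        then have n: "0 \<le> ln (Nmat g)" by (simp add: ln_Nmat_nonneg)
        have "(2 + 4 * ln (Nmat g)) powr p \<le> (1 + 1) powr p * 2 powr p + (1 + 1 / 1) powr p * (4 * ln (Nmat g)) powr p"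
          using n p by (intro add_powr_le) auto
        then show "norm ((2 + 4 * ln (Nmat g)) powr p) \<le> norm (2 powr p * 2 powr p + 2 powr p * (4 powr p * ln (Nmat g) powr p))"
          using n by (simp add: powr_mult)
      qed
    qed simp
    fix g assume "g \<in> space \<mu>"
    then have g: "g \<in> Gset" by simp
    have n: "0 \<le> ln (Nmat g)" by (rule ln_Nmat_nonneg[OF g])
    show "1 \<le> 2 + 4 * ln (Nmat g)" using n by simp
    fix x assume "x \<in> space (S_borel :: (real ^ 'n) measure)"
    then have x: "x \<in> Splus" by simp
    show "\<bar>cocycle g x\<bar> \<le> 2 + 4 * ln (Nmat g)" using abs_cocycle_le[OF g x] n by linarith
    fix y assume "y \<in> space (S_borel :: (real ^ 'n) measure)"
    then have y: "y \<in> Splus" by simp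
    have "\<bar>cocycle g x - cocycle g y\<bar> \<le> 2 * (1 + ln (Lmat g)) * gauge_dist x y" by (rule cocycle_lipschitz[OF g x y])
    also have "\<dots> \<le> (2 + 4 * ln (Nmat g)) * D x y"
      using ln_Lmat_le[OF g] ln_Lmat_nonneg[OF g] ge[OF x y] gauge_dist_nonneg[OF x y] by (intro mult_mono) auto
    finally show "\<bar>cocycle g x - cocycle g y\<bar> \<le> (2 + 4 * ln (Nmat g)) * D x y" .
  qed
  then show thesis by (rule that)
qed

text \<open>Split off the \<open>r\<close> rightmost factors: if their product lies in \<^const>\<open>Gbox\<close>, the factors to
  its left no longer matter; hence the moments satisfy a contracting affine recursion.\<close>

lemma Lmat_moment_bounded:
  assumes r: "1 \<le> r" "0 < measure (mconv \<mu> r) Gplus" and q: "0 \<le> q" and mom: "almost_has_moment \<mu> q"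
  obtains B where "0 \<le> B" "\<And>n. (\<integral>\<^sup>+g. ennreal (ln (Lmat g) powr q) \<partial>mconv \<mu> n) \<le> ennreal B"
proof -
  define X where "X g = ln (Lmat g)" for g :: "real ^ 'n ^ 'n"
  define b where "b n = (\<integral>\<^sup>+g. ennreal (X g powr q) \<partial>mconv \<mu> n)" for n
  have Xn: "0 \<le> X g" if "g \<in> Gset" for g using ln_Lmat_nonneg[OF that] by (simp add: X_def)
  have [measurable]: "X \<in> borel_measurable G_borel" unfolding X_def[abs_def] by measurable
  have XnM[measurable]: "X \<in> borel_measurable (mconv \<mu> n)" for n by (simp add: measurable_cong_sets[OF mconv_sets refl])
  have b1: "b 1 < \<infinity>" using mom unfolding b_def mconv_1 almost_has_moment_def X_def .
  \<comment> \<open>A common form for the crude bound, which yields finiteness, and for the sharp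
    one through the box: \<open>w\<close> and \<open>v\<close> depend on the right factors alone, so
    the integrals separate.\<close>
  have split: "b (m + n) \<le> (\<integral>\<^sup>+g. ennreal (X g powr q) \<partial>mconv \<mu> m) * (\<integral>\<^sup>+h. ennreal (w h) \<partial>mconv \<mu> n) + (\<integral>\<^sup>+h. ennreal (v h) \<partial>mconv \<mu> n)"
    if w[measurable]: "w \<in> borel_measurable G_borel" "v \<in> borel_measurable G_borel"
      and nn: "\<And>h. h \<in> Gset \<Longrightarrow> 0 \<le> w h" "\<And>h. h \<in> Gset \<Longrightarrow> 0 \<le> v h"
      and le: "\<And>g h. g \<in> Gset \<Longrightarrow> h \<in> Gset \<Longrightarrow> X (g ** h) powr q \<le> X g powr q * w h + v h" for w v m n
  proof -
    interpret M: prob_space "mconv \<mu> m" by (rule mconv_prob)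
    interpret N: prob_space "mconv \<mu> n" by (rule mconv_prob)
    have [measurable]: "w \<in> borel_measurable (mconv \<mu> n)" "v \<in> borel_measurable (mconv \<mu> n)"
      using w by (simp_all add: measurable_cong_sets[OF mconv_sets refl])
    have "b (m + n) = (\<integral>\<^sup>+g. \<integral>\<^sup>+h. ennreal (X (g ** h) powr q) \<partial>mconv \<mu> n \<partial>mconv \<mu> m)"
      unfolding b_def by (rule nn_integral_mconv_add) measurable
    also have "\<dots> \<le> (\<integral>\<^sup>+g. \<integral>\<^sup>+h. ennreal (X g powr q) * ennreal (w h) + ennreal (v h) \<partial>mconv \<mu> n \<partial>mconv \<mu> m)"
      using le nn by (intro nn_integral_mono) (auto simp flip: ennreal_mult ennreal_plus intro!: ennreal_leI)
    also have "\<dots> = (\<integral>\<^sup>+g. ennreal (X g powr q) * (\<integral>\<^sup>+h. ennreal (w h) \<partial>mconv \<mu> n) + (\<integral>\<^sup>+h. ennreal (v h) \<partial>mconv \<mu> n) \<partial>mconv \<mu> m)"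
      by (intro nn_integral_cong) (simp add: nn_integral_add nn_integral_cmult)
    also have "\<dots> = (\<integral>\<^sup>+g. ennreal (X g powr q) \<partial>mconv \<mu> m) * (\<integral>\<^sup>+h. ennreal (w h) \<partial>mconv \<mu> n) + (\<integral>\<^sup>+h. ennreal (v h) \<partial>mconv \<mu> n)"
      using M.emeasure_space_1 by (simp add: nn_integral_add nn_integral_multc)
    finally show ?thesis .
  qed
  have Xgh: "X (g ** h) powr q \<le> X g powr q * 2 powr q + 2 powr q * X h powr q" if "g \<in> Gset" "h \<in> Gset" for g h
  proof -
    have "X (g ** h) powr q \<le> (X g + X h) powr q"
      using ln_Lmat_mult[OF that] Xn[OF Gset_mult[OF that]] q by (intro powr_mono2) (auto simp: X_def)
    also have "\<dots> \<le> (1 + 1) powr q * X g powr q + (1 + 1 / 1) powr q * X h powr q"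
      using Xn that q by (intro add_powr_le) auto
    finally show ?thesis by (simp add: mult_ac)
  qed
  \<comment> \<open>Each moment must be finite before the recursion can be iterated in the reals;
    the bounds obtained here grow with n.\<close>
  have fin: "b n < \<infinity>" for n
  proof (induction n)
    case 0
    have "b 0 = ennreal (X (mat 1) powr q)" unfolding b_def mconv.simps
      by (subst nn_integral_return) (auto simp: mat_1_Gset)
    then show ?case by simp
  next
    case (Suc n)
    interpret N: prob_space "mconv \<mu> 1" by (rule mconv_prob)
    have "b (n + 1) \<le> b n * (\<integral>\<^sup>+h. ennreal (2 powr q) \<partial>mconv \<mu> 1) + (\<integral>\<^sup>+h. ennreal (2 powr q * X h powr q) \<partial>mconv \<mu> 1)"
      unfolding b_def[of n] by (rule split) (auto simp: Xgh)
    also have "(\<integral>\<^sup>+h. ennreal (2 powr q) \<partial>mconv \<mu> 1) = ennreal (2 powr q)" using N.emeasure_space_1 by simp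
    also have "(\<integral>\<^sup>+h. ennreal (2 powr q * X h powr q) \<partial>mconv \<mu> 1) = ennreal (2 powr q) * b 1"
      unfolding b_def by (simp only: ennreal_mult powr_ge_zero) (rule nn_integral_cmult, measurable)
    also have "b n * ennreal (2 powr q) + ennreal (2 powr q) * b 1 < \<infinity>"
      using Suc b1 by (auto simp: ennreal_mult_less_top)
    finally show ?case by simp
  qed
  obtain \<eta> where eta: "0 < \<eta>" "\<eta> < 1" and P: "0 < measure (mconv \<mu> r) (Gbox \<eta>)"
    using Gbox_positive[OF r(2)] by blast
  interpret R: prob_space "mconv \<mu> r" by (rule mconv_prob)
  let ?P = "measure (mconv \<mu> r) (Gbox \<eta>)"
  have box[measurable]: "Gbox \<eta> \<in> sets G_borel" by (rule Gbox_sets[OF eta(1)])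
  have boxr: "Gbox \<eta> \<in> sets (mconv \<mu> r)" by (simp add: mconv_sets)
  define C where "C = - 2 * ln \<eta>"
  have C0: "0 \<le> C" using eta by (simp add: C_def)
  have P1: "?P \<le> 1" by (rule R.prob_le_1)
  \<comment> \<open>Only products off the box keep the old moment, multiplied by (1 + d)^q. As the
    complement of the box has probability below 1, a small d gives a contraction factor.\<close>
  have "((\<lambda>d. (1 + d) powr q * (1 - ?P)) \<longlongrightarrow> (1 + 0) powr q * (1 - ?P)) (at_right 0)"
    by (intro tendsto_intros) auto
  then have "eventually (\<lambda>d. (1 + d) powr q * (1 - ?P) < 1) (at_right 0)"
    by (rule order_tendstoD(2)) (use P in simp)
  then have "eventually (\<lambda>d. 0 < d \<and> (1 + d) powr q * (1 - ?P) < 1) (at_right 0)"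
    using eventually_at_right_less[of 0] by eventually_elim auto
  then obtain d where d: "0 < d" "(1 + d) powr q * (1 - ?P) < 1"
    using eventually_happens trivial_limit_at_right_real by (metis (no_types, lifting))
  define a where "a = (1 + d) powr q * (1 - ?P)"
  have a: "0 \<le> a" "a < 1" using d P1 by (auto simp: a_def)
  define v where "v h = (1 + 1 / d) powr q * (C + X h) powr q" for h
  have [measurable]: "v \<in> borel_measurable G_borel" unfolding v_def[abs_def] by measurable
  have vM[measurable]: "v \<in> borel_measurable (mconv \<mu> r)" by (simp add: measurable_cong_sets[OF mconv_sets refl])
  define V where "V = (\<integral>\<^sup>+h. ennreal (v h) \<partial>mconv \<mu> r)"
  have Xbox: "X (g ** h) powr q \<le> X g powr q * ((1 + d) powr q * indicator (Gset - Gbox \<eta>) h) + v h"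
    if g: "g \<in> Gset" and h: "h \<in> Gset" for g h
  proof (cases "h \<in> Gbox \<eta>")
    case True
    have "X (g ** h) powr q \<le> (C + X h) powr q"
      using ln_Lmat_mult_Gbox[OF g True eta(1)] Xn[OF Gset_mult[OF g h]] Xn[OF h] q
      by (intro powr_mono2) (auto simp: X_def C_def)
    also have "1 * \<dots> \<le> v h"
      unfolding v_def using d q by (intro mult_right_mono ge_one_powr_ge_zero) auto
    finally show ?thesis using True by simp
  next
    case False
    have "X (g ** h) powr q \<le> (X g + (C + X h)) powr q"
      using ln_Lmat_mult[OF g h] Xn[OF Gset_mult[OF g h]] q C0 by (intro powr_mono2) (auto simp: X_def)
    also have "\<dots> \<le> (1 + d) powr q * X g powr q + v h"
      unfolding v_def using Xn[OF g] Xn[OF h] q C0 d by (intro add_powr_le) auto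
    finally show ?thesis using False h by (simp add: mult_ac)
  qed
  have rec: "b (n + r) \<le> b n * ennreal a + V" for n
  proof -
    have "b (n + r) \<le> b n * (\<integral>\<^sup>+h. ennreal ((1 + d) powr q * indicator (Gset - Gbox \<eta>) h) \<partial>mconv \<mu> r) + V"
      unfolding b_def[of n] V_def
    proof (rule split)
      have "Gset - Gbox \<eta> \<in> sets (G_borel :: (real ^ 'n ^ 'n) measure)"
        using sets.compl_sets[OF box] by simp
      then show "(\<lambda>h :: real ^ 'n ^ 'n. (1 + d) powr q * indicator (Gset - Gbox \<eta>) h) \<in> borel_measurable G_borel"
        by (intro borel_measurable_times borel_measurable_const borel_measurable_indicator)
    qed (auto simp: Xbox, auto simp: v_def)
    also have "(\<integral>\<^sup>+h. ennreal ((1 + d) powr q * indicator (Gset - Gbox \<eta>) h) \<partial>mconv \<mu> r)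
        = (\<integral>\<^sup>+h. ennreal ((1 + d) powr q) * indicator (Gset - Gbox \<eta>) h \<partial>mconv \<mu> r)"
      by (intro nn_integral_cong) (auto simp: indicator_def)
    also have "\<dots> = ennreal ((1 + d) powr q) * emeasure (mconv \<mu> r) (Gset - Gbox \<eta>)"
      using sets.compl_sets[OF boxr] by (intro nn_integral_cmult_indicator) simp
    also have "emeasure (mconv \<mu> r) (Gset - Gbox \<eta>) = ennreal (1 - ?P)"
      using R.prob_compl[OF boxr] by (simp add: R.emeasure_eq_measure)
    also have "ennreal ((1 + d) powr q) * ennreal (1 - ?P) = ennreal a"
      using P1 by (simp add: a_def ennreal_mult)
    finally show ?thesis .
  qed
  have Vfin: "V < \<infinity>"
  proof -
    let ?c = "(1 + 1 / d) powr q"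
    have "V \<le> (\<integral>\<^sup>+h. ennreal (?c * (2 powr q * C powr q)) + ennreal (?c * 2 powr q) * ennreal (X h powr q) \<partial>mconv \<mu> r)"
      unfolding V_def
    proof (rule nn_integral_mono)
      fix h assume "h \<in> space (mconv \<mu> r)"
      then have "0 \<le> X h" by (simp add: Xn)
      then have "(C + X h) powr q \<le> (1 + 1) powr q * C powr q + (1 + 1 / 1) powr q * X h powr q"
        using C0 q by (intro add_powr_le) auto
      then have "v h \<le> ?c * (2 powr q * C powr q + 2 powr q * X h powr q)"
        unfolding v_def by (intro mult_left_mono) auto
      then show "ennreal (v h) \<le> ennreal (?c * (2 powr q * C powr q)) + ennreal (?c * 2 powr q) * ennreal (X h powr q)"
        by (simp add: algebra_simps flip: ennreal_mult ennreal_plus)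
    qed
    also have "\<dots> = ennreal (?c * (2 powr q * C powr q)) + ennreal (?c * 2 powr q) * b r"
      using R.emeasure_space_1 by (simp add: nn_integral_add nn_integral_cmult b_def)
    also have "\<dots> < \<infinity>" using fin[of r] by (auto simp: ennreal_mult_less_top)
    finally show ?thesis .
  qed
  define \<beta> where "\<beta> n = enn2real (b n)" for n
  have b_eq: "b n = ennreal (\<beta> n)" for n using fin[of n] by (simp add: \<beta>_def)
  have beta0: "0 \<le> \<beta> n" for n by (simp add: \<beta>_def)
  have V_eq: "V = ennreal (enn2real V)" using Vfin by simp
  have rec': "\<beta> (n + r) \<le> \<beta> n * a + enn2real V" for n
    using rec[of n] a beta0 unfolding b_eq by (subst (asm) V_eq) (simp flip: ennreal_mult ennreal_plus)
  \<comment> \<open>The sum covers the first r indices, from which the recursion starts; the second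
    term is the fixed point of the affine map.\<close>
  define B where "B = (\<Sum>n<r. \<beta> n) + enn2real V / (1 - a)"
  have S0: "0 \<le> (\<Sum>n<r. \<beta> n)" by (intro sum_nonneg beta0)
  have "\<beta> n \<le> B" for n
  proof (induction n rule: less_induct)
    case (less n)
    show ?case
    proof (cases "n < r")
      case True
      then have "\<beta> n \<le> (\<Sum>n<r. \<beta> n)" by (intro member_le_sum) (auto simp: beta0)
      moreover have "0 \<le> enn2real V / (1 - a)" using a by simp
      ultimately show ?thesis by (simp add: B_def)
    next
      case False
      then have "\<beta> n \<le> \<beta> (n - r) * a + enn2real V" using rec'[of "n - r"] by simp
      also have "\<dots> \<le> B * a + enn2real V"
        using less[of "n - r"] False r a by (intro add_right_mono mult_right_mono) auto
      also have "\<dots> = (\<Sum>n<r. \<beta> n) * a + enn2real V / (1 - a)"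
        using a by (simp add: B_def field_simps)
      also have "(\<Sum>n<r. \<beta> n) * a \<le> (\<Sum>n<r. \<beta> n)" using a S0 by (simp add: mult_left_le)
      finally show ?thesis by (simp add: B_def)
    qed
  qed
  then have "b n \<le> ennreal B" for n unfolding b_eq by (rule ennreal_leI)
  moreover have "0 \<le> B" unfolding B_def using a S0 by simp
  ultimately show thesis using that unfolding b_def X_def by blast
qed

end

section \<open>The Berry--Esseen theorem for the martingale\<close>

lemma std_normal_cdf_lipschitz:
  "\<bar>cdf std_normal_distribution x - cdf std_normal_distribution y\<bar> \<le> 1 * \<bar>x - y\<bar>"
proof -
  interpret N: real_distribution std_normal_distribution by (rule real_dist_normal_dist)
  have le: "cdf std_normal_distribution b - cdf std_normal_distribution a \<le> b - a" if "a \<le> b" for a b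
  proof (cases "a = b")
    case False
    then have ab: "a < b" using that by simp
    have "cdf std_normal_distribution b - cdf std_normal_distribution a = measure std_normal_distribution {a<..b}"
      by (rule N.cdf_diff_eq[OF ab])
    also have "ennreal \<dots> = (\<integral>\<^sup>+x. ennreal (std_normal_density x) * indicator {a<..b} x \<partial>lborel)"
      by (subst N.emeasure_eq_measure[symmetric]) (simp add: emeasure_density)
    also have "\<dots> \<le> (\<integral>\<^sup>+x. indicator {a<..b} x \<partial>lborel)"
    proof (rule nn_integral_mono)
      fix x :: real
      have "1 \<le> sqrt (2 * pi)" using pi_ge_two by (intro real_le_rsqrt) simp
      then have "std_normal_density x \<le> 1"
        unfolding std_normal_density_def using mult_mono[of "1 / sqrt (2 * pi)" 1 "exp (- x\<^sup>2 / 2)" 1] by simp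
      then show "ennreal (std_normal_density x) * indicator {a<..b} x \<le> indicator {a<..b} x"
        by (auto simp: indicator_def ennreal_le_1)
    qed
    also have "\<dots> = ennreal (b - a)" using that by simp
    finally show ?thesis using that by simp
  qed simp
  show ?thesis
  proof (cases "x \<le> y")
    case True
    then show ?thesis using le[OF True] N.cdf_nondecreasing[OF True] by simp
  next
    case False
    then show ?thesis using le[of y x] N.cdf_nondecreasing[of y x] by simp
  qed
qed

text \<open>The Gaussian factor is a multiple of the normal density of variance 1 / (2 c), whose
  absolute moments are finite.\<close>

lemma integrable_gaussian_weight:
  fixes c :: real
  assumes c: "0 < c"
  shows "integrable lborel (\<lambda>t. (2 * \<bar>t\<bar> + t\<^sup>2) * exp (- c * t\<^sup>2))"
proof -
  define s where "s = sqrt (1 / (2 * c))"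
  have s: "0 < s" using c by (simp add: s_def)
  have s2: "s\<^sup>2 = 1 / (2 * c)" using c by (simp add: s_def)
  have e: "exp (- c * t\<^sup>2) = sqrt (2 * pi * s\<^sup>2) * normal_density 0 s t" for t
    using c s by (simp add: normal_density_def s2)
  have "integrable lborel (\<lambda>t. sqrt (2 * pi * s\<^sup>2) * (2 * (normal_density 0 s t * \<bar>t - 0\<bar> ^ 1) + normal_density 0 s t * \<bar>t - 0\<bar> ^ 2))"
    by (intro integrable_mult_right Bochner_Integration.integrable_add integrable_normal_moment_abs s)
  then show ?thesis unfolding e by (simp add: algebra_simps)
qed

context matrix_law
begin

lemma integral_mconv_Suc:
  fixes f :: "real ^ 'n ^ 'n \<Rightarrow> 'b :: {banach, second_countable_topology}"
  assumes f: "integrable (mconv \<mu> (Suc n)) f"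
  shows "(LINT k|mconv \<mu> (Suc n). f k) = (LINT h|mconv \<mu> n. LINT g|\<mu>. f (g ** h))"
  using integral_mconv_add(2)[of 1 n f] f by (simp only: mconv_1 plus_1_eq_Suc)

lemma integrable_mconv_Suc:
  fixes f :: "real ^ 'n ^ 'n \<Rightarrow> 'b :: {banach, second_countable_topology}"
  assumes f: "f \<in> borel_measurable G_borel"
    and u: "integrable (mconv \<mu> n) u" and v: "integrable \<mu> v"
    and nn: "\<And>h. h \<in> Gset \<Longrightarrow> 0 \<le> u h" "\<And>g. g \<in> Gset \<Longrightarrow> 0 \<le> v g"
    and le: "\<And>g h. g \<in> Gset \<Longrightarrow> h \<in> Gset \<Longrightarrow> norm (f (g ** h)) \<le> u h + v g"
  shows "integrable (mconv \<mu> (Suc n)) f"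
proof (rule integrableI_bounded)
  interpret N: prob_space "mconv \<mu> n" by (rule mconv_prob)
  note [measurable] = f borel_measurable_integrable[OF u] borel_measurable_integrable[OF v]
  show "f \<in> borel_measurable (mconv \<mu> (Suc n))" using f by (simp add: measurable_cong_sets[OF mconv_sets refl])
  have "(\<integral>\<^sup>+k. ennreal (norm (f k)) \<partial>mconv \<mu> (Suc n)) = (\<integral>\<^sup>+g. \<integral>\<^sup>+h. ennreal (norm (f (g ** h))) \<partial>mconv \<mu> n \<partial>\<mu>)"
    by (rule nn_integral_mconv_Suc) measurable
  also have "\<dots> \<le> (\<integral>\<^sup>+g. \<integral>\<^sup>+h. ennreal (u h) + ennreal (v g) \<partial>mconv \<mu> n \<partial>\<mu>)"
    using le nn by (intro nn_integral_mono) (auto simp flip: ennreal_plus intro!: ennreal_leI)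
  also have "\<dots> = (\<integral>\<^sup>+g. (\<integral>\<^sup>+h. ennreal (u h) \<partial>mconv \<mu> n) + ennreal (v g) \<partial>\<mu>)"
    using N.emeasure_space_1 by (intro nn_integral_cong) (simp add: nn_integral_add)
  also have "\<dots> = (\<integral>\<^sup>+h. ennreal (u h) \<partial>mconv \<mu> n) + (\<integral>\<^sup>+g. ennreal (v g) \<partial>\<mu>)"
    using emeasure_space_1 by (simp add: nn_integral_add)
  also have "\<dots> < \<infinity>"
  proof -
    have "(\<integral>\<^sup>+h. ennreal (u h) \<partial>mconv \<mu> n) = ennreal (LINT h|mconv \<mu> n. u h)"
      using nn by (intro nn_integral_eq_integral u AE_I2) simp
    moreover have "(\<integral>\<^sup>+g. ennreal (v g) \<partial>\<mu>) = ennreal (LINT g|\<mu>. v g)"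
      using nn by (intro nn_integral_eq_integral v AE_I2) simp
    ultimately show ?thesis by simp
  qed
  finally show "(\<integral>\<^sup>+k. ennreal (norm (f k)) \<partial>mconv \<mu> (Suc n)) < \<infinity>" .
qed

section \<open>The martingale, its variance and its characteristic function\<close>

definition twist :: "real \<Rightarrow> (real ^ 'n \<Rightarrow> real) \<Rightarrow> real ^ 'n ^ 'n \<Rightarrow> real ^ 'n \<Rightarrow> real" where
  "twist lam \<psi> g x = cocycle g x - lam + \<psi> (act g x) - \<psi> x"

text \<open>The sum of \<open>twist\<close> along the orbit telescopes, so it depends only on n and
  the product \<open>h\<close>. Statements about the martingale thus become integrals against
  \<open>mconv\<close>, without a filtration.\<close>

definition mart :: "real \<Rightarrow> (real ^ 'n \<Rightarrow> real) \<Rightarrow> real ^ 'n \<Rightarrow> nat \<Rightarrow> real ^ 'n ^ 'n \<Rightarrow> real" where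
  "mart lam \<psi> x n h = cocycle h x - real n * lam + \<psi> (act h x) - \<psi> x"

lemma mart_0: "x \<in> Splus \<Longrightarrow> mart lam \<psi> x 0 (mat 1) = 0"
  by (simp add: mart_def cocycle_mat_1 act_mat_1)

lemma mart_Suc:
  "g \<in> Gset \<Longrightarrow> h \<in> Gset \<Longrightarrow> x \<in> Splus \<Longrightarrow>
    mart lam \<psi> x (Suc n) (g ** h) = mart lam \<psi> x n h + twist lam \<psi> g (act h x)"
  by (simp add: mart_def twist_def cocycle_mult act_mult algebra_simps)

lemma mart_measurable:
  assumes psi: "\<psi> \<in> borel_measurable S_borel" and x: "x \<in> Splus"
  shows "mart lam \<psi> x n \<in> borel_measurable G_borel"
proof -
  have a: "(\<lambda>h. act h x) \<in> G_borel \<rightarrow>\<^sub>M S_borel" by (intro act_measurable measurable_const) (use x in auto)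
  have [measurable]: "(\<lambda>h. \<psi> (act h x)) \<in> borel_measurable G_borel" by (rule measurable_compose[OF a psi])
  have [measurable]: "(\<lambda>h. cocycle h x) \<in> borel_measurable G_borel"
    by (intro cocycle_measurable measurable_const) (use x in auto)
  show ?thesis unfolding mart_def[abs_def] by measurable
qed

text \<open>The square of the martingale plus \<open>chi\<close> along the orbit grows in mean by
  exactly \<open>s2\<close> per step, so the second moment is n s2 up to the bounded mean of
  \<open>chi\<close>. This is the means to identify the constant of the second Poisson equation with
  the given variance.\<close>

lemma mart_second_moment:
  assumes L: "lip_cocycle \<mu> S_borel act D K \<theta> x\<^sub>0 (twist lam \<psi>) el p"
    and psi: "\<psi> \<in> borel_measurable S_borel"
    and cen: "\<And>x. x \<in> Splus \<Longrightarrow> (LINT g|\<mu>. twist lam \<psi> g x) = 0"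
    and chi: "contracting_chain.lip S_borel D chi X" "chi x\<^sub>0 = 0"
      "\<And>x. x \<in> Splus \<Longrightarrow> chi x - contracting_chain.P \<mu> act chi x = (LINT g|\<mu>. (twist lam \<psi> g x)\<^sup>2) - s2"
  shows "integrable (mconv \<mu> n) (\<lambda>h. (mart lam \<psi> x\<^sub>0 n h)\<^sup>2)"
    and "\<bar>(LINT h|mconv \<mu> n. (mart lam \<psi> x\<^sub>0 n h)\<^sup>2) - real n * s2\<bar> \<le> X * K"
proof -
  interpret L: lip_cocycle \<mu> S_borel act D K \<theta> x\<^sub>0 "twist lam \<psi>" el p by fact
  let ?M = "mart lam \<psi> x\<^sub>0"
  have x0: "x\<^sub>0 \<in> Splus" using L.x0 by simp
  have chi_le: "\<bar>chi x\<bar> \<le> X * K" if "x \<in> Splus" for x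
    using L.lip_bound[OF chi(1), of x] chi(2) that by simp
  note chim = L.lip_measurable[OF chi(1)]
  have act_m: "(\<lambda>h. act h x\<^sub>0) \<in> G_borel \<rightarrow>\<^sub>M S_borel" by (intro act_measurable measurable_const) (use x0 in auto)
  have Mm: "?M n \<in> borel_measurable G_borel" for n by (rule mart_measurable[OF psi x0])
  have el_g: "\<bar>twist lam \<psi> g (act h x\<^sub>0)\<bar> \<le> el g" if "g \<in> Gset" "h \<in> Gset" for g h
    using L.sigma_le[of g "act h x\<^sub>0"] act_Splus[OF that(2) x0] that by simp
  have sq: "integrable (mconv \<mu> n) (\<lambda>h. (?M n h)\<^sup>2)" for n
  proof (induction n)
    case 0
    interpret N: prob_space "mconv \<mu> 0" by (rule mconv_prob)
    have "AE h in mconv \<mu> 0. norm ((?M 0 h)\<^sup>2) \<le> 0"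
      using Mm[of 0] unfolding mconv.simps
      by (subst AE_return) (auto simp: mat_1_Gset mart_0 x0)
    then show ?case using Mm[of 0]
      by (intro N.integrable_const_bound[of _ 0]) (simp_all add: measurable_cong_sets[OF mconv_sets refl])
  next
    case (Suc n)
    have M1: "?M (Suc n) \<in> borel_measurable G_borel" by (rule Mm)
    show ?case
    proof (rule integrable_mconv_Suc[where u = "\<lambda>h. 2 * (?M n h)\<^sup>2" and v = "\<lambda>g. 2 * (el g)\<^sup>2"])
      show "(\<lambda>h. (?M (Suc n) h)\<^sup>2) \<in> borel_measurable G_borel" using M1 by measurable
      fix g h :: "real ^ 'n ^ 'n" assume g: "g \<in> Gset" and h: "h \<in> Gset"
      let ?t = "twist lam \<psi> g (act h x\<^sub>0)"
      have "\<bar>?t\<bar> \<le> \<bar>el g\<bar>" using el_g[OF g h] by linarith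
      then have "?t\<^sup>2 \<le> (el g)\<^sup>2" by (rule abs_le_square_iff[THEN iffD1])
      moreover have "(?M n h + ?t)\<^sup>2 \<le> 2 * (?M n h)\<^sup>2 + 2 * ?t\<^sup>2"
        using zero_le_power2[of "?M n h - ?t"] by (simp add: power2_eq_square algebra_simps)
      ultimately show "norm ((?M (Suc n) (g ** h))\<^sup>2) \<le> 2 * (?M n h)\<^sup>2 + 2 * (el g)\<^sup>2"
        unfolding mart_Suc[OF g h x0] by simp
    qed (use Suc L.ell_integrable in auto)
  qed
  then show "integrable (mconv \<mu> n) (\<lambda>h. (?M n h)\<^sup>2)" .
  have act_int: "integrable (mconv \<mu> n) (\<lambda>h. chi (act h x\<^sub>0))" for n
  proof -
    interpret N: prob_space "mconv \<mu> n" by (rule mconv_prob)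
    show ?thesis
      by (rule N.integrable_const_bound[of _ "X * K"])
        (use chi_le act_Splus[OF _ x0] measurable_compose[OF act_m chim] in \<open>auto intro!: AE_I2 simp: measurable_cong_sets[OF mconv_sets refl]\<close>)
  qed
  define c where "c n = (LINT h|mconv \<mu> n. chi (act h x\<^sub>0))" for n
  have "(LINT h|mconv \<mu> n. (?M n h)\<^sup>2) = real n * s2 - c n" for n
  proof (induction n)
    case 0
    have "(LINT h|mconv \<mu> 0. (?M 0 h)\<^sup>2) = 0"
      unfolding mconv.simps using Mm[of 0] by (subst integral_return) (auto simp: mat_1_Gset mart_0 x0)
    moreover have "c 0 = 0" unfolding c_def mconv.simps
      by (subst integral_return) (auto simp: mat_1_Gset act_mat_1 x0 chi(2) intro: measurable_compose[OF act_m chim])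
    ultimately show ?case by simp
  next
    case (Suc n)
    interpret N: prob_space "mconv \<mu> n" by (rule mconv_prob)
    have inner: "(LINT g|\<mu>. (?M (Suc n) (g ** h))\<^sup>2) + (LINT g|\<mu>. chi (act (g ** h) x\<^sub>0)) = (?M n h)\<^sup>2 + (s2 + chi (act h x\<^sub>0))"
      if h: "h \<in> Gset" for h
    proof -
      let ?y = "act h x\<^sub>0"
      have y: "?y \<in> Splus" by (rule act_Splus[OF h x0])
      have "(LINT g|\<mu>. (?M (Suc n) (g ** h))\<^sup>2) = (LINT g|\<mu>. (?M n h)\<^sup>2 + 2 * ?M n h * twist lam \<psi> g ?y + (twist lam \<psi> g ?y)\<^sup>2)"
        by (intro Bochner_Integration.integral_cong refl) (simp add: mart_Suc h x0 power2_sum)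
      also have "\<dots> = (?M n h)\<^sup>2 + 2 * ?M n h * (LINT g|\<mu>. twist lam \<psi> g ?y) + (LINT g|\<mu>. (twist lam \<psi> g ?y)\<^sup>2)"
        using L.sigma_integrable[of ?y] L.sigma_sq_integrable[of ?y] y prob_space by simp
      also have "(LINT g|\<mu>. (twist lam \<psi> g ?y)\<^sup>2) = s2 + chi ?y - L.P chi ?y" using chi(3)[OF y] by simp
      also have "L.P chi ?y = (LINT g|\<mu>. chi (act (g ** h) x\<^sub>0))"
        unfolding L.P_def by (intro Bochner_Integration.integral_cong refl) (simp add: act_mult h x0)
      finally show ?thesis using cen[OF y] by simp
    qed
    have i1: "integrable (mconv \<mu> n) (\<lambda>h. (?M n h)\<^sup>2 + (s2 + chi (act h x\<^sub>0)))"
      by (intro Bochner_Integration.integrable_add sq act_int) simp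
    have "(LINT h|mconv \<mu> (Suc n). (?M (Suc n) h)\<^sup>2) + c (Suc n)
      = (LINT h|mconv \<mu> (Suc n). (?M (Suc n) h)\<^sup>2 + chi (act h x\<^sub>0))"
      unfolding c_def by (rule Bochner_Integration.integral_add[symmetric]) (rule sq act_int)+
    also have "\<dots> = (LINT h|mconv \<mu> n. LINT g|\<mu>. (?M (Suc n) (g ** h))\<^sup>2 + chi (act (g ** h) x\<^sub>0))"
      by (intro integral_mconv_Suc Bochner_Integration.integrable_add sq act_int)
    also have "\<dots> = (LINT h|mconv \<mu> n. (?M n h)\<^sup>2 + (s2 + chi (act h x\<^sub>0)))"
    proof (intro Bochner_Integration.integral_cong refl)
      fix h assume "h \<in> space (mconv \<mu> n)"
      then have h: "h \<in> Gset" by simp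
      let ?y = "act h x\<^sub>0"
      have y: "?y \<in> Splus" by (rule act_Splus[OF h x0])
      have "integrable \<mu> (\<lambda>g. (?M n h)\<^sup>2 + 2 * ?M n h * twist lam \<psi> g ?y + (twist lam \<psi> g ?y)\<^sup>2)"
        using L.sigma_integrable[of ?y] L.sigma_sq_integrable[of ?y] y by simp
      then have ia: "integrable \<mu> (\<lambda>g. (?M (Suc n) (g ** h))\<^sup>2)"
        by (rule Bochner_Integration.integrable_cong[OF refl, THEN iffD1, rotated]) (simp add: mart_Suc h x0 power2_sum)
      have "integrable \<mu> (\<lambda>g. chi (act g ?y))" using L.lip_integrable[OF chi(1), of ?y] y by simp
      then have ib: "integrable \<mu> (\<lambda>g. chi (act (g ** h) x\<^sub>0))"
        by (rule Bochner_Integration.integrable_cong[OF refl, THEN iffD1, rotated]) (simp add: act_mult h x0)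
      show "(LINT g|\<mu>. (?M (Suc n) (g ** h))\<^sup>2 + chi (act (g ** h) x\<^sub>0)) = (?M n h)\<^sup>2 + (s2 + chi (act h x\<^sub>0))"
        using inner[OF h] ia ib by simp
    qed
    also have "\<dots> = (real n * s2 - c n) + (s2 + c n)"
      using sq[of n] act_int[of n] Suc.IH N.prob_space by (simp add: c_def)
    finally show ?case by (simp add: algebra_simps)
  qed
  moreover have "\<bar>c n\<bar> \<le> X * K"
  proof -
    interpret N: prob_space "mconv \<mu> n" by (rule mconv_prob)
    have "\<bar>c n\<bar> \<le> (LINT h|mconv \<mu> n. norm (chi (act h x\<^sub>0)))"
      unfolding c_def using integral_norm_bound[of "mconv \<mu> n" "\<lambda>h. chi (act h x\<^sub>0)"] by simp
    also have "\<dots> \<le> (LINT h|mconv \<mu> n. X * K)"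
      by (intro integral_mono integrable_norm act_int) (use chi_le act_Splus[OF _ x0] in auto)
    finally show ?thesis using N.prob_space by simp
  qed
  ultimately show "\<bar>(LINT h|mconv \<mu> n. (?M n h)\<^sup>2) - real n * s2\<bar> \<le> X * K" by simp
qed

text \<open>The induction requires a general bounded test function \<open>f\<close> at the endpoint
  of the orbit: integrating out the newest factor replaces \<open>f\<close> by
  \<open>Q t f\<close>.\<close>

lemma char_mart:
  assumes L: "centered_cocycle \<mu> S_borel act D K \<theta> x\<^sub>0 (twist lam \<psi>) el p s2 chi X"
    and psi: "\<psi> \<in> borel_measurable S_borel"
  shows "(CLINT h|mconv \<mu> n. iexp (t * mart lam \<psi> x\<^sub>0 n h)) = (centered_cocycle.Q \<mu> act (twist lam \<psi>) t ^^ n) (\<lambda>_. 1) x\<^sub>0"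
proof -
  interpret L: centered_cocycle \<mu> S_borel act D K \<theta> x\<^sub>0 "twist lam \<psi>" el p s2 chi X by fact
  let ?M = "mart lam \<psi> x\<^sub>0" and ?Q = "L.Q t"
  have x0: "x\<^sub>0 \<in> Splus" using L.x0 by simp
  have act_m: "(\<lambda>h. act h x\<^sub>0) \<in> G_borel \<rightarrow>\<^sub>M S_borel" by (intro act_measurable measurable_const) (use x0 in auto)
  have Mm: "?M n \<in> borel_measurable G_borel" for n by (rule mart_measurable[OF psi x0])
  have "(CLINT h|mconv \<mu> n. iexp (t * ?M n h) * f (act h x\<^sub>0)) = (?Q ^^ n) f x\<^sub>0"
    if "f \<in> borel_measurable S_borel" "\<And>x. x \<in> Splus \<Longrightarrow> norm (f x) \<le> B" for f B
    using that
  proof (induction n arbitrary: f)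
    case 0
    have [measurable]: "(\<lambda>h. f (act h x\<^sub>0)) \<in> borel_measurable G_borel" by (rule measurable_compose[OF act_m 0(1)])
    note [measurable] = Mm[of 0]
    show ?case unfolding mconv.simps
      by (subst integral_return) (auto simp: mat_1_Gset mart_0 x0 act_mat_1)
  next
    case (Suc n)
    interpret N: prob_space "mconv \<mu> (Suc n)" by (rule mconv_prob)
    note [measurable] = Suc.prems(1)
    have fm[measurable]: "(\<lambda>h. f (act h x\<^sub>0)) \<in> borel_measurable G_borel" by (rule measurable_compose[OF act_m Suc.prems(1)])
    note [measurable] = Mm[of "Suc n"]
    have m: "(\<lambda>h. iexp (t * ?M (Suc n) h) * f (act h x\<^sub>0)) \<in> borel_measurable G_borel" by measurable
    have Qm: "?Q f \<in> borel_measurable S_borel" unfolding L.Q_def[abs_def] by measurable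
    have B0: "0 \<le> B" using Suc.prems(2)[OF x0] norm_ge_zero order_trans by blast
    have Qb: "norm (?Q f x) \<le> B" if "x \<in> Splus" for x
    proof -
      have "norm (?Q f x) \<le> (LINT g|\<mu>. norm (iexp (t * twist lam \<psi> g x) * f (act g x)))"
        unfolding L.Q_def by (rule integral_norm_bound)
      also have "\<dots> \<le> (LINT g|\<mu>. B)"
        by (rule integral_mono') (use Suc.prems(2) act_Splus that B0 in \<open>auto simp: norm_mult\<close>)
      finally show ?thesis using prob_space by simp
    qed
    have "integrable (mconv \<mu> (Suc n)) (\<lambda>h. iexp (t * ?M (Suc n) h) * f (act h x\<^sub>0))"
      by (rule N.integrable_const_bound[of _ B])
        (use m Suc.prems(2) act_Splus[OF _ x0] in \<open>auto simp del: mconv.simps intro!: AE_I2 simp: norm_mult measurable_cong_sets[OF mconv_sets refl]\<close>)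
    then have "(CLINT h|mconv \<mu> (Suc n). iexp (t * ?M (Suc n) h) * f (act h x\<^sub>0))
      = (CLINT h|mconv \<mu> n. CLINT g|\<mu>. iexp (t * ?M (Suc n) (g ** h)) * f (act (g ** h) x\<^sub>0))"
      by (rule integral_mconv_Suc)
    also have "\<dots> = (CLINT h|mconv \<mu> n. iexp (t * ?M n h) * ?Q f (act h x\<^sub>0))"
    proof (intro Bochner_Integration.integral_cong refl)
      fix h assume "h \<in> space (mconv \<mu> n)"
      then have h: "h \<in> Gset" by simp
      have "(CLINT g|\<mu>. iexp (t * ?M (Suc n) (g ** h)) * f (act (g ** h) x\<^sub>0))
        = (CLINT g|\<mu>. iexp (t * ?M n h) * (iexp (t * twist lam \<psi> g (act h x\<^sub>0)) * f (act g (act h x\<^sub>0))))"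
        by (intro Bochner_Integration.integral_cong refl)
          (simp add: mart_Suc act_mult h x0 distrib_left exp_add)
      then show "(CLINT g|\<mu>. iexp (t * ?M (Suc n) (g ** h)) * f (act (g ** h) x\<^sub>0)) = iexp (t * ?M n h) * ?Q f (act h x\<^sub>0)"
        by (simp add: L.Q_def)
    qed
    also have "\<dots> = (?Q ^^ n) (?Q f) x\<^sub>0" by (rule Suc.IH[OF Qm Qb])
    finally show ?case by (simp add: funpow_swap1)
  qed
  from this[of "\<lambda>_. 1" 1] show ?thesis by simp
qed

text \<open>Esseen's inequality with a cutoff proportional to sqrt n, the full range in which
  \<open>perturbed_iterates\<close> applies. The boundary term 1 / T is O(n^(-1/2)), within the
  claimed rate because p < 3.\<close>

theorem mart_berry_esseen:
  assumes L: "centered_cocycle \<mu> S_borel act D K \<theta> x\<^sub>0 (twist lam \<psi>) el p s2 chi X"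
    and psi: "\<psi> \<in> borel_measurable S_borel"
  obtains C where "0 \<le> C" "\<And>n u. 1 \<le> n \<Longrightarrow>
    \<bar>measure (mconv \<mu> n) {h \<in> Gset. mart lam \<psi> x\<^sub>0 n h \<le> u * sqrt (real n)} - cdf std_normal_distribution (u / sqrt s2)\<bar>
      \<le> C * real n powr (1 - p / 2)"
proof -
  interpret L: centered_cocycle \<mu> S_borel act D K \<theta> x\<^sub>0 "twist lam \<psi>" el p s2 chi X by fact
  have x0: "x\<^sub>0 \<in> Splus" using L.x0 by simp
  obtain C c r where c: "0 < c" "0 < r" "0 \<le> C"
    and Q: "\<And>t n. \<bar>t\<bar> \<le> r \<Longrightarrow> norm ((L.Q t ^^ n) (\<lambda>_. 1) x\<^sub>0 - exp (- real n * s2 * t\<^sup>2 / 2))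
       \<le> C * (t\<^sup>2 + real n * \<bar>t\<bar> powr p) * exp (- c * real n * t\<^sup>2)"
    by (rule L.perturbed_iterates) (rule that)
  obtain CE where CE: "0 < CE"
    "\<And>M N T B x. real_distribution M \<Longrightarrow> real_distribution N \<Longrightarrow> 0 < T \<Longrightarrow> 0 < B \<Longrightarrow>
      (\<And>x y. \<bar>cdf N x - cdf N y\<bar> \<le> B * \<bar>x - y\<bar>) \<Longrightarrow>
      set_integrable lborel {-T..T} (\<lambda>t. norm (char M t - char N t) / \<bar>t\<bar>) \<Longrightarrow>
      \<bar>cdf M x - cdf N x\<bar> \<le> CE * (B / T + (LINT t:{-T..T}|lborel. norm (char M t - char N t) / \<bar>t\<bar>))"
  proof (rule esseen_smoothing, goal_cases)
    case (1 C)
    show ?thesis by (rule 1(1)[OF 1(2)]) (rule 1(3))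
  qed
  have s2: "0 < s2" by (rule L.s2)
  have p: "2 < p" "p < 3" by (rule L.p)+
  \<comment> \<open>After rescaling, the error divided by |t| is at most a constant times n^(1 -
    p/2) times this weight: t^2 and |t|^p are both at most |t| (2 |t| + t^2).\<close>
  let ?w = "\<lambda>t. (2 * \<bar>t\<bar> + t\<^sup>2) * exp (- (c / s2) * t\<^sup>2)"
  have wi: "integrable lborel ?w" by (rule integrable_gaussian_weight) (use c s2 in simp)
  define I where "I = (LINT t|lborel. ?w t)"
  have I0: "0 \<le> I" unfolding I_def by (rule Bochner_Integration.integral_nonneg) auto
  define C1 where "C1 = C * (1 / s2 + 1 / s2 powr (p / 2))"
  have C1: "0 \<le> C1" using c s2 by (simp add: C1_def)
  define C2 where "C2 = CE * (1 / (r * sqrt s2) + C1 * I)"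
  have C20: "0 \<le> C2" using CE c s2 C1 I0 by (simp add: C2_def)
  show thesis
  proof (rule that[OF C20])
    fix n :: nat and u :: real assume n: "1 \<le> n"
    interpret N: prob_space "mconv \<mu> n" by (rule mconv_prob)
    let ?M = "mart lam \<psi> x\<^sub>0 n"
    have n0: "0 < real n" using n by simp
    define s where "s = sqrt (s2 * real n)"
    have s: "0 < s" using s2 n0 by (simp add: s_def)
    have ss: "s\<^sup>2 = s2 * real n" using s2 by (simp add: s_def)
    have Mm: "?M \<in> borel_measurable (mconv \<mu> n)"
      using mart_measurable[OF psi x0] by (simp add: measurable_cong_sets[OF mconv_sets refl])
    define M where "M = distr (mconv \<mu> n) borel (\<lambda>h. ?M h / s)"
    have [measurable]: "(\<lambda>h. ?M h / s) \<in> borel_measurable (mconv \<mu> n)" using Mm by measurable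
    have M: "real_distribution M" unfolding M_def by (rule N.real_distribution_distr) measurable
    interpret M: real_distribution M by (rule M)
    interpret S: real_distribution std_normal_distribution by (rule real_dist_normal_dist)
    have chM: "char M t = (L.Q (t / s) ^^ n) (\<lambda>_. 1) x\<^sub>0" for t
    proof -
      have "char M t = (CLINT h|mconv \<mu> n. iexp (t * (?M h / s)))"
        unfolding char_def M_def by (subst integral_distr) auto
      also have "\<dots> = (CLINT h|mconv \<mu> n. iexp ((t / s) * ?M h))" by simp
      also have "\<dots> = (L.Q (t / s) ^^ n) (\<lambda>_. 1) x\<^sub>0" by (rule char_mart[OF L psi])
      finally show ?thesis .
    qed
    define R where "R = real n powr (1 - p / 2)"
    have R0: "0 < R" using n0 by (simp add: R_def)
    \<comment> \<open>Applied with a = 1 to the term in t^2 and with a = 1/2 to the boundary term 1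
      / T.\<close>
    have npow: "real n powr (- a) \<le> R" if "p / 2 - 1 \<le> a" for a
      unfolding R_def using n that by (intro powr_mono) auto
    define T where "T = r * s"
    have T: "0 < T" using c s by (simp add: T_def)
    have bound: "norm (char M t - char std_normal_distribution t) / \<bar>t\<bar> \<le> C1 * R * ?w t" if t: "\<bar>t\<bar> \<le> T" for t
    proof (cases "t = 0")
      case True then show ?thesis by simp
    next
      case False
      have "\<bar>t / s\<bar> \<le> r" using t s by (simp add: T_def field_simps)
      from Q[OF this, of n]
      have q: "norm ((L.Q (t / s) ^^ n) (\<lambda>_. 1) x\<^sub>0 - exp (- real n * s2 * (t / s)\<^sup>2 / 2))
         \<le> C * ((t / s)\<^sup>2 + real n * \<bar>t / s\<bar> powr p) * exp (- c * real n * (t / s)\<^sup>2)" .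
      have a1: "real n * s2 * (t / s)\<^sup>2 = t\<^sup>2" using s2 n0 by (simp add: power_divide ss)
      have a2: "c * real n * (t / s)\<^sup>2 = c / s2 * t\<^sup>2" using s2 n0 by (simp add: power_divide ss)
      have a3: "(t / s)\<^sup>2 \<le> R / s2 * t\<^sup>2"
      proof -
        have "(t / s)\<^sup>2 = t\<^sup>2 / (s2 * real n)" by (simp add: power_divide ss)
        also have "\<dots> = real n powr (-1) / s2 * t\<^sup>2" using n0 by (simp add: powr_minus divide_inverse mult_ac)
        also have "\<dots> \<le> R / s2 * t\<^sup>2" using s2 p by (intro mult_right_mono divide_right_mono npow) auto
        finally show ?thesis .
      qed
      have a4: "real n * \<bar>t / s\<bar> powr p = R / s2 powr (p / 2) * \<bar>t\<bar> powr p"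
      proof -
        have "s powr p = (s2 * real n) powr (p / 2)"
          unfolding s_def using s2 n0 by (simp add: powr_half_sqrt[symmetric] powr_powr)
        also have "\<dots> = s2 powr (p / 2) * real n powr (p / 2)" using s2 n0 by (simp add: powr_mult)
        finally have sp: "s powr p = s2 powr (p / 2) * real n powr (p / 2)" .
        have "\<bar>t / s\<bar> powr p = \<bar>t\<bar> powr p / s powr p" using s by (simp add: powr_divide abs_divide)
        moreover have "R = real n / real n powr (p / 2)" using n0 by (simp add: R_def powr_diff)
        ultimately show ?thesis by (simp add: sp)
      qed
      have "norm (char M t - char std_normal_distribution t) \<le> C * (R / s2 * t\<^sup>2 + R / s2 powr (p / 2) * \<bar>t\<bar> powr p) * exp (- (c / s2) * t\<^sup>2)"
      proof -
        have "norm (char M t - char std_normal_distribution t)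
          \<le> C * ((t / s)\<^sup>2 + real n * \<bar>t / s\<bar> powr p) * exp (- (c / s2 * t\<^sup>2))"
          using q unfolding chM char_std_normal_distribution by (simp add: a1 a2)
        also have "\<dots> \<le> C * (R / s2 * t\<^sup>2 + R / s2 powr (p / 2) * \<bar>t\<bar> powr p) * exp (- (c / s2 * t\<^sup>2))"
          unfolding a4 using a3 c by (intro mult_right_mono mult_left_mono add_right_mono) auto
        finally show ?thesis by simp
      qed
      also have "\<dots> \<le> C * ((1 / s2 + 1 / s2 powr (p / 2)) * R * (\<bar>t\<bar> * (2 * \<bar>t\<bar> + t\<^sup>2))) * exp (- (c / s2) * t\<^sup>2)"
      proof (intro mult_right_mono mult_left_mono)
        have "\<bar>t\<bar> powr p \<le> \<bar>t\<bar> * (2 * \<bar>t\<bar> + t\<^sup>2)"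
        proof -
          have "\<bar>t\<bar> powr (p - 1) \<le> \<bar>t\<bar> + t\<^sup>2"
          proof (cases "\<bar>t\<bar> \<le> 1")
            case True
            have "\<bar>t\<bar> powr (p - 1) \<le> \<bar>t\<bar> powr 1" using True p by (intro powr_mono') auto
            then show ?thesis by (simp add: add_increasing2)
          next
            case F: False
            have "\<bar>t\<bar> powr (p - 1) \<le> \<bar>t\<bar> powr 2" using F p by (intro powr_mono) auto
            then show ?thesis using False by simp
          qed
          then have "\<bar>t\<bar> * \<bar>t\<bar> powr (p - 1) \<le> \<bar>t\<bar> * (2 * \<bar>t\<bar> + t\<^sup>2)" by (intro mult_left_mono) auto
          moreover have "\<bar>t\<bar> * \<bar>t\<bar> powr (p - 1) = \<bar>t\<bar> powr p" using powr_mult_base[of "\<bar>t\<bar>" "p - 1"] by simp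
          ultimately show ?thesis by simp
        qed
        moreover have "t\<^sup>2 \<le> \<bar>t\<bar> * (2 * \<bar>t\<bar> + t\<^sup>2)"
        proof -
          have "\<bar>t\<bar> * (2 * \<bar>t\<bar> + t\<^sup>2) = 2 * \<bar>t\<bar>\<^sup>2 + \<bar>t\<bar> * t\<^sup>2"
            unfolding power2_eq_square by (simp only: distrib_left mult_ac)
          then show ?thesis by simp
        qed
        ultimately have "R / s2 * t\<^sup>2 + R / s2 powr (p / 2) * \<bar>t\<bar> powr p
          \<le> R / s2 * (\<bar>t\<bar> * (2 * \<bar>t\<bar> + t\<^sup>2)) + R / s2 powr (p / 2) * (\<bar>t\<bar> * (2 * \<bar>t\<bar> + t\<^sup>2))"
          using R0 s2 by (intro add_mono mult_left_mono) auto
        then show "R / s2 * t\<^sup>2 + R / s2 powr (p / 2) * \<bar>t\<bar> powr p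
          \<le> (1 / s2 + 1 / s2 powr (p / 2)) * R * (\<bar>t\<bar> * (2 * \<bar>t\<bar> + t\<^sup>2))"
          by (simp add: algebra_simps)
      qed (use c in auto)
      also have "\<dots> = \<bar>t\<bar> * (C1 * R * ?w t)" by (simp add: C1_def mult_ac)
      finally show ?thesis using False by (simp add: field_simps)
    qed
    have [measurable]: "(\<lambda>t. char M t) \<in> borel_measurable borel" "(\<lambda>t. char std_normal_distribution t) \<in> borel_measurable borel"
      by measurable
    have wR: "integrable lborel (\<lambda>t. C1 * R * ?w t)" using wi by simp
    have si: "set_integrable lborel {-T..T} (\<lambda>t. norm (char M t - char std_normal_distribution t) / \<bar>t\<bar>)"
      unfolding set_integrable_def
    proof (rule Bochner_Integration.integrable_bound[OF wR])
      show "AE t in lborel. norm (indicator {-T..T} t *\<^sub>R (norm (char M t - char std_normal_distribution t) / \<bar>t\<bar>)) \<le> norm (C1 * R * ?w t)"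
      proof (rule AE_I2)
        fix t
        show "norm (indicator {-T..T} t *\<^sub>R (norm (char M t - char std_normal_distribution t) / \<bar>t\<bar>)) \<le> norm (C1 * R * ?w t)"
        proof (cases "\<bar>t\<bar> \<le> T")
          case True
          then show ?thesis using order_trans[OF bound[OF True] abs_ge_self] by (simp add: indicator_def abs_le_iff)
        next
          case False
          then show ?thesis by (auto simp: indicator_def abs_le_iff)
        qed
      qed
    qed measurable
    have "(LINT t:{-T..T}|lborel. norm (char M t - char std_normal_distribution t) / \<bar>t\<bar>) \<le> (LINT t|lborel. C1 * R * ?w t)"
      unfolding set_lebesgue_integral_def
    proof (rule integral_mono[OF si[unfolded set_integrable_def] wR])
      fix t
      show "indicator {-T..T} t *\<^sub>R (norm (char M t - char std_normal_distribution t) / \<bar>t\<bar>) \<le> C1 * R * ?w t"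
      proof (cases "\<bar>t\<bar> \<le> T")
        case True
        then show ?thesis using bound[OF True] by (simp add: indicator_def abs_le_iff)
      next
        case False
        then have "indicator {-T..T} t = (0::real)" by (auto simp: indicator_def abs_le_iff)
        then show ?thesis using C1 R0 by simp
      qed
    qed
    also have "\<dots> = C1 * R * I" by (simp add: I_def)
    finally have le: "(LINT t:{-T..T}|lborel. norm (char M t - char std_normal_distribution t) / \<bar>t\<bar>) \<le> C1 * R * I" .
    have "real n powr (- (1 / 2)) = 1 / sqrt (real n)"
      unfolding powr_minus_divide by (subst powr_half_sqrt) simp_all
    then have "1 / T = 1 / (r * sqrt s2) * real n powr (- (1 / 2))"
      by (simp add: T_def s_def real_sqrt_mult)
    also have "\<dots> \<le> 1 / (r * sqrt s2) * R" using c s2 p by (intro mult_left_mono npow) auto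
    finally have T': "1 / T \<le> 1 / (r * sqrt s2) * R" .
    have "\<bar>cdf M (u / sqrt s2) - cdf std_normal_distribution (u / sqrt s2)\<bar>
      \<le> CE * (1 / T + (LINT t:{-T..T}|lborel. norm (char M t - char std_normal_distribution t) / \<bar>t\<bar>))"
      by (rule CE(2)[OF M real_dist_normal_dist T zero_less_one std_normal_cdf_lipschitz si])
    also have "\<dots> \<le> CE * (1 / (r * sqrt s2) * R + C1 * R * I)"
      using le T' CE(1) by (intro mult_left_mono add_mono) auto
    also have "\<dots> = C2 * R" by (simp add: C2_def algebra_simps)
    also have "cdf M (u / sqrt s2) = measure (mconv \<mu> n) {h \<in> Gset. ?M h \<le> u * sqrt (real n)}"
    proof -
      have "cdf M (u / sqrt s2) = measure (mconv \<mu> n) ((\<lambda>h. ?M h / s) -` {..u / sqrt s2} \<inter> space (mconv \<mu> n))"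
        unfolding cdf_def M_def by (subst measure_distr) auto
      also have "(\<lambda>h. ?M h / s) -` {..u / sqrt s2} \<inter> space (mconv \<mu> n) = {h \<in> Gset. ?M h \<le> u * sqrt (real n)}"
        using s2 n0 by (auto simp: s_def real_sqrt_mult field_simps)
      finally show ?thesis .
    qed
    finally show "\<bar>measure (mconv \<mu> n) {h \<in> Gset. ?M h \<le> u * sqrt (real n)} - cdf std_normal_distribution (u / sqrt s2)\<bar> \<le> C2 * real n powr (1 - p / 2)"
      by (simp add: R_def)
  qed
qed

end

section \<open>Random products\<close>

lemma sup_bigo:
  fixes F :: "nat \<Rightarrow> real \<Rightarrow> real"
  assumes "\<And>n t. 1 \<le> n \<Longrightarrow> \<bar>F n t\<bar> \<le> C * \<rho> n" "\<And>n. 0 \<le> \<rho> n"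
  shows "(\<lambda>n. SUP t. \<bar>F n t\<bar>) \<in> O(\<rho>)"
proof (rule bigoI[of _ C])
  show "eventually (\<lambda>n. norm (SUP t. \<bar>F n t\<bar>) \<le> C * norm (\<rho> n)) sequentially"
    using eventually_ge_at_top[of 1]
  proof eventually_elim
    case (elim n)
    have bdd: "bdd_above (range (\<lambda>t. \<bar>F n t\<bar>))" using assms(1)[OF elim] by (intro bdd_aboveI2)
    have "(SUP t. \<bar>F n t\<bar>) \<le> C * \<rho> n" by (intro cSUP_least assms elim) simp
    moreover have "0 \<le> (SUP t. \<bar>F n t\<bar>)"
      by (rule order_trans[OF abs_ge_zero cSUP_upper[OF _ bdd]]) simp
    ultimately show ?case using assms(2)[of n] by simp
  qed
qed

text \<open>After clearing denominators the comparison of the exponents is that of q (3 - p) with p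
  - 2. Up to p = 1 + sqrt 3 the bound q >= p makes the martingale rate the slower one; beyond, the
  upper bound on q makes the truncation rate the slower one.\<close>

lemma rate_dominates:
  assumes p: "2 < p" "p < 3" and q: "p \<le> q" "q \<le> max p ((p - 2) / (3 - p))" and n: "1 \<le> (n::nat)"
  shows "real n powr (1 - p / 2) \<le> rate p q n" "real n powr (- (q / (2 * (q + 1)))) \<le> rate p q n"
proof -
  have r: "(1 / real n) powr a = real n powr (- a)" for a
    using powr_divide[of 1 "real n" a] by (simp add: powr_minus_divide)
  have q0: "0 < q + 1" using p q by linarith
  have eq: "q / (2 * (q + 1)) \<le> p / 2 - 1 \<longleftrightarrow> q * (3 - p) \<le> p - 2"
    "p / 2 - 1 \<le> q / (2 * (q + 1)) \<longleftrightarrow> p - 2 \<le> q * (3 - p)"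
  proof -
    have e: "(p / 2 - 1) * (2 * (q + 1)) = (p - 2) * (q + 1)" by (simp add: algebra_simps)
    have "q / (2 * (q + 1)) \<le> p / 2 - 1 \<longleftrightarrow> q \<le> (p - 2) * (q + 1)"
      unfolding e[symmetric] using q0 by (intro pos_divide_le_eq) simp
    then show "q / (2 * (q + 1)) \<le> p / 2 - 1 \<longleftrightarrow> q * (3 - p) \<le> p - 2" by (simp add: algebra_simps)
    have "p / 2 - 1 \<le> q / (2 * (q + 1)) \<longleftrightarrow> (p - 2) * (q + 1) \<le> q"
      unfolding e[symmetric] using q0 by (intro pos_le_divide_eq) simp
    then show "p / 2 - 1 \<le> q / (2 * (q + 1)) \<longleftrightarrow> p - 2 \<le> q * (3 - p)" by (simp add: algebra_simps)
  qed
  have "real n powr (1 - p / 2) \<le> rate p q n \<and> real n powr (- (q / (2 * (q + 1)))) \<le> rate p q n"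
  proof (cases "p \<le> 1 + sqrt 3")
    case True
    have "(p - 1)\<^sup>2 \<le> (sqrt 3)\<^sup>2" using True p by (intro power_mono) auto
    then have "p - 2 \<le> p * (3 - p)" by (simp add: power2_eq_square algebra_simps)
    also have "\<dots> \<le> q * (3 - p)" using p q by (intro mult_right_mono) auto
    finally have "p / 2 - 1 \<le> q / (2 * (q + 1))" by (simp only: eq)
    then have "real n powr (- (q / (2 * (q + 1)))) \<le> real n powr (- (p / 2 - 1))"
      using n by (intro powr_mono) auto
    moreover have "- (p / 2 - 1) = 1 - p / 2" by simp
    ultimately show ?thesis using True by (simp only: rate_def r if_True) simp
  next
    case False
    have "(sqrt 3)\<^sup>2 \<le> (p - 1)\<^sup>2" using False p by (intro power_mono) auto
    then have pp: "p * (3 - p) \<le> p - 2" by (simp add: power2_eq_square algebra_simps)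
    have "q * (3 - p) \<le> p - 2"
    proof (cases "q \<le> p")
      case True
      then have "q * (3 - p) \<le> p * (3 - p)" using p by (intro mult_right_mono) auto
      then show ?thesis using pp by linarith
    next
      case False
      then have "q \<le> (p - 2) / (3 - p)" using q by linarith
      then show ?thesis using p by (simp add: pos_le_divide_eq)
    qed
    then have "q / (2 * (q + 1)) \<le> p / 2 - 1" by (simp only: eq)
    then have "real n powr (1 - p / 2) \<le> real n powr (- (q / (2 * (q + 1))))"
      using n by (intro powr_mono) auto
    then show ?thesis using False by (simp only: rate_def r if_False) simp
  qed
  then show "real n powr (1 - p / 2) \<le> rate p q n" "real n powr (- (q / (2 * (q + 1)))) \<le> rate p q n" by auto
qed

text \<open>Off the tail event the event for \<open>X\<close> is sandwiched between events for
  \<open>Z\<close> whose threshold is moved by \<tau> in either direction; Lipschitz continuity of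
  \<open>G\<close> pays for the shift.\<close>

lemma (in prob_space) kolmogorov_transfer:
  fixes X Z U :: "'a \<Rightarrow> real"
  assumes [measurable]: "X \<in> borel_measurable M" "Z \<in> borel_measurable M" "U \<in> borel_measurable M"
    and close: "\<And>\<omega>. \<omega> \<in> space M \<Longrightarrow> \<bar>X \<omega> - Z \<omega>\<bar> \<le> U \<omega>"
    and tail: "measure M {\<omega> \<in> space M. \<tau> < U \<omega>} \<le> b"
    and Z: "\<And>u. \<bar>measure M {\<omega> \<in> space M. Z \<omega> \<le> u * w} - G u\<bar> \<le> a"
    and G: "\<And>u v. \<bar>G u - G v\<bar> \<le> c * \<bar>u - v\<bar>" and w: "0 < w" and tau: "0 \<le> \<tau>"
  shows "\<bar>measure M {\<omega> \<in> space M. X \<omega> \<le> t * w} - G t\<bar> \<le> a + b + c * (\<tau> / w)"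
proof -
  have up: "measure M {\<omega> \<in> space M. X \<omega> \<le> t * w}
      \<le> measure M {\<omega> \<in> space M. Z \<omega> \<le> (t + \<tau> / w) * w} + measure M {\<omega> \<in> space M. \<tau> < U \<omega>}"
  proof -
    have "measure M {\<omega> \<in> space M. X \<omega> \<le> t * w}
      \<le> measure M ({\<omega> \<in> space M. Z \<omega> \<le> (t + \<tau> / w) * w} \<union> {\<omega> \<in> space M. \<tau> < U \<omega>})"
    proof (rule finite_measure_mono)
      show "{\<omega> \<in> space M. X \<omega> \<le> t * w} \<subseteq> {\<omega> \<in> space M. Z \<omega> \<le> (t + \<tau> / w) * w} \<union> {\<omega> \<in> space M. \<tau> < U \<omega>}"
      proof
        fix \<omega> assume o: "\<omega> \<in> {\<omega> \<in> space M. X \<omega> \<le> t * w}"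
        then have "Z \<omega> \<le> t * w + U \<omega>" using close[of \<omega>] by auto
        moreover have "(t + \<tau> / w) * w = t * w + \<tau>" using w by (simp add: algebra_simps)
        ultimately show "\<omega> \<in> {\<omega> \<in> space M. Z \<omega> \<le> (t + \<tau> / w) * w} \<union> {\<omega> \<in> space M. \<tau> < U \<omega>}" using o by auto
      qed
    qed measurable
    also have "\<dots> \<le> measure M {\<omega> \<in> space M. Z \<omega> \<le> (t + \<tau> / w) * w} + measure M {\<omega> \<in> space M. \<tau> < U \<omega>}"
      by (intro measure_Un_le) measurable
    finally show ?thesis .
  qed
  have lo: "measure M {\<omega> \<in> space M. Z \<omega> \<le> (t - \<tau> / w) * w}
      \<le> measure M {\<omega> \<in> space M. X \<omega> \<le> t * w} + measure M {\<omega> \<in> space M. \<tau> < U \<omega>}"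
  proof -
    have "measure M {\<omega> \<in> space M. Z \<omega> \<le> (t - \<tau> / w) * w}
      \<le> measure M ({\<omega> \<in> space M. X \<omega> \<le> t * w} \<union> {\<omega> \<in> space M. \<tau> < U \<omega>})"
    proof (rule finite_measure_mono)
      show "{\<omega> \<in> space M. Z \<omega> \<le> (t - \<tau> / w) * w} \<subseteq> {\<omega> \<in> space M. X \<omega> \<le> t * w} \<union> {\<omega> \<in> space M. \<tau> < U \<omega>}"
      proof
        fix \<omega> assume o: "\<omega> \<in> {\<omega> \<in> space M. Z \<omega> \<le> (t - \<tau> / w) * w}"
        moreover have "(t - \<tau> / w) * w = t * w - \<tau>" using w by (simp add: algebra_simps)
        ultimately have "X \<omega> \<le> t * w - \<tau> + U \<omega>" using close[of \<omega>] by auto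
        then show "\<omega> \<in> {\<omega> \<in> space M. X \<omega> \<le> t * w} \<union> {\<omega> \<in> space M. \<tau> < U \<omega>}" using o by auto
      qed
    qed measurable
    also have "\<dots> \<le> measure M {\<omega> \<in> space M. X \<omega> \<le> t * w} + measure M {\<omega> \<in> space M. \<tau> < U \<omega>}"
      by (intro measure_Un_le) measurable
    finally show ?thesis .
  qed
  have "\<bar>G (t + \<tau> / w) - G t\<bar> \<le> c * (\<tau> / w)" "\<bar>G (t - \<tau> / w) - G t\<bar> \<le> c * (\<tau> / w)"
    using G[of "t + \<tau> / w" t] G[of "t - \<tau> / w" t] w tau by (simp_all add: abs_of_nonneg)
  then show ?thesis
    using up lo tail Z[of "t + \<tau> / w"] Z[of "t - \<tau> / w"] unfolding abs_le_iff by linarith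
qed

lemma left_prod_cong: "(\<And>i. 1 \<le> i \<Longrightarrow> i \<le> n \<Longrightarrow> y i = z i) \<Longrightarrow> left_prod y n = left_prod z n"
  by (induction n) auto

lemma left_prod_measurable:
  assumes "\<And>i. 1 \<le> i \<Longrightarrow> i \<le> n \<Longrightarrow> (\<lambda>\<omega>. f \<omega> i) \<in> M \<rightarrow>\<^sub>M G_borel"
  shows "(\<lambda>\<omega>. left_prod (f \<omega>) n) \<in> M \<rightarrow>\<^sub>M G_borel"
  using assms
proof (induction n)
  case 0
  then show ?case by (simp add: mat_1_Gset)
next
  case (Suc n)
  have "(\<lambda>\<omega>. f \<omega> (Suc n) ** left_prod (f \<omega>) n) \<in> M \<rightarrow>\<^sub>M G_borel"
    by (intro G_mult_measurable Suc) auto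
  then show ?case by simp
qed

section \<open>The walk realised on a probability space\<close>

locale matrix_walk = matrix_law \<mu> + M: prob_space M
  for \<mu> :: "(real ^ 'n ^ 'n) measure" and M :: "'a measure" +
  fixes Y :: "nat \<Rightarrow> 'a \<Rightarrow> real ^ 'n ^ 'n"
  assumes indep: "M.indep_vars (\<lambda>_. G_borel) Y {1..}"
    and Y_law: "\<And>n. 1 \<le> n \<Longrightarrow> distr M G_borel (Y n) = \<mu>"
begin

definition A :: "nat \<Rightarrow> 'a \<Rightarrow> real ^ 'n ^ 'n" where
  "A n \<omega> = left_prod (\<lambda>k. Y k \<omega>) n"

lemma Y_measurable: "1 \<le> n \<Longrightarrow> Y n \<in> M \<rightarrow>\<^sub>M G_borel"
  using indep unfolding M.indep_vars_def by auto

lemma A_measurable[measurable]: "A n \<in> M \<rightarrow>\<^sub>M G_borel"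
  unfolding A_def[abs_def] by (rule left_prod_measurable) (rule Y_measurable)

lemma A_Gset: "\<omega> \<in> space M \<Longrightarrow> A n \<omega> \<in> Gset"
  using measurable_space[OF A_measurable, of \<omega> n] by simp

text \<open>Independence is applied to the index blocks {Suc n} and {1..n}: the newest factor is
  independent of the product of the earlier ones, which is the recursion of
  \<open>mconv\<close>.\<close>

lemma A_law: "distr M G_borel (A n) = mconv \<mu> n"
proof (induction n)
  case 0
  have "A 0 = (\<lambda>_. mat 1)" by (simp add: A_def fun_eq_iff)
  then show ?case by (simp add: M.distr_const mat_1_Gset)
next
  case (Suc n)
  have "M.indep_var (Pi\<^sub>M {Suc n} (\<lambda>_. G_borel)) (\<lambda>\<omega>. \<lambda>i\<in>{Suc n}. Y i \<omega>) (Pi\<^sub>M {1..n} (\<lambda>_. G_borel)) (\<lambda>\<omega>. \<lambda>i\<in>{1..n}. Y i \<omega>)"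
    by (rule M.indep_var_restrict[OF indep]) auto
  then have "M.indep_var G_borel ((\<lambda>w. w (Suc n)) \<circ> (\<lambda>\<omega>. \<lambda>i\<in>{Suc n}. Y i \<omega>)) G_borel ((\<lambda>w. left_prod w n) \<circ> (\<lambda>\<omega>. \<lambda>i\<in>{1..n}. Y i \<omega>))"
  proof (rule M.indep_var_compose)
    show "(\<lambda>w. w (Suc n)) \<in> Pi\<^sub>M {Suc n} (\<lambda>_. G_borel) \<rightarrow>\<^sub>M G_borel" by (rule measurable_component_singleton) simp
    show "(\<lambda>w. left_prod w n) \<in> Pi\<^sub>M {1..n} (\<lambda>_. G_borel) \<rightarrow>\<^sub>M G_borel"
      by (rule left_prod_measurable) (rule measurable_component_singleton, simp)
  qed
  also have "(\<lambda>w. w (Suc n)) \<circ> (\<lambda>\<omega>. \<lambda>i\<in>{Suc n}. Y i \<omega>) = Y (Suc n)" by (simp add: fun_eq_iff)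
  also have "(\<lambda>w. left_prod w n) \<circ> (\<lambda>\<omega>. \<lambda>i\<in>{1..n}. Y i \<omega>) = A n"
    by (auto simp: fun_eq_iff A_def intro: left_prod_cong)
  finally have "distr M G_borel (Y (Suc n)) \<Otimes>\<^sub>M distr M G_borel (A n) = distr M (G_borel \<Otimes>\<^sub>M G_borel) (\<lambda>\<omega>. (Y (Suc n) \<omega>, A n \<omega>))"
    unfolding M.indep_var_distribution_eq by simp
  then have e: "\<mu> \<Otimes>\<^sub>M mconv \<mu> n = distr M (G_borel \<Otimes>\<^sub>M G_borel) (\<lambda>\<omega>. (Y (Suc n) \<omega>, A n \<omega>))"
    by (simp add: Y_law Suc)
  have [measurable]: "Y (Suc n) \<in> M \<rightarrow>\<^sub>M G_borel" by (rule Y_measurable) simp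
  have "mconv \<mu> (Suc n) = distr M G_borel ((\<lambda>(g, h). g ** h) \<circ> (\<lambda>\<omega>. (Y (Suc n) \<omega>, A n \<omega>)))"
    unfolding mconv.simps e by (rule distr_distr) measurable
  also have "(\<lambda>(g, h). g ** h) \<circ> (\<lambda>\<omega>. (Y (Suc n) \<omega>, A n \<omega>)) = A (Suc n)" by (simp add: fun_eq_iff A_def)
  finally show ?case ..
qed

text \<open>Joint independence turns the product measure behind \<open>conv_power\<close> into the
  law of the first r factors of the walk, whose product has law
  \<open>mconv \<mu> r\<close>.\<close>

lemma conv_power_eq: assumes r: "1 \<le> r" shows "conv_power \<mu> r = mconv \<mu> r"
proof -
  have "M.indep_vars (\<lambda>_. G_borel) Y {1..r}" by (rule M.indep_vars_subset[OF indep]) auto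
  then have "distr M (Pi\<^sub>M {1..r} (\<lambda>_. G_borel)) (\<lambda>\<omega>. \<lambda>i\<in>{1..r}. Y i \<omega>) = Pi\<^sub>M {1..r} (\<lambda>i. distr M G_borel (Y i))"
    using r by (subst (asm) M.indep_vars_iff_distr_eq_PiM') (auto intro: Y_measurable)
  also have "\<dots> = Pi\<^sub>M {1..r} (\<lambda>_. \<mu>)" by (intro PiM_cong refl) (simp add: Y_law)
  finally have e: "Pi\<^sub>M {1..r} (\<lambda>_. \<mu>) = distr M (Pi\<^sub>M {1..r} (\<lambda>_. G_borel)) (\<lambda>\<omega>. \<lambda>i\<in>{1..r}. Y i \<omega>)" ..
  have "conv_power \<mu> r = distr M G_borel ((\<lambda>y. left_prod y r) \<circ> (\<lambda>\<omega>. \<lambda>i\<in>{1..r}. Y i \<omega>))"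
    unfolding conv_power_def e
  proof (rule distr_distr)
    show "(\<lambda>w. left_prod w r) \<in> Pi\<^sub>M {1..r} (\<lambda>_. G_borel) \<rightarrow>\<^sub>M G_borel"
      by (rule left_prod_measurable) (rule measurable_component_singleton, simp)
    show "(\<lambda>\<omega>. \<lambda>i\<in>{1..r}. Y i \<omega>) \<in> M \<rightarrow>\<^sub>M Pi\<^sub>M {1..r} (\<lambda>_. G_borel)"
      by (rule measurable_restrict) (auto intro: Y_measurable)
  qed
  also have "(\<lambda>y. left_prod y r) \<circ> (\<lambda>\<omega>. \<lambda>i\<in>{1..r}. Y i \<omega>) = A r"
    by (auto simp: fun_eq_iff A_def intro: left_prod_cong)
  finally show ?thesis by (simp add: A_law)
qed

text \<open>The limits that define \<open>lam\<close> and \<open>s2\<close> do not depend on the starting point: every quantity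
  between \<^const>\<open>vmin\<close> and \<^const>\<open>opnorm\<close> is, up to an error bounded in \<open>L\<^sup>2\<close>, the martingale
  \<^const>\<open>mart\<close> started at a fixed point.\<close>

lemma martingale_approximation:
  assumes contr: "strictly_contracting \<mu>" and p: "2 < p" "p < 3" and q: "p \<le> q"
    and mom: "has_moment \<mu> p" and amom: "almost_has_moment \<mu> q"
    and W0: "\<And>\<omega>. \<omega> \<in> space M \<Longrightarrow> W\<^sub>0 \<omega> \<in> Splus"
    and lam: "AE \<omega> in M. (\<lambda>n. ln (opnorm (A n \<omega>)) / real n) \<longlonglongrightarrow> lam"
    and s2: "(\<lambda>n. (LINT \<omega>|M. (cocycle (A n \<omega>) (W\<^sub>0 \<omega>) - real n * lam)\<^sup>2) / real n) \<longlonglongrightarrow> s2" "0 < s2"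
  obtains Z U C B where
    "\<And>n. Z n \<in> borel_measurable M" "\<And>n. U n \<in> borel_measurable M"
    "\<And>n \<omega> a. \<omega> \<in> space M \<Longrightarrow> vmin (A n \<omega>) \<le> a \<Longrightarrow> a \<le> opnorm (A n \<omega>) \<Longrightarrow> \<bar>ln a - real n * lam - Z n \<omega>\<bar> \<le> U n \<omega>"
    "\<And>n \<omega>. \<omega> \<in> space M \<Longrightarrow> 0 \<le> U n \<omega>"
    "0 \<le> B" "\<And>n. (\<integral>\<^sup>+\<omega>. ennreal (U n \<omega> powr q) \<partial>M) \<le> ennreal B"
    "0 \<le> C" "\<And>n u. 1 \<le> n \<Longrightarrow> \<bar>measure M {\<omega> \<in> space M. Z n \<omega> \<le> u * sqrt (real n)} - cdf std_normal_distribution (u / sqrt s2)\<bar>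
      \<le> C * real n powr (1 - p / 2)"
proof -
  obtain r where r: "1 \<le> r" "0 < measure (mconv \<mu> r) Gplus"
    using contr conv_power_eq unfolding strictly_contracting_def by auto
  \<comment> \<open>Any point of the simplex would do; \<open>undefined\<close> merely selects a
    coordinate.\<close>
  define x\<^sub>0 :: "real ^ 'n" where "x\<^sub>0 = axis undefined 1"
  have x0: "x\<^sub>0 \<in> Splus" unfolding x\<^sub>0_def by (rule axis_Splus)
  obtain D K \<theta> where L0: "lip_cocycle \<mu> S_borel act D K \<theta> x\<^sub>0 cocycle (\<lambda>g. 2 + 4 * ln (Nmat g)) p"
    using chain_of_moment[OF r x0 p mom] by blast
  interpret L0: lip_cocycle \<mu> S_borel act D K \<theta> x\<^sub>0 cocycle "\<lambda>g. 2 + 4 * ln (Nmat g)" p by (rule L0)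
  obtain l \<psi> E where psi: "L0.lip \<psi> E" "\<psi> x\<^sub>0 = 0"
    and cen: "\<And>x. x \<in> space S_borel \<Longrightarrow> (LINT g|\<mu>. cocycle g x - l + \<psi> (act g x) - \<psi> x) = 0"
  proof (rule L0.centering, goal_cases)
    case (1 l \<psi> E)
    show ?thesis by (rule 1(1)[OF 1(2,3)]) (rule 1(4))
  qed
  obtain c where L1: "lip_cocycle \<mu> S_borel act D K \<theta> x\<^sub>0 (\<lambda>g x. cocycle g x - l + \<psi> (act g x) - \<psi> x) (\<lambda>g. c * (2 + 4 * ln (Nmat g))) p"
    using L0.lip_cocycle_cohomologous[OF psi(1)] by blast
  have tw: "(\<lambda>g x. cocycle g x - l + \<psi> (act g x) - \<psi> x) = twist l \<psi>" by (simp add: fun_eq_iff twist_def)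
  note L1 = L1[unfolded tw]
  interpret L1: lip_cocycle \<mu> S_borel act D K \<theta> x\<^sub>0 "twist l \<psi>" "\<lambda>g. c * (2 + 4 * ln (Nmat g))" p by (rule L1)
  have cen: "(LINT g|\<mu>. twist l \<psi> g x) = 0" if "x \<in> Splus" for x using cen[of x] that by (simp add: twist_def)
  obtain v chi X where chi: "L0.lip chi X" "chi x\<^sub>0 = 0"
    "\<And>x. x \<in> space S_borel \<Longrightarrow> chi x - L0.P chi x = (LINT g|\<mu>. (twist l \<psi> g x)\<^sup>2) - v"
  proof (rule L1.variance_poisson, goal_cases)
    case (1 chi X v)
    show ?thesis by (rule 1(1)[OF 1(2,3)]) (rule 1(4))
  qed
  have psim: "\<psi> \<in> borel_measurable S_borel" by (rule L0.lip_measurable[OF psi(1)])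
  have chi3: "chi x - L0.P chi x = (LINT g|\<mu>. (twist l \<psi> g x)\<^sup>2) - v" if "x \<in> Splus" for x
    using chi(3)[of x] that by simp
  have sm: "integrable (mconv \<mu> n) (\<lambda>h. (mart l \<psi> x\<^sub>0 n h)\<^sup>2)"
    "\<bar>(LINT h|mconv \<mu> n. (mart l \<psi> x\<^sub>0 n h)\<^sup>2) - real n * v\<bar> \<le> X * K" for n
    by (rule mart_second_moment[OF L1 psim cen chi(1,2) chi3]; assumption)+
  define Z where "Z n \<omega> = mart l \<psi> x\<^sub>0 n (A n \<omega>)" for n \<omega>
  have Zm[measurable]: "Z n \<in> borel_measurable M" for n
    unfolding Z_def[abs_def] by (rule measurable_compose[OF A_measurable mart_measurable[OF psim x0]])
  have Zsq: "integrable M (\<lambda>\<omega>. (Z n \<omega>)\<^sup>2)" "\<bar>(LINT \<omega>|M. (Z n \<omega>)\<^sup>2) - real n * v\<bar> \<le> X * K" for n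
  proof -
    have mm: "(\<lambda>h. (mart l \<psi> x\<^sub>0 n h)\<^sup>2) \<in> borel_measurable G_borel" using mart_measurable[OF psim x0] by measurable
    show "integrable M (\<lambda>\<omega>. (Z n \<omega>)\<^sup>2)"
      using sm(1)[of n] mm unfolding Z_def A_law[symmetric] by (subst (asm) integrable_distr_eq) auto
    show "\<bar>(LINT \<omega>|M. (Z n \<omega>)\<^sup>2) - real n * v\<bar> \<le> X * K"
      using sm(2)[of n] mm unfolding Z_def A_law[symmetric] by (subst (asm) integral_distr) auto
  qed
  \<comment> \<open>A bound for the oscillation of \<open>\<psi>\<close>: the coboundary part of the
    martingale is moved into the error \<open>U\<close>.\<close>
  define b where "b = E * K"
  have b0: "0 \<le> b" using L0.lip_nonneg[OF psi(1)] L0.K by (simp add: b_def)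
  define U where "U n \<omega> = ln (Lmat (A n \<omega>)) + b" for n \<omega>
  have Um[measurable]: "U n \<in> borel_measurable M" for n unfolding U_def[abs_def] by measurable
  have U0: "0 \<le> U n \<omega>" if "\<omega> \<in> space M" for n \<omega>
    using ln_Lmat_nonneg[OF A_Gset[OF that]] b0 by (simp add: U_def)
  have close: "\<bar>ln a - real n * l - Z n \<omega>\<bar> \<le> U n \<omega>"
    if o: "\<omega> \<in> space M" and a: "vmin (A n \<omega>) \<le> a" "a \<le> opnorm (A n \<omega>)" for n \<omega> a
  proof -
    note g = A_Gset[OF o, of n]
    have "\<bar>ln a - cocycle (A n \<omega>) x\<^sub>0\<bar> \<le> ln (Lmat (A n \<omega>))"
      unfolding cocycle_def by (intro abs_ln_diff_le_ln_Lmat g a vmin_le le_opnorm x0)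
    moreover have "\<bar>\<psi> (act (A n \<omega>) x\<^sub>0) - \<psi> x\<^sub>0\<bar> \<le> b"
      using L0.lip_osc[OF psi(1), of "act (A n \<omega>) x\<^sub>0" x\<^sub>0] act_Splus[OF g x0] x0 by (simp add: b_def)
    ultimately show ?thesis unfolding Z_def U_def mart_def by (simp add: abs_le_iff)
  qed
  have q0: "0 \<le> q" "2 \<le> q" using p q by auto
  obtain B0 where B0: "0 \<le> B0" "\<And>n. (\<integral>\<^sup>+g. ennreal (ln (Lmat g) powr q) \<partial>mconv \<mu> n) \<le> ennreal B0"
    using Lmat_moment_bounded[OF r q0(1) amom] by blast
  define B where "B = 2 powr q * B0 + 2 powr q * b powr q"
  have Bnn: "0 \<le> B" using B0 by (simp add: B_def)
  have Uq: "(\<integral>\<^sup>+\<omega>. ennreal (U n \<omega> powr q) \<partial>M) \<le> ennreal B" for n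
  proof -
    have "(\<integral>\<^sup>+\<omega>. ennreal (U n \<omega> powr q) \<partial>M) \<le> (\<integral>\<^sup>+\<omega>. ennreal (2 powr q) * ennreal (ln (Lmat (A n \<omega>)) powr q) + ennreal (2 powr q * b powr q) \<partial>M)"
    proof (rule nn_integral_mono)
      fix \<omega> assume o: "\<omega> \<in> space M"
      have "U n \<omega> powr q \<le> (1 + 1) powr q * ln (Lmat (A n \<omega>)) powr q + (1 + 1 / 1) powr q * b powr q"
        unfolding U_def by (intro add_powr_le ln_Lmat_nonneg A_Gset o b0 q0) simp
      then show "ennreal (U n \<omega> powr q) \<le> ennreal (2 powr q) * ennreal (ln (Lmat (A n \<omega>)) powr q) + ennreal (2 powr q * b powr q)"
        by (simp flip: ennreal_mult ennreal_plus)
    qed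
    also have "\<dots> = ennreal (2 powr q) * (\<integral>\<^sup>+\<omega>. ennreal (ln (Lmat (A n \<omega>)) powr q) \<partial>M) + ennreal (2 powr q * b powr q)"
      using M.emeasure_space_1 by (simp add: nn_integral_add nn_integral_cmult)
    also have "(\<integral>\<^sup>+\<omega>. ennreal (ln (Lmat (A n \<omega>)) powr q) \<partial>M) = (\<integral>\<^sup>+g. ennreal (ln (Lmat g) powr q) \<partial>mconv \<mu> n)"
      unfolding A_law[symmetric] by (rule nn_integral_distr[symmetric]) measurable
    also have "ennreal (2 powr q) * \<dots> + ennreal (2 powr q * b powr q) \<le> ennreal (2 powr q) * ennreal B0 + ennreal (2 powr q * b powr q)"
      by (intro add_right_mono mult_left_mono B0) simp
    also have "\<dots> = ennreal B" using B0 by (simp add: B_def ennreal_mult)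
    finally show ?thesis .
  qed
  have Usq: "integrable M (\<lambda>\<omega>. (U n \<omega>)\<^sup>2)" "(LINT \<omega>|M. (U n \<omega>)\<^sup>2) \<le> 1 + B" for n
  proof -
    have "(\<integral>\<^sup>+\<omega>. ennreal ((U n \<omega>)\<^sup>2) \<partial>M) \<le> (\<integral>\<^sup>+\<omega>. 1 + ennreal (U n \<omega> powr q) \<partial>M)"
    proof (rule nn_integral_mono)
      fix \<omega> assume o: "\<omega> \<in> space M"
      have "(U n \<omega>)\<^sup>2 \<le> 1 + U n \<omega> powr q"
      proof (cases "U n \<omega> \<le> 1")
        case True
        then have "(U n \<omega>)\<^sup>2 \<le> 1" using U0[OF o] by (simp add: power_le_one)
        then show ?thesis by (simp add: add_increasing2)
      next
        case False
        then have "U n \<omega> powr 2 \<le> U n \<omega> powr q" using q0 by (intro powr_mono) auto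
        then show ?thesis using False by simp
      qed
      then have "ennreal ((U n \<omega>)\<^sup>2) \<le> ennreal (1 + U n \<omega> powr q)" by (rule ennreal_leI)
      then show "ennreal ((U n \<omega>)\<^sup>2) \<le> 1 + ennreal (U n \<omega> powr q)" by simp
    qed
    also have "\<dots> = 1 + (\<integral>\<^sup>+\<omega>. ennreal (U n \<omega> powr q) \<partial>M)"
      using M.emeasure_space_1 by (simp add: nn_integral_add)
    also have "\<dots> \<le> 1 + ennreal B" by (intro add_left_mono Uq)
    finally have le: "(\<integral>\<^sup>+\<omega>. ennreal ((U n \<omega>)\<^sup>2) \<partial>M) \<le> ennreal (1 + B)" using Bnn by simp
    show i: "integrable M (\<lambda>\<omega>. (U n \<omega>)\<^sup>2)"
      by (rule integrableI_nonneg) (use le in \<open>auto simp: less_top[symmetric] top_unique\<close>)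
    have "ennreal (LINT \<omega>|M. (U n \<omega>)\<^sup>2) = (\<integral>\<^sup>+\<omega>. ennreal ((U n \<omega>)\<^sup>2) \<partial>M)"
      by (rule nn_integral_eq_integral[symmetric, OF i]) simp
    then have "ennreal (LINT \<omega>|M. (U n \<omega>)\<^sup>2) \<le> ennreal (1 + B)" using le by (simp only:)
    moreover have "0 \<le> 1 + B" using Bnn by simp
    ultimately show "(LINT \<omega>|M. (U n \<omega>)\<^sup>2) \<le> 1 + B" by (simp only: ennreal_le_iff)
  qed
  have lim_aux: "(\<lambda>n. (2 * (real n * v + X * K) + 2 * (1 + B)) / (real n)\<^sup>2) \<longlonglongrightarrow> 0"
    by real_asymp
  \<comment> \<open>The mean square of \<open>ln (opnorm (A n \<omega>)) / real n - l\<close> is O(1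
    / n), while the squares converge almost surely to \<open>(lam - l)\<^sup>2\<close>; Fatou's
    lemma forces this limit to be 0.\<close>
  have l_eq: "l = lam"
  proof -
    define f where "f n \<omega> = (ln (opnorm (A n \<omega>)) / real n - l)\<^sup>2" for n \<omega>
    have [measurable]: "f n \<in> borel_measurable M" for n unfolding f_def[abs_def] by measurable
    have fl: "AE \<omega> in M. (\<lambda>n. ennreal (f n \<omega>)) \<longlonglongrightarrow> ennreal ((lam - l)\<^sup>2)"
      using lam by eventually_elim (auto simp: f_def intro!: tendsto_intros)
    have fb: "(\<integral>\<^sup>+\<omega>. ennreal (f n \<omega>) \<partial>M) \<le> ennreal ((2 * (real n * v + X * K) + 2 * (1 + B)) / (real n)\<^sup>2)"
      if n: "1 \<le> n" for n
    proof -
      have i: "integrable M (\<lambda>\<omega>. (2 * (Z n \<omega>)\<^sup>2 + 2 * (U n \<omega>)\<^sup>2) / (real n)\<^sup>2)"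
        using Zsq(1)[of n] Usq(1)[of n] by simp
      have "(\<integral>\<^sup>+\<omega>. ennreal (f n \<omega>) \<partial>M) \<le> (\<integral>\<^sup>+\<omega>. ennreal ((2 * (Z n \<omega>)\<^sup>2 + 2 * (U n \<omega>)\<^sup>2) / (real n)\<^sup>2) \<partial>M)"
      proof (intro nn_integral_mono ennreal_leI)
        fix \<omega> assume o: "\<omega> \<in> space M"
        let ?d = "ln (opnorm (A n \<omega>)) - real n * l"
        have "\<bar>?d - Z n \<omega>\<bar> \<le> \<bar>U n \<omega>\<bar>"
          using close[OF o vmin_le_opnorm[OF A_Gset[OF o]] order_refl, of n] by linarith
        then have "(?d - Z n \<omega>)\<^sup>2 \<le> (U n \<omega>)\<^sup>2" by (rule abs_le_square_iff[THEN iffD1])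
        moreover have "?d\<^sup>2 \<le> 2 * (Z n \<omega>)\<^sup>2 + 2 * (?d - Z n \<omega>)\<^sup>2"
          using zero_le_power2[of "?d - 2 * Z n \<omega>"] by (simp add: power2_eq_square algebra_simps)
        ultimately have "?d\<^sup>2 \<le> 2 * (Z n \<omega>)\<^sup>2 + 2 * (U n \<omega>)\<^sup>2" by linarith
        moreover have "f n \<omega> = ?d\<^sup>2 / (real n)\<^sup>2"
          using n by (simp add: f_def power_divide[symmetric] diff_divide_distrib)
        ultimately show "f n \<omega> \<le> (2 * (Z n \<omega>)\<^sup>2 + 2 * (U n \<omega>)\<^sup>2) / (real n)\<^sup>2"
          by (simp add: divide_right_mono)
      qed
      also have "\<dots> = ennreal (LINT \<omega>|M. (2 * (Z n \<omega>)\<^sup>2 + 2 * (U n \<omega>)\<^sup>2) / (real n)\<^sup>2)"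
        by (rule nn_integral_eq_integral[OF i]) simp
      also have "(LINT \<omega>|M. (2 * (Z n \<omega>)\<^sup>2 + 2 * (U n \<omega>)\<^sup>2) / (real n)\<^sup>2)
          = (2 * (LINT \<omega>|M. (Z n \<omega>)\<^sup>2) + 2 * (LINT \<omega>|M. (U n \<omega>)\<^sup>2)) / (real n)\<^sup>2"
        using Zsq(1)[of n] Usq(1)[of n] by simp
      also have "ennreal \<dots> \<le> ennreal ((2 * (real n * v + X * K) + 2 * (1 + B)) / (real n)\<^sup>2)"
        using Zsq(2)[of n] Usq(2)[of n] by (intro ennreal_leI divide_right_mono) (auto simp: abs_le_iff)
      finally show ?thesis .
    qed
    have "ennreal ((lam - l)\<^sup>2) = (\<integral>\<^sup>+\<omega>. ennreal ((lam - l)\<^sup>2) \<partial>M)" using M.emeasure_space_1 by simp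
    also have "\<dots> = (\<integral>\<^sup>+\<omega>. liminf (\<lambda>n. ennreal (f n \<omega>)) \<partial>M)"
    proof (rule nn_integral_cong_AE)
      show "AE \<omega> in M. ennreal ((lam - l)\<^sup>2) = liminf (\<lambda>n. ennreal (f n \<omega>))"
        using fl
      proof eventually_elim
        case (elim \<omega>)
        show ?case using lim_imp_Liminf[OF _ elim] by simp
      qed
    qed
    also have "\<dots> \<le> liminf (\<lambda>n. \<integral>\<^sup>+\<omega>. ennreal (f n \<omega>) \<partial>M)" by (rule nn_integral_liminf) measurable
    also have "\<dots> \<le> liminf (\<lambda>n. ennreal ((2 * (real n * v + X * K) + 2 * (1 + B)) / (real n)\<^sup>2))"
      by (rule Liminf_mono, rule eventually_mono[OF eventually_ge_at_top[of 1]]) (rule fb)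
    also have "\<dots> = ennreal 0"
      by (rule lim_imp_Liminf[OF _ tendsto_ennrealI[OF lim_aux]]) simp
    finally show ?thesis by simp
  qed
  \<comment> \<open>\<open>U\<close> is bounded in L^2 and \<open>Z\<close> is of order sqrt n
    there. Young's inequality with weight sqrt n splits the cross term into two parts of order sqrt
    n, negligible after division by n.\<close>
  have v_eq: "v = s2"
  proof -
    define f where "f n \<omega> = cocycle (A n \<omega>) (W\<^sub>0 \<omega>) - real n * lam" for n \<omega>
    define a where "a n = (LINT \<omega>|M. (f n \<omega>)\<^sup>2)" for n
    define z where "z n = (LINT \<omega>|M. (Z n \<omega>)\<^sup>2)" for n
    have alim: "(\<lambda>n. a n / real n) \<longlonglongrightarrow> s2" using s2(1) by (simp add: a_def f_def)
    have zb: "\<bar>z n - real n * v\<bar> \<le> X * K" for n using Zsq(2)[of n] by (simp add: z_def)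
    \<comment> \<open>The Bochner integral of a non-integrable function is 0, so positivity of the
      limit \<open>s2\<close> yields integrability of the squares for all large n.\<close>
    have "eventually (\<lambda>n. 0 < a n / real n) sequentially" using order_tendstoD(1)[OF alim s2(2)] .
    then have diff: "eventually (\<lambda>n. \<bar>a n / real n - v\<bar> \<le> ((1 + sqrt (real n)) * (1 + B) + (real n * v + X * K) / sqrt (real n) + X * K) / real n) sequentially"
      using eventually_ge_at_top[of 1]
    proof eventually_elim
      case (elim n)
      let ?r = "sqrt (real n)"
      have r: "0 < ?r" using elim by simp
      have "a n \<noteq> 0" using elim by auto
      then have fi: "integrable M (\<lambda>\<omega>. (f n \<omega>)\<^sup>2)"
        unfolding a_def using not_integrable_integral_eq by blast
      have "\<bar>a n - z n\<bar> = \<bar>LINT \<omega>|M. (f n \<omega>)\<^sup>2 - (Z n \<omega>)\<^sup>2\<bar>"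
        unfolding a_def z_def using fi Zsq(1)[of n] by simp
      also have "\<dots> \<le> (LINT \<omega>|M. \<bar>(f n \<omega>)\<^sup>2 - (Z n \<omega>)\<^sup>2\<bar>)" by (rule integral_abs_bound)
      also have "\<dots> \<le> (LINT \<omega>|M. (1 + ?r) * (U n \<omega>)\<^sup>2 + (Z n \<omega>)\<^sup>2 / ?r)"
      proof (rule integral_mono)
        show "integrable M (\<lambda>\<omega>. \<bar>(f n \<omega>)\<^sup>2 - (Z n \<omega>)\<^sup>2\<bar>)" using fi Zsq(1)[of n] by simp
        show "integrable M (\<lambda>\<omega>. (1 + ?r) * (U n \<omega>)\<^sup>2 + (Z n \<omega>)\<^sup>2 / ?r)" using Usq(1)[of n] Zsq(1)[of n] by simp
        fix \<omega> assume o: "\<omega> \<in> space M"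
        note g = A_Gset[OF o, of n]
        let ?u = "U n \<omega>" and ?z = "\<bar>Z n \<omega>\<bar>"
        have u: "\<bar>f n \<omega> - Z n \<omega>\<bar> \<le> ?u"
          using close[OF o vmin_le[OF g W0[OF o]] le_opnorm[OF g W0[OF o]]] by (simp add: f_def cocycle_def l_eq)
        have "\<bar>(f n \<omega>)\<^sup>2 - (Z n \<omega>)\<^sup>2\<bar> = \<bar>f n \<omega> - Z n \<omega>\<bar> * \<bar>f n \<omega> + Z n \<omega>\<bar>"
          by (simp add: power2_eq_square square_diff_square_factored abs_mult mult.commute)
        also have "\<dots> \<le> ?u * (?u + 2 * ?z)" using u by (intro mult_mono) auto
        also have "\<dots> = ?u\<^sup>2 + 2 * ?u * ?z" by (simp add: power2_eq_square algebra_simps)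
        also have "2 * ?u * ?z \<le> ?r * ?u\<^sup>2 + (Z n \<omega>)\<^sup>2 / ?r"
        proof -
          have "0 \<le> (?r * ?u - ?z)\<^sup>2 / ?r" using r by simp
          also have "\<dots> = ?r * ?u\<^sup>2 + (Z n \<omega>)\<^sup>2 / ?r - 2 * ?u * ?z"
            using r by (simp add: power2_diff power_mult_distrib field_simps)
          finally show ?thesis by simp
        qed
        finally show "\<bar>(f n \<omega>)\<^sup>2 - (Z n \<omega>)\<^sup>2\<bar> \<le> (1 + ?r) * ?u\<^sup>2 + (Z n \<omega>)\<^sup>2 / ?r" by (simp add: algebra_simps)
      qed
      also have "\<dots> = (1 + ?r) * (LINT \<omega>|M. (U n \<omega>)\<^sup>2) + z n / ?r"
        using Usq(1)[of n] Zsq(1)[of n] by (simp add: z_def)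
      also have "\<dots> \<le> (1 + ?r) * (1 + B) + (real n * v + X * K) / ?r"
        using Usq(2)[of n] zb[of n] r by (intro add_mono mult_left_mono divide_right_mono) (auto simp: abs_le_iff)
      finally have az: "\<bar>a n - z n\<bar> \<le> (1 + ?r) * (1 + B) + (real n * v + X * K) / ?r" .
      have "a n / real n - v = (a n - real n * v) / real n"
        using elim by (simp add: diff_divide_distrib)
      then have "\<bar>a n / real n - v\<bar> = \<bar>a n - real n * v\<bar> / real n"
        by (simp only: abs_divide abs_of_nat)
      also have "\<dots> \<le> ((1 + ?r) * (1 + B) + (real n * v + X * K) / ?r + X * K) / real n"
        using az zb[of n] by (intro divide_right_mono) auto
      finally show ?case .
    qed
    have "(\<lambda>n. ((1 + sqrt (real n)) * (1 + B) + (real n * v + X * K) / sqrt (real n) + X * K) / real n) \<longlonglongrightarrow> 0"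
      by real_asymp
    then have "(\<lambda>n. a n / real n - v) \<longlonglongrightarrow> 0"
      by (rule Lim_null_comparison[rotated]) (use diff in simp)
    then have "(\<lambda>n. a n / real n) \<longlonglongrightarrow> v" by (simp add: LIM_zero_iff)
    then show ?thesis using alim LIMSEQ_unique by blast
  qed
  have L2: "centered_cocycle \<mu> S_borel act D K \<theta> x\<^sub>0 (twist l \<psi>) (\<lambda>g. c * (2 + 4 * ln (Nmat g))) p s2 chi X"
    by (intro centered_cocycle.intro L1 centered_cocycle_axioms.intro)
      (use cen chi chi3 s2(2) v_eq in auto)
  obtain C where C: "0 \<le> C" "\<And>n u. 1 \<le> n \<Longrightarrow>
    \<bar>measure (mconv \<mu> n) {h \<in> Gset. mart l \<psi> x\<^sub>0 n h \<le> u * sqrt (real n)} - cdf std_normal_distribution (u / sqrt s2)\<bar>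
      \<le> C * real n powr (1 - p / 2)"
  proof (rule mart_berry_esseen[OF L2 psim], goal_cases)
    case (1 C)
    show ?thesis by (rule 1(1)[OF 1(2)]) (rule 1(3))
  qed
  have meas: "measure M {\<omega> \<in> space M. Z n \<omega> \<le> u * sqrt (real n)} = measure (mconv \<mu> n) {h \<in> Gset. mart l \<psi> x\<^sub>0 n h \<le> u * sqrt (real n)}" for n u
  proof -
    note [measurable] = mart_measurable[OF psim x0]
    let ?S = "{h \<in> space G_borel. mart l \<psi> x\<^sub>0 n h \<le> u * sqrt (real n)}"
    have "?S \<in> sets G_borel" by measurable
    then have "measure (mconv \<mu> n) ?S = measure M (A n -` ?S \<inter> space M)"
      unfolding A_law[symmetric] by (rule measure_distr[OF A_measurable])
    also have "A n -` ?S \<inter> space M = {\<omega> \<in> space M. Z n \<omega> \<le> u * sqrt (real n)}"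
      by (auto simp: Z_def A_Gset)
    finally show ?thesis by simp
  qed
  show thesis
  proof (rule that[of Z U B C])
    show "\<bar>ln a - real n * lam - Z n \<omega>\<bar> \<le> U n \<omega>"
      if "\<omega> \<in> space M" "vmin (A n \<omega>) \<le> a" "a \<le> opnorm (A n \<omega>)" for n \<omega> a
      using close[OF that] by (simp only: l_eq)
    show "\<bar>measure M {\<omega> \<in> space M. Z n \<omega> \<le> u * sqrt (real n)} - cdf std_normal_distribution (u / sqrt s2)\<bar>
      \<le> C * real n powr (1 - p / 2)" if "1 \<le> n" for n u
      unfolding meas by (rule C(2)[OF that])
  qed (fact Zm Um Bnn Uq C(1) | rule U0, assumption)+
qed

text \<open>Every measurable functional between \<open>vmin\<close> and \<open>opnorm\<close> is
  within the same error \<open>U\<close> of the martingale, so one argument serves both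
  conclusions.\<close>

theorem berry_esseen_between:
  assumes contr: "strictly_contracting \<mu>" and p: "2 < p" "p < 3" and q: "p \<le> q" "q \<le> max p ((p - 2) / (3 - p))"
    and mom: "has_moment \<mu> p" and amom: "almost_has_moment \<mu> q"
    and W0: "\<And>\<omega>. \<omega> \<in> space M \<Longrightarrow> W\<^sub>0 \<omega> \<in> Splus"
    and lam: "AE \<omega> in M. (\<lambda>n. ln (opnorm (A n \<omega>)) / real n) \<longlonglongrightarrow> lam"
    and s2: "(\<lambda>n. (LINT \<omega>|M. (cocycle (A n \<omega>) (W\<^sub>0 \<omega>) - real n * lam)\<^sup>2) / real n) \<longlonglongrightarrow> s2" "0 < s2"
    and k: "k \<in> borel_measurable G_borel" "\<And>g. g \<in> Gset \<Longrightarrow> vmin g \<le> k g" "\<And>g. g \<in> Gset \<Longrightarrow> k g \<le> opnorm g"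
  shows "(\<lambda>n. SUP t. \<bar>measure M {\<omega> \<in> space M. ln (k (A n \<omega>)) - real n * lam \<le> t * sqrt (real n)}
      - cdf std_normal_distribution (t / sqrt s2)\<bar>) \<in> O(rate p q)"
proof -
  obtain Z U C B where
    Zm[measurable]: "\<And>n. Z n \<in> borel_measurable M" and Um[measurable]: "\<And>n. U n \<in> borel_measurable M"
    and close: "\<And>n \<omega> a. \<omega> \<in> space M \<Longrightarrow> vmin (A n \<omega>) \<le> a \<Longrightarrow> a \<le> opnorm (A n \<omega>) \<Longrightarrow> \<bar>ln a - real n * lam - Z n \<omega>\<bar> \<le> U n \<omega>"
    and U0: "\<And>n \<omega>. \<omega> \<in> space M \<Longrightarrow> 0 \<le> U n \<omega>"
    and B: "0 \<le> B" "\<And>n. (\<integral>\<^sup>+\<omega>. ennreal (U n \<omega> powr q) \<partial>M) \<le> ennreal B"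
    and C: "0 \<le> C" "\<And>n u. 1 \<le> n \<Longrightarrow> \<bar>measure M {\<omega> \<in> space M. Z n \<omega> \<le> u * sqrt (real n)} - cdf std_normal_distribution (u / sqrt s2)\<bar>
      \<le> C * real n powr (1 - p / 2)"
  proof (rule martingale_approximation[OF contr p q(1) mom amom W0 lam s2], goal_cases)
    case (2 Z U B C)
    show ?thesis by (rule 2(1)[OF 2(2,3)]) (rule 2(4-); assumption)+
  qed
  have q0: "0 < q" using p q by linarith
  have [measurable]: "(\<lambda>\<omega>. k (A n \<omega>)) \<in> borel_measurable M" for n
    by (rule measurable_compose[OF A_measurable k(1)])
  \<comment> \<open>Markov's inequality for the moment of order q, which is bounded uniformly in
    n.\<close>
  have tail: "measure M {\<omega> \<in> space M. \<tau> < U n \<omega>} \<le> B * \<tau> powr (- q)" if t: "0 < \<tau>" for \<tau> n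
  proof -
    have "ennreal (\<tau> powr q * measure M {\<omega> \<in> space M. \<tau> < U n \<omega>})
      = ennreal (\<tau> powr q) * emeasure M {\<omega> \<in> space M. \<tau> < U n \<omega>}"
      by (simp add: ennreal_mult M.emeasure_eq_measure)
    also have "\<dots> = (\<integral>\<^sup>+\<omega>. ennreal (\<tau> powr q) * indicator {\<omega> \<in> space M. \<tau> < U n \<omega>} \<omega> \<partial>M)"
      by (rule nn_integral_cmult_indicator[symmetric]) measurable
    also have "\<dots> \<le> (\<integral>\<^sup>+\<omega>. ennreal (U n \<omega> powr q) \<partial>M)"
      using t q0 by (intro nn_integral_mono) (auto simp: indicator_def intro!: ennreal_leI powr_mono2)
    also have "\<dots> \<le> ennreal B" by (rule B)
    finally have "\<tau> powr q * measure M {\<omega> \<in> space M. \<tau> < U n \<omega>} \<le> B" using B(1) by simp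
    then show ?thesis using t by (simp add: powr_minus field_simps)
  qed
  let ?G = "\<lambda>t. cdf std_normal_distribution (t / sqrt s2)"
  have G: "\<bar>?G x - ?G y\<bar> \<le> 1 / sqrt s2 * \<bar>x - y\<bar>" for x y
  proof -
    have "\<bar>?G x - ?G y\<bar> \<le> 1 * \<bar>x / sqrt s2 - y / sqrt s2\<bar>" by (rule std_normal_cdf_lipschitz)
    also have "\<dots> = 1 / sqrt s2 * \<bar>x - y\<bar>" using s2(2) by (simp add: abs_divide flip: diff_divide_distrib)
    finally show ?thesis .
  qed
  show ?thesis
  proof (rule sup_bigo[where C = "C + B + 1 / sqrt s2"])
    show "0 \<le> rate p q n" for n by (simp add: rate_def)
    fix n :: nat and t :: real assume n: "1 \<le> n"
    have n0: "0 < real n" using n by simp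
    let ?e = "- (q / (2 * (q + 1)))"
    \<comment> \<open>The solution of \<open>\<tau> powr (- q) = \<tau> / sqrt (real n)\<close>,
      which equalises the tail and the shift.\<close>
    define \<tau> where "\<tau> = real n powr (1 / (2 * (q + 1)))"
    have t0: "0 < \<tau>" using n0 by (simp add: \<tau>_def)
    have "\<bar>measure M {\<omega> \<in> space M. ln (k (A n \<omega>)) - real n * lam \<le> t * sqrt (real n)} - ?G t\<bar>
        \<le> C * real n powr (1 - p / 2) + B * \<tau> powr (- q) + 1 / sqrt s2 * (\<tau> / sqrt (real n))"
    proof (rule M.kolmogorov_transfer[where Z = "Z n" and U = "U n"])
      show "\<bar>ln (k (A n \<omega>)) - real n * lam - Z n \<omega>\<bar> \<le> U n \<omega>" if "\<omega> \<in> space M" for \<omega>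
        by (intro close that k A_Gset)
      show "0 < sqrt (real n)" "0 \<le> \<tau>" using n0 t0 by auto
    qed (use C(2)[OF n] tail[OF t0] G in \<open>measurable\<close>)
    also have "\<tau> powr (- q) = real n powr ?e" by (simp add: \<tau>_def powr_powr)
    also have "\<tau> / sqrt (real n) = real n powr ?e"
    proof -
      have "\<tau> / sqrt (real n) = real n powr (1 / (2 * (q + 1)) - 1 / 2)"
        using n0 by (simp add: \<tau>_def powr_diff powr_half_sqrt)
      also have "1 / (2 * (q + 1)) - 1 / 2 = ?e" using q0 by (simp add: field_simps)
      finally show ?thesis .
    qed
    also have "C * real n powr (1 - p / 2) + B * real n powr ?e + 1 / sqrt s2 * real n powr ?e
        \<le> C * rate p q n + B * rate p q n + 1 / sqrt s2 * rate p q n"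
      using B C s2(2) by (intro add_mono mult_left_mono rate_dominates p q n) auto
    also have "\<dots> = (C + B + 1 / sqrt s2) * rate p q n" by (simp add: algebra_simps)
    finally show "\<bar>measure M {\<omega> \<in> space M. ln (k (A n \<omega>)) - real n * lam \<le> t * sqrt (real n)} - ?G t\<bar>
        \<le> (C + B + 1 / sqrt s2) * rate p q n" .
  qed
qed

end

theorem proposition7p2:
  fixes \<mu> :: "(real ^ 'n ^ 'n) measure"
    and \<nu> :: "(real ^ 'n) measure"
    and M :: "'a measure"
    and Y :: "nat \<Rightarrow> 'a \<Rightarrow> real ^ 'n ^ 'n"
    and W\<^sub>0 :: "'a \<Rightarrow> real ^ 'n"
    and p q lam s2 :: real
  defines "A \<equiv> \<lambda>n \<omega>. left_prod (\<lambda>k. Y k \<omega>) n"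
    and "\<Phi> \<equiv> cdf std_normal_distribution"
  assumes "CARD('n) \<ge> 2"
    and "2 < p" "p < 3"
    and "p \<le> q" "q \<le> max p ((p - 2) / (3 - p))"
    and "prob_space \<mu>" "sets \<mu> = sets G_borel"
    and "strictly_contracting \<mu>"
    and "has_moment \<mu> p"
    and "almost_has_moment \<mu> q"
    and "invariant_prob \<mu> \<nu>"
    and "prob_space M"
    and "prob_space.indep_vars M (\<lambda>_. G_borel) Y {1..}"
    and "\<And>n. 1 \<le> n \<Longrightarrow> distr M G_borel (Y n) = \<mu>"
    and "indep_rv M Splus_borel W\<^sub>0
           (\<Pi>\<^sub>M n\<in>{1..}. G_borel) (\<lambda>\<omega>. \<lambda>n\<in>{1..}. Y n \<omega>)"
    and "distr M Splus_borel W\<^sub>0 = \<nu>"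
    and "AE \<omega> in M. (\<lambda>n. ln (opnorm (A n \<omega>)) / real n) \<longlonglongrightarrow> lam"
    and "(\<lambda>n. (LINT \<omega>|M. (cocycle (A n \<omega>) (W\<^sub>0 \<omega>) - real n * lam)\<^sup>2) / real n) \<longlonglongrightarrow> s2"
    and "s2 > 0"
  shows "(\<lambda>n. SUP t. \<bar>measure M {\<omega> \<in> space M. ln (vmin (A n \<omega>)) - real n * lam \<le> t * sqrt (real n)}
                      - \<Phi> (t / sqrt s2)\<bar>) \<in> O(rate p q)
       \<and> (\<lambda>n. SUP t. \<bar>measure M {\<omega> \<in> space M. ln (spec_rad (A n \<omega>)) - real n * lam \<le> t * sqrt (real n)}
                      - \<Phi> (t / sqrt s2)\<bar>) \<in> O(rate p q)"
proof -
  interpret W: matrix_walk \<mu> M Y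
    using assms by (intro matrix_walk.intro matrix_law.intro matrix_law_axioms.intro matrix_walk_axioms.intro)
  have A: "A = W.A" unfolding A_def W.A_def[abs_def] ..
  have W0: "W\<^sub>0 \<omega> \<in> Splus" if "\<omega> \<in> space M" for \<omega>
  proof -
    have "W\<^sub>0 \<in> M \<rightarrow>\<^sub>M Splus_borel" using \<open>indep_rv M Splus_borel W\<^sub>0 _ _\<close> unfolding indep_rv_def by blast
    from measurable_space[OF this that] show ?thesis by (simp add: Splus_borel_def space_measure_of_conv)
  qed
  have lim1: "AE \<omega> in M. (\<lambda>n. ln (opnorm (W.A n \<omega>)) / real n) \<longlonglongrightarrow> lam"
    using \<open>AE \<omega> in M. _ \<omega>\<close> unfolding A .
  have lim2: "(\<lambda>n. (LINT \<omega>|M. (cocycle (W.A n \<omega>) (W\<^sub>0 \<omega>) - real n * lam)\<^sup>2) / real n) \<longlonglongrightarrow> s2"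
    using \<open>_ \<longlonglongrightarrow> s2\<close> unfolding A .
  note BE = W.berry_esseen_between[OF \<open>strictly_contracting \<mu>\<close> \<open>2 < p\<close> \<open>p < 3\<close> \<open>p \<le> q\<close> \<open>q \<le> _\<close>
    \<open>has_moment \<mu> p\<close> \<open>almost_has_moment \<mu> q\<close> W0 lim1 lim2 \<open>s2 > 0\<close>]
  \<comment> \<open>\<open>vmin\<close> is the lower end of the admissible range;
    \<open>spec_rad\<close> lies inside it by the Perron-Frobenius bounds.\<close>
  show ?thesis unfolding A \<Phi>_def
    by (intro conjI BE vmin_measurable spec_rad_measurable vmin_le_opnorm spec_rad_bounds order_refl)
qed

end
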